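(* Let $\Psi:(0,\infty)\times(0,\infty)\to[0,\infty)$ be a measurable function for which there exist $\beta>0$ and $k>0$ such that $\Psi(\zeta,\eta)=\Psi(\eta,\zeta)$ for all $(\zeta,\eta)\in(0,\infty)^2$ and $\Psi(\zeta,\eta)\le k(\zeta\eta)^{-\beta}$ for $(\zeta,\eta)\in(0,1)^2$, $\Psi(\zeta,\eta)\le k\,\eta\,\zeta^{-\beta}$ for $(\zeta,\eta)\in(0,1)\times(1,\infty)$, and $\Psi(\zeta,\eta)\le k(\zeta+\eta)$ for $(\zeta,\eta)\in(1,\infty)^2$. Let $g^{in}\in L^1_{-2\beta,1}(0,\infty)$ with $g^{in}\ge 0$ a.e. Then there exists at least one weak solution $g$ to the Smoluchowski coagulation equation with kernel $\Psi$ and initial condition $g^{in}$ on $[0,\infty)$ which is mass-conserving, i.e. $\int_0^\infty \zeta g(\zeta,t)\,d\zeta=\int_0^\infty \zeta g^{in}(\zeta)\,d\zeta$ for all $t\ge 0$.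
   Context: $L^1_{-2\beta,1}(0,\infty):=L^1((0,\infty);(\zeta^{-2\beta}+\zeta)d\zeta)$. The Smoluchowski coagulation equation is $\partial_t g(\zeta,t)=\frac12\int_0^\zeta \Psi(\zeta-\eta,\eta)g(\zeta-\eta,t)g(\eta,t)d\eta-\int_0^\infty\Psi(\zeta,\eta)g(\zeta,t)g(\eta,t)d\eta$, $g(\zeta,0)=g^{in}(\zeta)$. For $T\in(0,\infty]$, a weak solution on $[0,T)$ is a non-negative function $g\in\mathcal{C}([0,T);L^1(0,\infty))\cap L^\infty(0,T;L^1_{-2\beta,1}(0,\infty))$ such that for every $t\in(0,T)$ and every $\omega\in L^\infty(0,\infty)$, $\int_0^\infty[g(\zeta,t)-g^{in}(\zeta)]\omega(\zeta)d\zeta=\frac12\int_0^t\int_0^\infty\int_0^\infty\tilde\omega(\zeta,\eta)\Psi(\zeta,\eta)g(\zeta,s)g(\eta,s)d\eta d\zeta ds$, where $\tilde\omega(\zeta,\eta):=\omega(\zeta+\eta)-\omega(\zeta)-\omega(\eta)$. *)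

theory Defs
  imports "HOL-Analysis.Analysis"
begin

definition weighted_L1 :: "real \<Rightarrow> (real \<Rightarrow> real) \<Rightarrow> bool" where
  "weighted_L1 \<beta> f \<longleftrightarrow>
     set_integrable lborel {0<..} (\<lambda>x. (x powr (-2*\<beta>) + x) * f x)"

definition weighted_norm :: "real \<Rightarrow> (real \<Rightarrow> real) \<Rightarrow> real" where
  "weighted_norm \<beta> f =
     set_lebesgue_integral lborel {0<..} (\<lambda>x. (x powr (-2*\<beta>) + x) * \<bar>f x\<bar>)"

definition weak_solution ::
  "(real \<Rightarrow> real \<Rightarrow> real) \<Rightarrow> real \<Rightarrow> (real \<Rightarrow> real) \<Rightarrow> (real \<Rightarrow> real \<Rightarrow> real) \<Rightarrow> bool" where
  "weak_solution \<Psi> \<beta> gin g \<longleftrightarrow>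
     (\<lambda>(z, t). g z t) \<in> borel_measurable (restrict_space (lborel \<Otimes>\<^sub>M lborel) ({0<..} \<times> {0..})) \<and>
     (\<forall>t\<ge>0. AE z in lborel. z > 0 \<longrightarrow> g z t \<ge> 0) \<and>
     (\<forall>t\<ge>0. set_integrable lborel {0<..} (\<lambda>z. g z t)) \<and>
     (\<forall>t\<ge>0. ((\<lambda>s. set_lebesgue_integral lborel {0<..} (\<lambda>z. \<bar>g z s - g z t\<bar>)) \<longlongrightarrow> 0)
                (at t within {0..})) \<and>
     (\<exists>C. AE t in lborel. t \<ge> 0 \<longrightarrow>
            weighted_L1 \<beta> (\<lambda>z. g z t) \<and> weighted_norm \<beta> (\<lambda>z. g z t) \<le> C) \<and>
     (\<forall>t>0. \<forall>\<omega>. (\<omega> \<in> borel_measurable (restrict_space lborel {0<..}) \<and>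
                  (\<exists>B. AE x in lborel. x > 0 \<longrightarrow> \<bar>\<omega> x\<bar> \<le> B)) \<longrightarrow>
        (set_integrable (lborel \<Otimes>\<^sub>M (lborel \<Otimes>\<^sub>M lborel)) ({0<..<t} \<times> ({0<..} \<times> {0<..}))
           (\<lambda>(s, z, e). (\<omega> (z + e) - \<omega> z - \<omega> e) * \<Psi> z e * g z s * g e s) \<and>
         set_lebesgue_integral lborel {0<..} (\<lambda>z. (g z t - gin z) * \<omega> z) =
         1/2 * set_lebesgue_integral (lborel \<Otimes>\<^sub>M (lborel \<Otimes>\<^sub>M lborel)) ({0<..<t} \<times> ({0<..} \<times> {0<..}))
           (\<lambda>(s, z, e). (\<omega> (z + e) - \<omega> z - \<omega> e) * \<Psi> z e * g z s * g e s)))"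

end

theory Submission
  imports Defs
begin

text \<open>The equation is approximated by an explicit Euler scheme with kernel \<open>min K n\<close> and a step so small
  that positivity is kept. As \<open>x powr (-2 * \<beta>)\<close> is decreasing, its moment does not grow along the scheme,
  while the first moment is constant; moreover the large sizes carry uniformly little mass and the family is
  uniformly integrable, because translations preserve Lebesgue measure. Hence the approximations converge weakly
  in L1, at all times simultaneously along one filter. Uniform integrability passes to
  tensor squares, which gives convergence of the quadratic term for a merely measurable kernel, and
  equicontinuity in time gives convergence of its time integral. Uniform smallness of the tails of the first
  moment yields conservation of mass.\<close>

section \<open>Equi-small families of integrable functions\<close>

text \<open>The proof lives on a surplus at small sizes and has its obstacle at large ones. The
  kernel is dominated by \<open>wt b x * wt b y\<close>, with a singularity of order -b, while the
  moment of order -2 * b is under control. Below 1/r this gains a factor r^(-b), so small sizes can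
  be removed from the kernel at a cost uniform in the approximation. At large sizes the kernel may
  grow linearly, and the datum has no moment above the first from which decay of the tails could be
  read off. What helps is that a collision of \<open>x\<close> with a smaller \<open>y\<close>
  changes \<open>max 0 (x - 2 * r)\<close> by at most \<open>y\<close>, while
  \<open>y * K x y\<close> is at most a constant times \<open>x * wt b y\<close>. Apart from its
  initial value, the tail beyond 4 r is therefore fed only by the tail beyond r, and smallness is
  passed from scale to scale. Between the two cut-offs the kernel is bounded and eventually
  untouched by the truncation, so weak convergence has to be exploited only for one fixed bounded
  kernel at a time.\<close>

lemma integrable_bounded_times:
  fixes f :: "'a \<Rightarrow> real"
  assumes f: "integrable M f" and \<phi>: "\<phi> \<in> borel_measurable M"
    and B: "\<And>x. x \<in> space M \<Longrightarrow> \<bar>\<phi> x\<bar> \<le> B"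
  shows "integrable M (\<lambda>x. \<phi> x * f x)"
proof (rule Bochner_Integration.integrable_bound)
  show "integrable M (\<lambda>x. B * f x)" using f by simp
  show "(\<lambda>x. \<phi> x * f x) \<in> borel_measurable M" using f \<phi> by measurable
  show "AE x in M. norm (\<phi> x * f x) \<le> norm (B * f x)"
    by (rule AE_I2) (auto simp: abs_mult intro!: mult_right_mono dest: B)
qed

lemma abs_integral_bounded_times:
  fixes f :: "'a \<Rightarrow> real"
  assumes f: "integrable M f" "\<And>x. 0 \<le> f x" and \<phi>: "\<phi> \<in> borel_measurable M"
    and B: "\<And>x. x \<in> space M \<Longrightarrow> \<bar>\<phi> x\<bar> \<le> B"
  shows "\<bar>LINT x|M. \<phi> x * f x\<bar> \<le> B * (LINT x|M. f x)"
proof -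
  have "\<bar>LINT x|M. \<phi> x * f x\<bar> \<le> (LINT x|M. \<bar>\<phi> x * f x\<bar>)"
    by (rule integral_abs_bound)
  also have "\<dots> \<le> (LINT x|M. B * f x)"
  proof (rule integral_mono)
    show "integrable M (\<lambda>x. \<bar>\<phi> x * f x\<bar>)"
      by (rule integrable_abs[OF integrable_bounded_times[OF f(1) \<phi> B]])
    show "integrable M (\<lambda>x. B * f x)" using f(1) by simp
    show "\<bar>\<phi> x * f x\<bar> \<le> B * f x" if "x \<in> space M" for x
      using B[OF that] f(2)[of x] by (simp add: abs_mult mult_right_mono)
  qed
  finally show ?thesis by simp
qed

abbreviation int_on :: "'a measure \<Rightarrow> 'a set \<Rightarrow> ('a \<Rightarrow> real) \<Rightarrow> real" where
  "int_on M A f \<equiv> LINT x|M. indicator A x * f x"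

lemma integrable_indicator_times:
  fixes f :: "'a \<Rightarrow> real"
  assumes "integrable M f" "A \<in> sets M"
  shows "integrable M (\<lambda>x. indicator A x * f x)"
  using assms by (intro integrable_bounded_times[where B=1]) (auto simp: indicator_def)

text \<open>The test function \<open>sgn (f x - g x)\<close> attains the L1 distance. Weak estimates
  that are uniform over the unit ball of bounded functions thereby become strong ones, which is how
  Lipschitz continuity in time is obtained in L1.\<close>

lemma integral_abs_diff_le:
  fixes f g :: "'a \<Rightarrow> real"
  assumes f: "integrable M f" and g: "integrable M g"
    and le: "\<And>\<omega>. \<omega> \<in> borel_measurable M \<Longrightarrow> (\<And>x. \<bar>\<omega> x\<bar> \<le> 1) \<Longrightarrow>
      (LINT x|M. \<omega> x * f x) - (LINT x|M. \<omega> x * g x) \<le> C"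
  shows "(LINT x|M. \<bar>f x - g x\<bar>) \<le> C"
proof -
  define \<omega> where "\<omega> = (\<lambda>x. sgn (f x - g x))"
  have [measurable]: "f \<in> borel_measurable M" "g \<in> borel_measurable M" using f g by auto
  have \<omega>: "\<omega> \<in> borel_measurable M" "\<And>x. \<bar>\<omega> x\<bar> \<le> 1"
    unfolding \<omega>_def by measurable[1] (simp add: sgn_if)
  have "(LINT x|M. \<bar>f x - g x\<bar>) = (LINT x|M. \<omega> x * f x - \<omega> x * g x)"
    unfolding \<omega>_def by (intro Bochner_Integration.integral_cong) (auto simp: sgn_if)
  also have "\<dots> = (LINT x|M. \<omega> x * f x) - (LINT x|M. \<omega> x * g x)"
    using integrable_bounded_times[OF f \<omega>] integrable_bounded_times[OF g \<omega>] by simp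
  finally show ?thesis using le[OF \<omega>] by simp
qed

text \<open>Rounding a bounded test function down to a grid of width 1/m leaves finitely many level
  sets, and the convergence on sets applies to each of them. The rounding error is at most C/m
  uniformly along \<open>F\<close>, because all total integrals are bounded by
  \<open>C\<close>.\<close>

lemma tendsto_integral_bounded_times:
  fixes f :: "'i \<Rightarrow> 'a \<Rightarrow> real"
  assumes f: "\<And>n. integrable M (f n)" "\<And>n x. 0 \<le> f n x" "\<And>n. (LINT x|M. f n x) \<le> C"
    and g: "integrable M g" "\<And>x. 0 \<le> g x" "(LINT x|M. g x) \<le> C"
    and lim: "\<And>A. A \<in> sets M \<Longrightarrow>
      ((\<lambda>n. int_on M A (f n)) \<longlongrightarrow> int_on M A g) F"
    and \<phi>[measurable]: "\<phi> \<in> borel_measurable M" and B: "\<And>x. x \<in> space M \<Longrightarrow> \<bar>\<phi> x\<bar> \<le> B"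
  shows "((\<lambda>n. LINT x|M. \<phi> x * f n x) \<longlongrightarrow> (LINT x|M. \<phi> x * g x)) F"
proof (rule tendstoI)
  fix e :: real assume e: "e > 0"
  have C: "C \<ge> 0" using g by (meson Bochner_Integration.integral_nonneg order_trans)
  obtain m :: nat where m: "m > 3 * C / e" using reals_Archimedean2 by blast
  have m0: "real m > 0" using le_less_trans[OF _ m, of 0] C e by simp
  have Cm: "C / m < e / 3" using m m0 e by (simp add: field_simps)
  define \<psi> where "\<psi> = (\<lambda>x. real_of_int \<lfloor>m * \<phi> x\<rfloor> / m)"
  \<comment> \<open>Rounding down may fall below \<open>- m * B\<close> by less than 1; the extra 1
    keeps every occurring integer in \<open>{-L..L}\<close>.\<close>
  define L where "L = \<lceil>m * B\<rceil> + 1"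
  define A where "A = (\<lambda>i::int. {x \<in> space M. \<lfloor>m * \<phi> x\<rfloor> = i})"
  have [measurable]: "\<psi> \<in> borel_measurable M" unfolding \<psi>_def by measurable
  have A[measurable]: "A i \<in> sets M" for i unfolding A_def by measurable
  have \<psi>\<phi>: "\<bar>\<phi> x - \<psi> x\<bar> \<le> 1 / m" for x
  proof -
    have "\<bar>m * \<phi> x - real_of_int \<lfloor>m * \<phi> x\<rfloor>\<bar> \<le> 1" by linarith
    then have "\<bar>(m * \<phi> x - real_of_int \<lfloor>m * \<phi> x\<rfloor>) / m\<bar> \<le> 1 / m"
      using m0 by (simp add: divide_le_cancel)
    then show ?thesis unfolding \<psi>_def using m0 by (simp add: diff_divide_distrib)
  qed
  have \<psi>_eq: "\<psi> x = (\<Sum>i\<in>{-L..L}. real_of_int i / m * indicator (A i) x)" if x: "x \<in> space M" for x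
  proof -
    have "\<bar>m * \<phi> x\<bar> \<le> m * B" using B[OF x] m0 by (simp add: abs_mult)
    then have L: "\<lfloor>m * \<phi> x\<rfloor> \<in> {-L..L}" unfolding L_def by (auto; linarith)
    have "(\<Sum>i\<in>{-L..L}. real_of_int i / m * indicator (A i) x) =
        (\<Sum>i\<in>{-L..L}. if i = \<lfloor>m * \<phi> x\<rfloor> then real_of_int i / m else 0)"
      using x by (intro sum.cong) (auto simp: A_def indicator_def)
    also have "\<dots> = \<psi> x" using L by (simp add: \<psi>_def)
    finally show ?thesis by simp
  qed
  have \<psi>_int: "(LINT x|M. \<psi> x * h x) = (\<Sum>i\<in>{-L..L}. real_of_int i / m * int_on M (A i) h)"
    if h: "integrable M h" for h :: "'a \<Rightarrow> real"
  proof -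
    have "(LINT x|M. \<psi> x * h x) = (LINT x|M. (\<Sum>i\<in>{-L..L}. real_of_int i / m * (indicator (A i) x * h x)))"
      by (intro Bochner_Integration.integral_cong) (auto simp: \<psi>_eq sum_distrib_right mult.assoc)
    also have "\<dots> = (\<Sum>i\<in>{-L..L}. real_of_int i / m * int_on M (A i) h)"
      using integrable_indicator_times[OF h A] by (subst Bochner_Integration.integral_sum) auto
    finally show ?thesis .
  qed
  have "((\<lambda>n. LINT x|M. \<psi> x * f n x) \<longlongrightarrow> (LINT x|M. \<psi> x * g x)) F"
    unfolding \<psi>_int[OF f(1)] \<psi>_int[OF g(1)] by (intro tendsto_intros lim A)
  then have "eventually (\<lambda>n. dist (LINT x|M. \<psi> x * f n x) (LINT x|M. \<psi> x * g x) < e / 3) F"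
    using e by (intro tendstoD) auto
  moreover have err: "\<bar>(LINT x|M. \<phi> x * h x) - (LINT x|M. \<psi> x * h x)\<bar> < e / 3"
    if h: "integrable M h" "\<And>x. 0 \<le> h x" "(LINT x|M. h x) \<le> C" for h :: "'a \<Rightarrow> real"
  proof -
    have i1: "integrable M (\<lambda>x. \<phi> x * h x)" by (rule integrable_bounded_times[OF h(1) \<phi> B])
    have i2: "integrable M (\<lambda>x. (\<phi> x - \<psi> x) * h x)"
      using \<psi>\<phi> by (intro integrable_bounded_times[OF h(1)]) auto
    have i3: "integrable M (\<lambda>x. \<psi> x * h x)"
      using Bochner_Integration.integrable_diff[OF i1 i2] by (simp add: algebra_simps)
    have "\<bar>(LINT x|M. \<phi> x * h x) - (LINT x|M. \<psi> x * h x)\<bar> = \<bar>LINT x|M. (\<phi> x - \<psi> x) * h x\<bar>"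
      using i1 i3 by (simp add: algebra_simps)
    also have "\<dots> \<le> 1 / m * (LINT x|M. h x)"
      using \<psi>\<phi> by (intro abs_integral_bounded_times h) auto
    also have "\<dots> \<le> 1 / m * C" using h(3) by (intro mult_left_mono) auto
    also have "\<dots> < e / 3" using Cm by simp
    finally show ?thesis .
  qed
  ultimately show "eventually (\<lambda>n. dist (LINT x|M. \<phi> x * f n x) (LINT x|M. \<phi> x * g x) < e) F"
  proof (elim eventually_mono)
    fix n assume "dist (LINT x|M. \<psi> x * f n x) (LINT x|M. \<psi> x * g x) < e / 3"
    then show "dist (LINT x|M. \<phi> x * f n x) (LINT x|M. \<phi> x * g x) < e"
      using err[OF f(1,2,3), of n] err[OF g] unfolding dist_real_def by linarith
  qed
qed

text \<open>Uniform integrability as in the Dunford-Pettis criterion, in the form of continuity at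
  the empty set that is uniform in the index. On a space of infinite measure decreasing sets may
  also escape to infinity, so this one condition excludes concentration as well as loss of mass at
  infinity. The families are nonnegative, hence no absolute value.\<close>

definition equi_small :: "'a measure \<Rightarrow> ('i \<Rightarrow> 'a \<Rightarrow> real) \<Rightarrow> bool" where
  "equi_small M f \<longleftrightarrow> (\<forall>A::nat \<Rightarrow> 'a set. range A \<subseteq> sets M \<longrightarrow> decseq A \<longrightarrow> (\<Inter>i. A i) = {} \<longrightarrow>
     (\<forall>e>0. \<exists>i. \<forall>n. int_on M (A i) (f n) \<le> e))"

lemma equi_smallD:
  assumes "equi_small M f" "\<And>i. A i \<in> sets M" "decseq A" "(\<Inter>i. A i) = {}" "e > 0"
  obtains i :: nat where "\<And>n. int_on M (A i) (f n) \<le> e"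
  using assms unfolding equi_small_def by blast

lemma tendsto_integral_decseq:
  fixes g :: "'a \<Rightarrow> real"
  assumes g: "integrable M g" and A: "\<And>i. A i \<in> sets M" "decseq A" "(\<Inter>i. A i) = {}"
  shows "(\<lambda>i. int_on M (A i) g) \<longlonglongrightarrow> 0"
proof -
  have "(\<lambda>i. int_on M (A i) g) \<longlonglongrightarrow> (LINT x|M. 0)"
  proof (rule integral_dominated_convergence[where w="\<lambda>x. \<bar>g x\<bar>"])
    show "AE x in M. (\<lambda>i. indicator (A i) x * g x) \<longlonglongrightarrow> 0"
    proof (rule AE_I2)
      fix x
      have "(\<lambda>i. indicator (A i) x :: real) \<longlonglongrightarrow> indicator (\<Inter>i. A i) x"
        by (rule LIMSEQ_indicator_decseq[OF A(2)])
      then have "(\<lambda>i. indicator (A i) x * g x) \<longlonglongrightarrow> 0 * g x"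
        using A(3) by (intro tendsto_mult tendsto_const) auto
      then show "(\<lambda>i. indicator (A i) x * g x) \<longlonglongrightarrow> 0" by simp
    qed
  qed (use g A in \<open>auto simp: indicator_def\<close>)
  then show ?thesis by simp
qed

text \<open>Complements are handled by the total integrals. For a disjoint union, finitely many
  members converge and the remainder has to be small uniformly in \<open>n\<close>; equi-smallness
  supplies exactly this, as the remainders of a disjoint sequence decrease to the empty set.\<close>

lemma tendsto_integral_sets_Dynkin:
  fixes f :: "'i \<Rightarrow> 'a \<Rightarrow> real"
  assumes f: "\<And>n. integrable M (f n)" "\<And>n x. 0 \<le> f n x"
    and g: "integrable M g" "\<And>x. 0 \<le> g x"
    and tot: "((\<lambda>n. LINT x|M. f n x) \<longlongrightarrow> (LINT x|M. g x)) F"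
    and small: "equi_small M f"
    and G: "Int_stable G" "G \<subseteq> Pow (space M)" "sets M = sigma_sets (space M) G"
    and lim: "\<And>A. A \<in> G \<Longrightarrow>
      ((\<lambda>n. int_on M A (f n)) \<longlongrightarrow> int_on M A g) F"
    and A: "A \<in> sets M"
  shows "((\<lambda>n. int_on M A (f n)) \<longlongrightarrow> int_on M A g) F"
  using G(1,2) A[unfolded G(3)]
proof (induction rule: sigma_sets_induct_disjoint)
  case (basic A) then show ?case by (rule lim)
next
  case empty then show ?case by simp
next
  case (compl A)
  then have A: "A \<in> sets M" using G(3) by simp
  have eq: "int_on M (space M - A) h = (LINT x|M. h x) - int_on M A h"
    if "integrable M h" for h :: "'a \<Rightarrow> real"
  proof -
    have "int_on M (space M - A) h = (LINT x|M. h x - indicator A x * h x)"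
      by (intro Bochner_Integration.integral_cong) (auto simp: indicator_def)
    then show ?thesis using integrable_indicator_times[OF that A] that by simp
  qed
  show ?case unfolding eq[OF f(1)] eq[OF g(1)] by (intro tendsto_intros tot compl)
next
  case (union A)
  then have A[measurable]: "A i \<in> sets M" for i using G(3) by auto
  define D where "D = (\<lambda>k::nat. \<Union>i\<in>{k..}. A i)"
  have D[measurable]: "D k \<in> sets M" for k unfolding D_def by measurable
  have dec: "decseq D" unfolding D_def decseq_def by fastforce
  have D0: "(\<Inter>k. D k) = {}"
  proof (rule ccontr)
    assume "(\<Inter>k. D k) \<noteq> {}"
    then obtain x where x: "\<And>k. x \<in> D k" by auto
    then obtain i where i: "x \<in> A i" unfolding D_def by blast
    obtain j where "j \<ge> Suc i" "x \<in> A j" using x[of "Suc i"] unfolding D_def by blast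
    then show False using i \<open>disjoint_family A\<close> unfolding disjoint_family_on_def
      by (metis IntI UNIV_I empty_iff not_less_eq_eq order_refl)
  qed
  have split: "int_on M (\<Union>i. A i) h =
      (\<Sum>i<k. int_on M (A i) h) + int_on M (D k) h"
    if h: "integrable M h" for h :: "'a \<Rightarrow> real" and k
  proof -
    have ind: "indicator (\<Union>i. A i) x = (\<Sum>i<k. indicator (A i) x) + (indicator (D k) x :: real)" for x
    proof -
      have "indicator (\<Union>i. A i) x = indicator (\<Union>i<k. A i) x + (indicator (D k) x :: real)"
      proof -
        have "UNIV = {..<k} \<union> {k..}" by auto
        then have "(\<Union>i. A i) = (\<Union>i<k. A i) \<union> D k"
          unfolding D_def by (metis UN_Un)
        moreover have "(\<Union>i<k. A i) \<inter> D k = {}"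
        proof -
          have "A i \<inter> A j = {}" if "i < k" "k \<le> j" for i j
            using \<open>disjoint_family A\<close> that unfolding disjoint_family_on_def by auto
          then show ?thesis unfolding D_def by auto
        qed
        ultimately show ?thesis by (auto simp: indicator_def)
      qed
      also have "indicator (\<Union>i<k. A i) x = (\<Sum>i<k. indicator (A i) x :: real)"
        using \<open>disjoint_family A\<close>
        by (intro indicator_UN_disjoint) (auto simp: disjoint_family_on_def)
      finally show ?thesis .
    qed
    show ?thesis
      unfolding ind distrib_right sum_distrib_right
      using integrable_indicator_times[OF h D, of k]
        Bochner_Integration.integrable_sum[OF integrable_indicator_times[OF h A], where I="{..<k}"]
        Bochner_Integration.integral_sum[OF integrable_indicator_times[OF h A], where I="{..<k}"]
      by (simp only: Bochner_Integration.integral_add)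
  qed
  show ?case
  proof (rule tendstoI)
    fix e :: real assume e: "e > 0"
    obtain k1 where k1: "\<And>n. int_on M (D k1) (f n) \<le> e/4"
      using equi_smallD[OF small D dec D0, of "e/4"] e by auto
    have "eventually (\<lambda>k. int_on M (D k) g < e/4) sequentially"
      using tendsto_integral_decseq[OF g(1) D dec D0] e by (intro order_tendstoD) auto
    then obtain k2 where k2: "\<And>k. k \<ge> k2 \<Longrightarrow> int_on M (D k) g < e/4"
      by (auto simp: eventually_sequentially)
    \<comment> \<open>\<open>k1\<close> serves the whole family and \<open>k2\<close> the limit;
      both integrals decrease along \<open>D\<close>, so the maximum serves both.\<close>
    define k where "k = max k1 k2"
    have gk: "int_on M (D k) g < e/4" using k2 by (simp add: k_def)
    have fk: "int_on M (D k) (f n) \<le> e/4" for n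
    proof -
      have "int_on M (D k) (f n) \<le> int_on M (D k1) (f n)"
      proof (intro integral_mono integrable_indicator_times f D)
        have "D k \<subseteq> D k1" using dec unfolding decseq_def k_def by simp
        then show "indicator (D k) x * f n x \<le> indicator (D k1) x * f n x" for x
          using f(2)[of n x] by (auto simp: indicator_def)
      qed
      then show ?thesis using k1[of n] by simp
    qed
    have f0: "0 \<le> int_on M (D k) (f n)" for n
      using f(2) by (intro Bochner_Integration.integral_nonneg) auto
    have g0: "0 \<le> int_on M (D k) g"
      using g(2) by (intro Bochner_Integration.integral_nonneg) auto
    have "((\<lambda>n. \<Sum>i<k. int_on M (A i) (f n)) \<longlongrightarrow> (\<Sum>i<k. int_on M (A i) g)) F"
      by (intro tendsto_intros union)
    then have "eventually (\<lambda>n. dist (\<Sum>i<k. int_on M (A i) (f n)) (\<Sum>i<k. int_on M (A i) g) < e/4) F"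
      using e by (intro tendstoD) auto
    then show "eventually (\<lambda>n. dist (int_on M (\<Union>i. A i) (f n)) (int_on M (\<Union>i. A i) g) < e) F"
    proof eventually_elim
      case (elim n)
      then show ?case unfolding split[OF f(1), where k=k] split[OF g(1), where k=k]
        using fk[of n] f0[of n] gk g0 e unfolding dist_real_def by linarith
    qed
  qed
qed

section \<open>Tensor squares and quadratic functionals under weak convergence\<close>

abbreviation lborel2 :: "(real \<times> real) measure" where "lborel2 \<equiv> lborel \<Otimes>\<^sub>M lborel"
abbreviation measurable2 :: "(real \<Rightarrow> real \<Rightarrow> real) \<Rightarrow> bool" where
  "measurable2 f \<equiv> (\<lambda>p. f (fst p) (snd p)) \<in> borel_measurable lborel2"
abbreviation lborel3 :: "(real \<times> real \<times> real) measure" where "lborel3 \<equiv> lborel \<Otimes>\<^sub>M lborel2"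

lemma integrable_pair_times:
  fixes f g :: "real \<Rightarrow> real"
  assumes "integrable lborel f" "integrable lborel g"
  shows "integrable lborel2 (\<lambda>p. f (fst p) * g (snd p))"
    and "(LINT p|lborel2. f (fst p) * g (snd p)) = (LBINT x. f x) * (LBINT x. g x)"
proof -
  have [measurable]: "f \<in> borel_measurable borel" "g \<in> borel_measurable borel" using assms by auto
  have "integrable lborel2 (\<lambda>(x,y). f x * g y)"
    by (rule lborel_pair.Fubini_integrable) (use assms in \<open>auto simp: abs_mult\<close>)
  then show i: "integrable lborel2 (\<lambda>p. f (fst p) * g (snd p))"
    by (simp add: case_prod_beta')
  show "(LINT p|lborel2. f (fst p) * g (snd p)) = (LBINT x. f x) * (LBINT x. g x)"
    using lborel_pair.integral_fst'[OF i] by simp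
qed

text \<open>\<open>J i n x\<close> is the mass of \<open>f n\<close> on the section of
  \<open>A i\<close> at \<open>x\<close>. For fixed \<open>x\<close> the sections decrease to the
  empty set, so \<open>J i n x\<close> becomes small uniformly in \<open>n\<close>, and the sets
  \<open>E i\<close> of those \<open>x\<close> where it exceeds \<open>d\<close> for some
  \<open>n\<close> decrease to the empty set again. The hypothesis is thus used twice: off
  \<open>E i\<close> the section is small, on \<open>E i\<close> the outer factor is. Countability
  of the index type makes the union \<open>E i\<close> measurable.\<close>

lemma equi_small_pair:
  fixes f :: "'i \<Rightarrow> real \<Rightarrow> real"
  assumes f: "\<And>n. integrable lborel (f n)" "\<And>n x. 0 \<le> f n x" "\<And>n. (LBINT x. f n x) \<le> C"
    and small: "equi_small lborel f" and I: "countable (UNIV :: 'i set)"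
  shows "equi_small lborel2 (\<lambda>n p. f n (fst p) * f n (snd p))"
  unfolding equi_small_def
proof (intro allI impI)
  fix A :: "nat \<Rightarrow> (real \<times> real) set" and e :: real
  assume A0: "range A \<subseteq> sets lborel2" and dec: "decseq A" and A_empty: "(\<Inter>i. A i) = {}" and e: "e > 0"
  have A[measurable]: "A i \<in> sets lborel2" for i using A0 by auto
  have [measurable]: "f n \<in> borel_measurable lborel" for n using f(1) by auto
  define J where "J = (\<lambda>i n x. LBINT y. indicator (A i) (x, y) * f n y)"
  have J[measurable]: "J i n \<in> borel_measurable lborel" for i n
    unfolding J_def by measurable
  have sec[measurable]: "{y. (x, y) \<in> A i} \<in> sets lborel" for x i
    using sets_Pair1[OF A[of i]] by (simp add: vimage_def)
  have ind: "indicator (A i) (x, y) = (indicator {y. (x, y) \<in> A i} y :: real)" for i x y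
    by (auto simp: indicator_def)
  have Jint: "integrable lborel (\<lambda>y. indicator (A i) (x, y) * f n y)" for i x n
    unfolding ind by (intro integrable_indicator_times f sec)
  have J0: "0 \<le> J i n x" for i n x
    unfolding J_def using f(2) by (intro Bochner_Integration.integral_nonneg) auto
  have Jmono: "J j n x \<le> J i n x" if "i \<le> j" for i j n x
    unfolding J_def
  proof (intro integral_mono Jint)
    have "A j \<subseteq> A i" using dec that by (auto simp: decseq_def)
    then show "indicator (A j) (x, y) * f n y \<le> indicator (A i) (x, y) * f n y" for y
      using f(2)[of n y] by (auto simp: indicator_def)
  qed
  have JC: "J i n x \<le> C" for i n x
  proof -
    have "J i n x \<le> (LBINT y. f n y)"
      unfolding J_def using f(2)[of n] by (intro integral_mono Jint f) (auto simp: indicator_def)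
    then show ?thesis using f(3)[of n] by simp
  qed
  have C: "C \<ge> 0" using JC[of 0 undefined 0] J0[of 0 undefined 0] by simp
  \<comment> \<open>The two contributions are at most \<open>d * C\<close> and \<open>C * d\<close>;
    the 1 in the denominator covers \<open>C = 0\<close>.\<close>
  define d where "d = e / (2 * (C + 1))"
  have d: "d > 0" unfolding d_def using e C by simp
  define E where "E = (\<lambda>i. \<Union>n\<in>UNIV. {x \<in> space lborel. d < J i n x})"
  have E: "E i \<in> sets lborel" for i
    unfolding E_def using I by (intro sets.countable_UN'') measurable
  have Edec: "decseq E"
    unfolding E_def decseq_def using Jmono by (auto) (meson less_le_trans)
  have E_empty: "(\<Inter>i. E i) = {}"
  proof -
    have "\<exists>i. x \<notin> E i" for x
    proof -
      have 1: "decseq (\<lambda>i. {y. (x, y) \<in> A i})" using dec by (auto simp: decseq_def)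
      have 2: "(\<Inter>i. {y. (x, y) \<in> A i}) = {}" using A_empty by auto
      obtain i where "\<And>n. J i n x \<le> d"
        unfolding J_def ind using equi_smallD[OF small sec 1 2 d] by blast
      then have "x \<notin> E i" unfolding E_def by (auto simp: not_less)
      then show ?thesis ..
    qed
    then show ?thesis by auto
  qed
  obtain i where i: "\<And>n. int_on lborel (E i) (f n) \<le> d"
    using equi_smallD[OF small E Edec E_empty d] by blast
  have "(LINT p|lborel2. indicator (A i) p * (f n (fst p) * f n (snd p))) \<le> e" for n
  proof -
    have int: "integrable lborel2 (\<lambda>p. indicator (A i) p * (f n (fst p) * f n (snd p)))"
      by (intro integrable_indicator_times integrable_pair_times f A)
    have "(LINT p|lborel2. indicator (A i) p * (f n (fst p) * f n (snd p))) =
        (LBINT x. LBINT y. indicator (A i) (x, y) * (f n x * f n y))"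
      using lborel_pair.integral_fst'[OF int] by simp
    also have "\<dots> = (LBINT x. J i n x * f n x)"
      unfolding J_def by (auto simp: mult_ac simp flip: integral_mult_right_zero intro!: Bochner_Integration.integral_cong)
    also have "\<dots> \<le> (LBINT x. d * f n x + C * (indicator (E i) x * f n x))"
    proof (rule integral_mono)
      show "integrable lborel (\<lambda>x. J i n x * f n x)"
        using J0 JC by (intro integrable_bounded_times[where B=C] f) auto
      show "integrable lborel (\<lambda>x. d * f n x + C * (indicator (E i) x * f n x))"
        using integrable_indicator_times[OF f(1) E] f(1) by auto
      fix x
      show "J i n x * f n x \<le> d * f n x + C * (indicator (E i) x * f n x)"
      proof (cases "x \<in> E i")
        case True
        have "J i n x * f n x \<le> C * f n x" using JC f(2) by (intro mult_right_mono) auto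
        moreover have "0 \<le> d * f n x" using d f(2)[of n x] by simp
        ultimately show ?thesis using True by simp
      next
        case False
        then have "J i n x \<le> d" unfolding E_def by (auto simp: not_less)
        then have "J i n x * f n x \<le> d * f n x" using f(2) by (intro mult_right_mono) auto
        then show ?thesis using False by simp
      qed
    qed
    also have "\<dots> = d * (LBINT x. f n x) + C * int_on lborel (E i) (f n)"
      using integrable_indicator_times[OF f(1) E] f(1) by simp
    also have "\<dots> \<le> d * C + C * d"
      using d C f(3) i by (intro add_mono mult_left_mono) auto
    also have "\<dots> \<le> e"
    proof -
      have "2 * d * (C + 1) = e" unfolding d_def using C by (simp add: field_simps)
      then show ?thesis using d by (simp add: algebra_simps)
    qed
    finally show ?thesis .
  qed
  then show "\<exists>i. \<forall>n. (LINT p|lborel2. indicator (A i) p * (f n (fst p) * f n (snd p))) \<le> e" by blast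
qed

text \<open>On a rectangle the integral of the tensor square factors, so its convergence follows
  from that of the factors. Rectangles form an intersection-stable generator; equi-smallness of the
  squares extends the convergence to all measurable sets of the plane, and from there to bounded
  measurable \<open>\<kappa>\<close>.\<close>

lemma tendsto_quadratic_integral:
  fixes f :: "'i \<Rightarrow> real \<Rightarrow> real"
  assumes f: "\<And>n. integrable lborel (f n)" "\<And>n x. 0 \<le> f n x" "\<And>n. (LBINT x. f n x) \<le> C"
    and g: "integrable lborel g" "\<And>x. 0 \<le> g x" "(LBINT x. g x) \<le> C"
    and small: "equi_small lborel f" and I: "countable (UNIV :: 'i set)"
    and lim: "\<And>A. A \<in> sets lborel \<Longrightarrow>
      ((\<lambda>n. int_on lborel A (f n)) \<longlongrightarrow> int_on lborel A g) F"
    and \<kappa>: "\<kappa> \<in> borel_measurable lborel2" "\<And>p. \<bar>\<kappa> p\<bar> \<le> B"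
  shows "((\<lambda>n. LINT p|lborel2. \<kappa> p * (f n (fst p) * f n (snd p))) \<longlongrightarrow>
      (LINT p|lborel2. \<kappa> p * (g (fst p) * g (snd p)))) F"
proof (rule tendsto_integral_bounded_times[where C="C * C" and B=B])
  have sq: "(LBINT x. h x) * (LBINT x. h x) \<le> C * C"
    if "\<And>x. 0 \<le> h x" "(LBINT x. h x) \<le> C" for h :: "real \<Rightarrow> real"
  proof -
    have "0 \<le> (LBINT x. h x)" using that(1) by simp
    then show ?thesis using that(2) by (intro mult_mono) auto
  qed
  show "(LINT p|lborel2. f n (fst p) * f n (snd p)) \<le> C * C" for n
    using sq[OF f(2,3)] integrable_pair_times(2)[OF f(1) f(1)] by simp
  show "(LINT p|lborel2. g (fst p) * g (snd p)) \<le> C * C"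
    using sq[OF g(2,3)] integrable_pair_times(2)[OF g(1) g(1)] by simp
  fix A :: "(real \<times> real) set" assume A: "A \<in> sets lborel2"
  let ?G = "{a \<times> b |a b. a \<in> sets (lborel :: real measure) \<and> b \<in> sets (lborel :: real measure)}"
  show "((\<lambda>n. LINT p|lborel2. indicator A p * (f n (fst p) * f n (snd p))) \<longlongrightarrow>
      (LINT p|lborel2. indicator A p * (g (fst p) * g (snd p)))) F"
  proof (rule tendsto_integral_sets_Dynkin[where G="?G"])
    show "equi_small lborel2 (\<lambda>n p. f n (fst p) * f n (snd p))"
      by (rule equi_small_pair[OF f small I])
    show "Int_stable ?G" by (rule Int_stable_pair_measure_generator)
    show "?G \<subseteq> Pow (space lborel2)" by (auto simp: space_pair_measure)
    show "sets lborel2 = sigma_sets (space lborel2) ?G"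
      by (simp add: sets_pair_measure space_pair_measure)
    have tot: "((\<lambda>n. LBINT x. f n x) \<longlongrightarrow> (LBINT x. g x)) F"
      using lim[of UNIV] by simp
    show "((\<lambda>n. LINT p|lborel2. f n (fst p) * f n (snd p)) \<longlongrightarrow>
      (LINT p|lborel2. g (fst p) * g (snd p))) F"
      unfolding integrable_pair_times(2)[OF f(1) f(1)] integrable_pair_times(2)[OF g(1) g(1)]
      by (intro tendsto_intros tot)
    fix S assume "S \<in> ?G"
    then obtain a b where S: "S = a \<times> b" and ab: "a \<in> sets lborel" "b \<in> sets lborel" by blast
    have eq: "(LINT p|lborel2. indicator S p * (h (fst p) * h (snd p))) =
      (LBINT x. indicator a x * h x) * (LBINT x. indicator b x * h x)"
      if h: "integrable lborel h" for h :: "real \<Rightarrow> real"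
    proof -
      have "(LINT p|lborel2. indicator S p * (h (fst p) * h (snd p))) =
        (LINT p|lborel2. (indicator a (fst p) * h (fst p)) * (indicator b (snd p) * h (snd p)))"
        by (intro Bochner_Integration.integral_cong) (auto simp: S indicator_def)
      also have "\<dots> = (LBINT x. indicator a x * h x) * (LBINT x. indicator b x * h x)"
        by (intro integrable_pair_times(2) integrable_indicator_times h ab)
      finally show ?thesis .
    qed
    show "((\<lambda>n. LINT p|lborel2. indicator S p * (f n (fst p) * f n (snd p))) \<longlongrightarrow>
      (LINT p|lborel2. indicator S p * (g (fst p) * g (snd p)))) F"
      unfolding eq[OF f(1)] eq[OF g(1)] by (intro tendsto_intros lim ab)
  qed (use A f g in \<open>auto intro!: integrable_pair_times\<close>)
qed (use f g \<kappa> in \<open>auto intro!: integrable_pair_times\<close>)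

text \<open>Equi-smallness makes the set function of limits countably additive, and Radon-Nikodym applies.\<close>
lemma equi_small_limit_density:
  fixes f :: "'i \<Rightarrow> 'a \<Rightarrow> real"
  assumes M: "sigma_finite_measure M"
    and f: "\<And>n. integrable M (f n)" "\<And>n x. 0 \<le> f n x"
    and small: "equi_small M f" and F: "F \<noteq> bot"
    and lim: "\<And>A. A \<in> sets M \<Longrightarrow> \<exists>l. ((\<lambda>n. int_on M A (f n)) \<longlongrightarrow> l) F"
  obtains g where "integrable M g" "\<And>x. 0 \<le> g x"
    "\<And>A. A \<in> sets M \<Longrightarrow> ((\<lambda>n. int_on M A (f n)) \<longlongrightarrow> int_on M A g) F"
proof -
  interpret sigma_finite_measure M by fact
  have "\<forall>A. \<exists>l. A \<in> sets M \<longrightarrow> ((\<lambda>n. int_on M A (f n)) \<longlongrightarrow> l) F" using lim by blast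
  then obtain \<mu> where \<mu>: "\<And>A. A \<in> sets M \<Longrightarrow> ((\<lambda>n. int_on M A (f n)) \<longlongrightarrow> \<mu> A) F"
    by metis
  have nn: "0 \<le> int_on M A (f n)" for A n
    using f(2) by (intro Bochner_Integration.integral_nonneg) auto
  have \<mu>0: "0 \<le> \<mu> A" if "A \<in> sets M" for A
    by (rule tendsto_lowerbound[OF \<mu>[OF that] _ F]) (use nn in auto)
  have \<mu>_empty: "\<mu> {} = 0"
    using tendsto_unique[OF F \<mu>[of "{}"]] by simp
  have \<mu>_add: "\<mu> (A \<union> B) = \<mu> A + \<mu> B" if "A \<in> sets M" "B \<in> sets M" "A \<inter> B = {}" for A B
  proof (rule tendsto_unique[OF F \<mu>])
    show "A \<union> B \<in> sets M" using that by auto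
    have "int_on M (A \<union> B) (f n) =
      int_on M A (f n) + int_on M B (f n)" for n
    proof -
      have "int_on M (A \<union> B) (f n) = (LINT x|M. indicator A x * f n x + indicator B x * f n x)"
        using that(3) by (intro Bochner_Integration.integral_cong) (auto simp: indicator_def)
      then show ?thesis using that by (simp add: integrable_indicator_times f)
    qed
    then show "((\<lambda>n. int_on M (A \<union> B) (f n)) \<longlongrightarrow> \<mu> A + \<mu> B) F"
      using that by (simp add: tendsto_add \<mu>)
  qed
  define N where "N = measure_of (space M) (sets M) (\<lambda>A. ennreal (\<mu> A))"
  have sN: "space N = space M" "sets N = sets M"
    unfolding N_def by (auto simp: sets.space_closed sets.sigma_sets_eq)
  have ca: "countably_additive (sets M) (\<lambda>A. ennreal (\<mu> A))"
  proof (rule sets.empty_continuous_imp_countably_additive)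
    show "positive (sets M) (\<lambda>A. ennreal (\<mu> A))" unfolding positive_def using \<mu>_empty by simp
    show "additive (sets M) (\<lambda>A. ennreal (\<mu> A))"
      unfolding additive_def using \<mu>_add \<mu>0 by (auto simp: ennreal_plus)
    fix A :: "nat \<Rightarrow> 'a set" assume A: "range A \<subseteq> sets M" "decseq A" "(\<Inter>i. A i) = {}"
    have mono: "\<mu> (A j) \<le> \<mu> (A i)" if "i \<le> j" for i j
    proof (rule tendsto_le[OF F \<mu> \<mu>])
      show "A i \<in> sets M" "A j \<in> sets M" using A by auto
      have "A j \<subseteq> A i" using A(2) that by (auto simp: decseq_def)
      then have "int_on M (A j) (f n) \<le> int_on M (A i) (f n)" for n
        using A(1) f(2)[of n] by (intro integral_mono integrable_indicator_times f) (auto simp: indicator_def)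
      then show "\<forall>\<^sub>F n in F. int_on M (A j) (f n) \<le> int_on M (A i) (f n)"
        by simp
    qed
    have "(\<lambda>i. \<mu> (A i)) \<longlonglongrightarrow> 0"
    proof (rule LIMSEQ_I)
      fix r :: real assume r: "0 < r"
      obtain i where i: "\<And>n. int_on M (A i) (f n) \<le> r / 2"
        using equi_smallD[OF small _ A(2,3), of "r / 2"] A(1) r by auto
      have "\<mu> (A i) \<le> r / 2"
        by (rule tendsto_upperbound[OF \<mu> _ F]) (use A i in auto)
      then have "norm (\<mu> (A j) - 0) < r" if "j \<ge> i" for j
        using mono[OF that] \<mu>0[of "A j"] A(1) r by auto
      then show "\<exists>no. \<forall>n\<ge>no. norm (\<mu> (A n) - 0) < r" by blast
    qed
    then show "(\<lambda>i. ennreal (\<mu> (A i))) \<longlonglongrightarrow> 0"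
      by (simp add: tendsto_ennrealI flip: ennreal_0)
  qed simp
  have N: "emeasure N A = ennreal (\<mu> A)" if "A \<in> sets M" for A
  proof (rule emeasure_measure_of[OF N_def sets.space_closed])
    show "positive (sets N) (\<lambda>A. ennreal (\<mu> A))" by (simp add: positive_def \<mu>_empty)
  qed (use that ca sN in auto)
  have fin: "finite_measure N" by (rule finite_measureI) (simp add: N sN)
  have ac: "absolutely_continuous M N"
    unfolding absolutely_continuous_def
  proof
    fix A assume A: "A \<in> null_sets M"
    have "int_on M A (f n) = 0" for n
      using A AE_not_in[OF A] by (intro integral_eq_zero_AE) (auto elim!: eventually_mono)
    then have "\<mu> A = 0" using tendsto_unique[OF F \<mu>[of A]] A by (auto simp: null_sets_def)
    then show "A \<in> null_sets N" using A N by (auto simp: null_sets_def sN)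
  qed
  obtain D where D: "D \<in> borel_measurable M" "AE x in M. RN_deriv M N x = ennreal (D x)" "\<And>x. 0 \<le> D x"
    using real_RN_deriv[OF fin ac sN(2)] by metis
  have "density M (\<lambda>x. ennreal (D x)) = density M (RN_deriv M N)"
    by (rule density_cong) (use D in auto)
  also have "\<dots> = N" using density_RN_deriv[OF ac sN(2)] .
  finally have den: "density M (\<lambda>x. ennreal (D x)) = N" .
  have D_eq: "(\<integral>\<^sup>+x. ennreal (indicator A x * D x) \<partial>M) = ennreal (\<mu> A)" if A: "A \<in> sets M" for A
  proof -
    have "(\<integral>\<^sup>+x. ennreal (D x) * indicator A x \<partial>M) = emeasure N A"
      using D A unfolding den[symmetric] by (simp add: emeasure_density)
    then show ?thesis using N[OF A] by (simp add: ennreal_mult'' ennreal_indicator mult.commute)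
  qed
  have Dint: "integrable M D"
    using D D_eq[of "space M"] by (intro integrableI_nonneg) (auto cong: nn_integral_cong)
  show ?thesis
  proof
    show "integrable M D" by fact
    show "0 \<le> D x" for x by fact
    fix A assume A: "A \<in> sets M"
    have "int_on M A D = \<mu> A"
      using D_eq[OF A] D(3) A D(1) \<mu>0[OF A] by (subst integral_eq_nn_integral) auto
    then show "((\<lambda>n. int_on M A (f n)) \<longlongrightarrow> int_on M A D) F"
      using \<mu>[OF A] by simp
  qed
qed

text \<open>Tychonoff's theorem replaces a diagonal argument: no countability of the index set is needed.\<close>
lemma bounded_family_subfilter:
  fixes q :: "'i \<Rightarrow> 'b \<Rightarrow> real"
  assumes q: "\<And>n b. \<bar>q n b\<bar> \<le> C" and G: "G \<noteq> bot"
  obtains F where "F \<noteq> bot" "F \<le> G" "\<And>b. \<exists>l. ((\<lambda>n. q n b) \<longlongrightarrow> l) F"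
proof -
  have "compactin (product_topology (\<lambda>b::'b. euclidean :: real topology) UNIV) (PiE UNIV (\<lambda>b. {-C..C}))"
    by (subst compactin_PiE) auto
  then have K: "compact (PiE UNIV (\<lambda>b::'b. {-C..C}))"
    by (simp add: euclidean_product_topology)
  have "eventually (\<lambda>x. x \<in> PiE UNIV (\<lambda>b::'b. {-C..C})) (filtermap q G)"
    unfolding eventually_filtermap using q by (intro always_eventually) (auto simp: abs_le_iff minus_le_iff)
  then obtain l where l: "inf (nhds l) (filtermap q G) \<noteq> bot"
    using K[unfolded compact_filter, rule_format, of "filtermap q G"] G
    by (auto simp: filtermap_bot_iff)
  \<comment> \<open>\<open>l\<close> is a cluster point of \<open>q\<close> along \<open>G\<close>;
    adding the pulled back neighbourhoods of \<open>l\<close> to \<open>G\<close> forces convergence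
    to \<open>l\<close> in every coordinate.\<close>
  define F where "F = inf (filtercomap q (nhds l)) G"
  have "F \<noteq> bot"
  proof
    assume "F = bot"
    then have "eventually (\<lambda>_. False) F" by simp
    then obtain P Q where P: "eventually P (nhds l)" and Q: "eventually Q G" and PQ: "\<And>n. P (q n) \<Longrightarrow> Q n \<Longrightarrow> False"
      unfolding F_def eventually_inf eventually_filtercomap by auto
    have "eventually (\<lambda>x. \<not> P x) (filtermap q G)"
      using Q PQ unfolding eventually_filtermap by (auto elim!: eventually_mono)
    then have "eventually (\<lambda>_. False) (inf (nhds l) (filtermap q G))"
      using P unfolding eventually_inf by blast
    then show False using l by (simp add: eventually_False)
  qed
  moreover have "F \<le> G" unfolding F_def by simp
  moreover have "((\<lambda>n. q n b) \<longlongrightarrow> l b) F" for b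
  proof -
    have lim: "filterlim q (nhds l) F"
      unfolding filterlim_iff_le_filtercomap F_def by simp
    show ?thesis
    proof (rule topological_tendstoI)
      fix S :: "real set" assume S: "open S" "l b \<in> S"
      have "open ((\<lambda>x::'b \<Rightarrow> real. x b) -` S)"
        by (rule open_vimage[OF S(1) continuous_on_product_coordinates])
      then have "eventually (\<lambda>x. x \<in> (\<lambda>x. x b) -` S) (nhds l)"
        using S(2) by (intro eventually_nhds_in_open) auto
      then show "eventually (\<lambda>n. q n b \<in> S) F"
        using filterlim_iff[THEN iffD1, OF lim] by auto
    qed
  qed
  ultimately show ?thesis using that by blast
qed

text \<open>Dominated convergence is a statement about sequences and may fail along a general
  filter. Pointwise convergence is therefore first made uniform on \<open>{0..t}\<close>, by a
  finite net of times and a common modulus of continuity, which the limit inherits. The modulus is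
  required only eventually, since the approximations jump in time.\<close>

lemma tendsto_integral_equicontinuous:
  fixes q :: "'i \<Rightarrow> real \<Rightarrow> real"
  assumes t: "t > 0"
    and int: "\<And>n. set_integrable lborel {0<..<t} (q n)" "set_integrable lborel {0<..<t} p"
    and F: "F \<noteq> bot"
    and lim: "\<And>s. 0 \<le> s \<Longrightarrow> s \<le> t \<Longrightarrow> ((\<lambda>n. q n s) \<longlongrightarrow> p s) F"
    and eq: "\<And>e. e > 0 \<Longrightarrow> \<exists>d>0. eventually (\<lambda>n. \<forall>s r. 0 \<le> s \<longrightarrow> s \<le> t \<longrightarrow> 0 \<le> r \<longrightarrow> r \<le> t \<longrightarrow>
      \<bar>s - r\<bar> < d \<longrightarrow> \<bar>q n s - q n r\<bar> \<le> e) F"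
  shows "((\<lambda>n. LBINT s:{0<..<t}. q n s) \<longlongrightarrow> (LBINT s:{0<..<t}. p s)) F"
proof (rule tendstoI)
  fix e :: real assume e: "e > 0"
  \<comment> \<open>Comparison at a point of the net costs three errors of size \<open>e'\<close>;
    integrated over length \<open>t\<close> they give 3/4 of \<open>e\<close>.\<close>
  define e' where "e' = e / (4 * t)"
  have e': "e' > 0" unfolding e'_def using e t by simp
  obtain d where d: "d > 0" and ev: "eventually (\<lambda>n. \<forall>s r. 0 \<le> s \<longrightarrow> s \<le> t \<longrightarrow> 0 \<le> r \<longrightarrow> r \<le> t \<longrightarrow>
      \<bar>s - r\<bar> < d \<longrightarrow> \<bar>q n s - q n r\<bar> \<le> e') F" using eq[OF e'] by blast
  obtain k where k: "finite k" "k \<subseteq> {0..t}" "{0..t} \<subseteq> (\<Union>x\<in>k. ball x d)"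
  proof -
    have "seq_compact {0..t}" by (simp add: compact_imp_seq_compact)
    then have "\<exists>k. finite k \<and> k \<subseteq> {0..t} \<and> {0..t} \<subseteq> (\<Union>x\<in>k. ball x d)"
      using seq_compact_imp_totally_bounded[of "{0..t}"] d by auto
    then show ?thesis using that by blast
  qed
  have "eventually (\<lambda>n. \<forall>x\<in>k. dist (q n x) (p x) < e') F"
    using k lim e' by (intro eventually_ball_finite ballI tendstoD) auto
  with ev have main: "eventually (\<lambda>n. \<forall>s. 0 \<le> s \<longrightarrow> s \<le> t \<longrightarrow> \<bar>q n s - p s\<bar> \<le> 3 * e') F"
  proof eventually_elim
    case (elim n)
    show ?case
    proof (intro allI impI)
      fix s assume s: "0 \<le> s" "s \<le> t"
      then obtain x where x: "x \<in> k" "dist x s < d" using k(3) by auto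
      have xt: "0 \<le> x" "x \<le> t" using x(1) k(2) by auto
      have sx: "\<bar>s - x\<bar> < d" using x(2) by (simp add: dist_real_def abs_minus_commute)
      have 1: "\<bar>q n s - q n x\<bar> \<le> e'" using elim(1) s xt sx by blast
      have 2: "\<bar>q n x - p x\<bar> < e'" using elim(2) x(1) by (auto simp: dist_real_def)
      have 3: "\<bar>p s - p x\<bar> \<le> e'"
      proof (rule tendsto_upperbound[OF _ _ F])
        show "((\<lambda>m. \<bar>q m s - q m x\<bar>) \<longlongrightarrow> \<bar>p s - p x\<bar>) F"
          by (intro tendsto_intros lim s xt)
        show "\<forall>\<^sub>F m in F. \<bar>q m s - q m x\<bar> \<le> e'"
          using ev s xt sx by (auto elim!: eventually_mono)
      qed
      show "\<bar>q n s - p s\<bar> \<le> 3 * e'" using 1 2 3 by linarith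
    qed
  qed
  show "eventually (\<lambda>n. dist (LBINT s:{0<..<t}. q n s) (LBINT s:{0<..<t}. p s) < e) F"
    using main
  proof eventually_elim
    case (elim n)
    have "\<bar>(LBINT s:{0<..<t}. q n s) - (LBINT s:{0<..<t}. p s)\<bar> =
      \<bar>LBINT s:{0<..<t}. q n s - p s\<bar>"
      using int by (simp add: set_integral_diff)
    also have "\<dots> \<le> (LBINT s:{0<..<t}. \<bar>q n s - p s\<bar>)"
      unfolding set_lebesgue_integral_def
      by (rule order_trans[OF integral_abs_bound]) (simp add: abs_mult)
    also have "\<dots> \<le> (LBINT s:{0<..<t}. 3 * e')"
    proof (rule set_integral_mono)
      show "set_integrable lborel {0<..<t} (\<lambda>s. \<bar>q n s - p s\<bar>)"
        by (intro set_integrable_abs set_integral_diff int)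
      show "set_integrable lborel {0<..<t} (\<lambda>s. 3 * e')"
        unfolding set_integrable_def using t by (intro integrable_scaleR_left) (auto intro: integrable_real_indicator)
    qed (use elim in auto)
    also have "\<dots> = 3 * e' * t" using t by (simp add: set_integral_const)
    also have "\<dots> < e" unfolding e'_def using t e by (simp add: field_simps)
    finally show ?case by (simp add: dist_real_def)
  qed
qed

section \<open>The explicit Euler step\<close>

text \<open>For each fixed second coordinate the map is a translation of the first, and translations
  preserve Lebesgue measure. The shear is the change of variables between the gain convolution and
  its weak form with \<open>\<omega> (x + y)\<close>.\<close>

lemma distr_lborel_shear:
  "distr lborel2 lborel2 (\<lambda>p. (fst p - snd p, snd p :: real)) =
    lborel2"
proof (rule measure_eqI)
  fix S assume "S \<in> sets (distr lborel2 lborel2 (\<lambda>p. (fst p - snd p, snd p :: real)))"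
  then have S[measurable]: "S \<in> sets lborel2" by simp
  let ?D = "distr lborel2 lborel2 (\<lambda>p. (fst p - snd p, snd p :: real))"
  have "emeasure ?D S = (\<integral>\<^sup>+p. indicator S p \<partial>?D)"
    using S by (intro nn_integral_indicator[symmetric]) simp
  also have "\<dots> = (\<integral>\<^sup>+p. indicator S (fst p - snd p, snd p) \<partial>lborel2)"
    by (rule nn_integral_distr) measurable
  also have "\<dots> = (\<integral>\<^sup>+y. \<integral>\<^sup>+x. indicator S (x - y, y) \<partial>lborel \<partial>lborel)"
    by (subst lborel_pair.nn_integral_snd[symmetric]) (auto simp: case_prod_beta')
  also have "\<dots> = (\<integral>\<^sup>+y. \<integral>\<^sup>+x. indicator S (x, y) \<partial>lborel \<partial>lborel)"
  proof (rule nn_integral_cong)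
    fix y :: real
    have "(\<lambda>x. indicator S (x, y) :: ennreal) \<in> borel_measurable lborel" by measurable
    then show "(\<integral>\<^sup>+x. indicator S (x - y, y) \<partial>lborel) = (\<integral>\<^sup>+x. indicator S (x, y) \<partial>lborel)"
      using nn_integral_real_affine[of "\<lambda>x. indicator S (x, y)" 1 "-y"] by simp
  qed
  also have "\<dots> = emeasure lborel2 S"
    using S by (subst lborel_pair.nn_integral_snd) (auto intro: nn_integral_indicator)
  finally show "emeasure ?D S = emeasure lborel2 S" .
qed simp

lemma integrable_shear:
  fixes H :: "real \<times> real \<Rightarrow> real"
  assumes "integrable lborel2 H"
  shows "integrable lborel2 (\<lambda>p. H (fst p - snd p, snd p))"
    and "(LINT p|lborel2. H (fst p - snd p, snd p)) = (LINT p|lborel2. H p)"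
proof -
  have [measurable]: "H \<in> borel_measurable lborel2" using assms by auto
  have T: "(\<lambda>p. (fst p - snd p, snd p)) \<in> measurable lborel2 lborel2"
    by measurable
  show "integrable lborel2 (\<lambda>p. H (fst p - snd p, snd p))"
    using assms integrable_distr[OF T, of H] by (simp add: distr_lborel_shear)
  show "(LINT p|lborel2. H (fst p - snd p, snd p)) = (LINT p|lborel2. H p)"
    using integral_distr[OF T, of H] by (simp add: distr_lborel_shear)
qed

section \<open>Weights and functions of finite weighted norm\<close>

definition wt :: "real \<Rightarrow> real \<Rightarrow> real" where "wt a x = x powr (-a) + x"

lemma wt_measurable[measurable]: "wt a \<in> borel_measurable borel"
  unfolding wt_def by measurable

lemma wt_pos: "0 < x \<Longrightarrow> 0 < wt a x"
  unfolding wt_def by (simp add: add_pos_pos)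

lemma powr_minus_antimono: "0 \<le> a \<Longrightarrow> 0 < x \<Longrightarrow> x \<le> y \<Longrightarrow> y powr (-a) \<le> x powr (-a :: real)"
  by (rule powr_mono2') auto

lemma wt_ge_1: "0 \<le> a \<Longrightarrow> 0 < x \<Longrightarrow> 1 \<le> wt a x"
  using powr_minus_antimono[of a x 1] unfolding wt_def by (cases "x \<le> 1") (auto simp: add_increasing)

lemma wt_ge_powr: "0 < x \<Longrightarrow> x powr (-a) \<le> wt a x"
  and wt_ge_self: "0 < x \<Longrightarrow> x \<le> wt a x"
  unfolding wt_def by auto

lemma powr_le_wt_double:
  assumes "0 \<le> a" "0 < x" shows "x powr (-a) \<le> wt (2 * a) x"
proof (cases "x \<le> 1")
  case True
  then have "x powr (-a) \<le> x powr (- (2 * a))" using assms by (intro powr_mono') auto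
  then show ?thesis unfolding wt_def using assms by simp
next
  case False
  then have "x powr (-a) \<le> 1" using powr_minus_antimono[of a 1 x] assms by simp
  then show ?thesis using wt_ge_1[of "2 * a" x] assms by simp
qed

lemma wt_le_wt_double: "0 \<le> a \<Longrightarrow> 0 < x \<Longrightarrow> wt a x \<le> 2 * wt (2 * a) x"
  using powr_le_wt_double[of a x] wt_ge_self[of x "2 * a"] wt_def[of a x] by simp

text \<open>The power is decreasing and the linear part additive, so a collision cannot increase the
  total weight. The norm bound along the scheme comes from this.\<close>

lemma wt_add: "0 \<le> a \<Longrightarrow> 0 < x \<Longrightarrow> 0 < y \<Longrightarrow> wt a (x + y) \<le> wt a x + wt a y"
  using powr_minus_antimono[of a x "x + y"] powr_ge_zero[of y "-a"] unfolding wt_def by linarith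

lemma indicator_self_le_wt: "0 < x \<Longrightarrow> \<bar>indicator A x * x\<bar> \<le> 1 * wt a x"
  using wt_ge_self[of x a] by (auto simp: indicator_def less_imp_le[OF wt_pos])

text \<open>Sign and support are required at every point, not only almost everywhere. Integrals over
  the line then stand for integrals over the half-line, and the convolution of two such functions is
  automatically confined to \<open>0 < y < z\<close>.\<close>

definition admissible :: "real \<Rightarrow> (real \<Rightarrow> real) \<Rightarrow> bool" where
  "admissible a g \<longleftrightarrow> g \<in> borel_measurable borel \<and> (\<forall>x. 0 \<le> g x) \<and> (\<forall>x\<le>0. g x = 0) \<and>
    integrable lborel (\<lambda>x. wt a x * g x)"

lemma admissibleD:
  assumes "admissible a g"
  shows "g \<in> borel_measurable borel" "0 \<le> g x" "x \<le> 0 \<Longrightarrow> g x = 0" "integrable lborel (\<lambda>x. wt a x * g x)"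
    "0 \<le> wt a x * g x" "0 \<le> (LBINT x. wt a x * g x)"
proof -
  show nn: "0 \<le> wt a x * g x" for x
    using assms wt_pos[of x a] by (cases "x \<le> 0") (auto simp: admissible_def)
  show "0 \<le> (LBINT x. wt a x * g x)"
    by (rule Bochner_Integration.integral_nonneg) (rule nn)
qed (use assms in \<open>auto simp: admissible_def\<close>)

lemma admissible_integral:
  assumes g: "admissible a g" and \<phi>: "\<phi> \<in> borel_measurable borel" "\<And>x. 0 < x \<Longrightarrow> \<bar>\<phi> x\<bar> \<le> B * wt a x"
  shows "integrable lborel (\<lambda>x. \<phi> x * g x)"
    and "\<bar>LBINT x. \<phi> x * g x\<bar> \<le> B * (LBINT x. wt a x * g x)"
proof -
  note [measurable] = admissibleD(1)[OF g] \<phi>(1)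
  have le: "\<bar>\<phi> x * g x\<bar> \<le> B * (wt a x * g x)" for x
    using mult_right_mono[OF \<phi>(2), of x "g x"] admissibleD(2,3)[OF g, of x]
    by (cases "x \<le> 0") (auto simp: abs_mult mult.assoc)
  show i: "integrable lborel (\<lambda>x. \<phi> x * g x)"
  proof (rule Bochner_Integration.integrable_bound)
    show "integrable lborel (\<lambda>x. B * (wt a x * g x))" using admissibleD(4)[OF g] by simp
    show "AE x in lborel. norm (\<phi> x * g x) \<le> norm (B * (wt a x * g x))"
      using order_trans[OF le abs_ge_self] by simp
  qed measurable
  have "\<bar>LBINT x. \<phi> x * g x\<bar> \<le> (LBINT x. \<bar>\<phi> x * g x\<bar>)" by (rule integral_abs_bound)
  also have "\<dots> \<le> (LBINT x. B * (wt a x * g x))"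
    using i le admissibleD(4)[OF g] by (intro integral_mono) auto
  finally show "\<bar>LBINT x. \<phi> x * g x\<bar> \<le> B * (LBINT x. wt a x * g x)" by simp
qed

lemma admissible_pair_integral:
  assumes g: "admissible a g" and h: "admissible a h"
    and \<Phi>: "\<Phi> \<in> borel_measurable lborel2"
    and le: "\<And>x y. 0 < x \<Longrightarrow> 0 < y \<Longrightarrow> \<bar>\<Phi> (x, y)\<bar> \<le> B * (wt a x * wt a y)"
  shows "integrable lborel2 (\<lambda>p. \<Phi> p * (g (fst p) * h (snd p)))"
    and "\<bar>LINT p|lborel2. \<Phi> p * (g (fst p) * h (snd p))\<bar> \<le>
      B * ((LBINT x. wt a x * g x) * (LBINT x. wt a x * h x))"
proof -
  note [measurable] = admissibleD(1)[OF g] admissibleD(1)[OF h] \<Phi>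
  let ?D = "\<lambda>p. B * ((wt a (fst p) * g (fst p)) * (wt a (snd p) * h (snd p)))"
  have le': "\<bar>\<Phi> p * (g (fst p) * h (snd p))\<bar> \<le> ?D p" for p
  proof (cases "fst p \<le> 0 \<or> snd p \<le> 0")
    case True then show ?thesis using admissibleD(3)[OF g, of "fst p"] admissibleD(3)[OF h, of "snd p"] by auto
  next
    case False
    have "\<bar>\<Phi> p\<bar> * (g (fst p) * h (snd p)) \<le> B * (wt a (fst p) * wt a (snd p)) * (g (fst p) * h (snd p))"
      using le[of "fst p" "snd p"] False admissibleD(2)[OF g] admissibleD(2)[OF h] by (intro mult_right_mono) auto
    then show ?thesis using admissibleD(2)[OF g] admissibleD(2)[OF h] by (simp add: abs_mult mult_ac)
  qed
  note p = integrable_pair_times[OF admissibleD(4)[OF g] admissibleD(4)[OF h]]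
  show i: "integrable lborel2 (\<lambda>p. \<Phi> p * (g (fst p) * h (snd p)))"
  proof (rule Bochner_Integration.integrable_bound)
    show "integrable lborel2 ?D" using p by simp
    show "AE p in lborel2. norm (\<Phi> p * (g (fst p) * h (snd p))) \<le> norm (?D p)"
      using order_trans[OF le' abs_ge_self] by simp
  qed measurable
  have "\<bar>LINT p|lborel2. \<Phi> p * (g (fst p) * h (snd p))\<bar> \<le>
      (LINT p|lborel2. \<bar>\<Phi> p * (g (fst p) * h (snd p))\<bar>)" by (rule integral_abs_bound)
  also have "\<dots> \<le> (LINT p|lborel2. ?D p)"
    using i le' p by (intro integral_mono) auto
  finally show "\<bar>LINT p|lborel2. \<Phi> p * (g (fst p) * h (snd p))\<bar> \<le>
      B * ((LBINT x. wt a x * g x) * (LBINT x. wt a x * h x))" using p by simp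
qed

definition euler_step :: "real \<Rightarrow> (real \<Rightarrow> real \<Rightarrow> real) \<Rightarrow> (real \<Rightarrow> real) \<Rightarrow> real \<Rightarrow> real" where
  "euler_step h \<kappa> g z = g z - h * (g z * (LBINT y. \<kappa> z y * g y)) +
     h / 2 * (LBINT y. \<kappa> (z - y) y * (g (z - y) * g y))"

abbreviation tilde :: "(real \<Rightarrow> real) \<Rightarrow> real \<times> real \<Rightarrow> real" where
  "tilde \<omega> p \<equiv> \<omega> (fst p + snd p) - \<omega> (fst p) - \<omega> (snd p)"

abbreviation coag_integrand :: "(real \<Rightarrow> real \<Rightarrow> real) \<Rightarrow> (real \<Rightarrow> real) \<Rightarrow> (real \<Rightarrow> real) \<Rightarrow> real \<times> real \<Rightarrow> real" where
  "coag_integrand \<kappa> \<omega> g p \<equiv> tilde \<omega> p * \<kappa> (fst p) (snd p) * (g (fst p) * g (snd p))"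

lemma abs_tilde_le:
  assumes "\<And>x. \<bar>\<omega> x\<bar> \<le> B" shows "\<bar>tilde \<omega> p\<bar> \<le> 3 * B"
  using assms[of "fst p + snd p"] assms[of "fst p"] assms[of "snd p"] by linarith

text \<open>Twice the weak right-hand side: the factor 1/2 of the equation stays outside and shows
  up as \<open>h / 2\<close> and \<open>tau n / 2\<close>.\<close>

definition coag_form :: "(real \<Rightarrow> real \<Rightarrow> real) \<Rightarrow> (real \<Rightarrow> real) \<Rightarrow> (real \<Rightarrow> real) \<Rightarrow> real" where
  "coag_form \<kappa> \<omega> g = (LINT p|lborel2.
     coag_integrand \<kappa> \<omega> g p)"

text \<open>A bounded kernel makes the three parts of \<open>tilde \<omega>\<close> integrable one
  by one: \<open>wt a\<close> is at least 1, hence below the product of the weights, and it is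
  subadditive. The part with \<open>\<omega> (x + y)\<close> is the gain term after the shear. The
  two remaining parts coincide by symmetry, which gives the loss term its coefficient 1 against the
  1/2 of the gain.\<close>

lemma euler_step_weak:
  assumes g: "admissible a g" and a: "0 \<le> a"
    and \<kappa>[measurable]: "measurable2 \<kappa>"
    and \<kappa>b: "\<And>x y. 0 \<le> \<kappa> x y" "\<And>x y. \<kappa> x y \<le> N" and sym: "\<And>x y. \<kappa> x y = \<kappa> y x"
    and \<omega>[measurable]: "\<omega> \<in> borel_measurable borel" and B: "\<And>x. 0 < x \<Longrightarrow> \<bar>\<omega> x\<bar> \<le> B * wt a x"
  shows "integrable lborel (\<lambda>x. \<omega> x * euler_step h \<kappa> g x)"
    and "(LBINT x. \<omega> x * euler_step h \<kappa> g x) = (LBINT x. \<omega> x * g x) + h / 2 * coag_form \<kappa> \<omega> g"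
    and "integrable lborel2 (coag_integrand \<kappa> \<omega> g)"
proof -
  note [measurable] = admissibleD(1)[OF g]
  let ?G = "\<lambda>p. g (fst p) * g (snd p)"
  have N: "0 \<le> N" using \<kappa>b[of 0 0] by simp
  have "0 \<le> B * wt a 1" using order_trans[OF abs_ge_zero B[of 1]] by simp
  then have B0: "0 \<le> B" using wt_pos[of 1 a] by (simp add: zero_le_mult_iff)
  have kN: "\<bar>\<kappa> x y\<bar> \<le> N" for x y using \<kappa>b[of x y] by simp
  have W: "1 \<le> wt a x" if "0 < x" for x by (rule wt_ge_1[OF a that])
  have prod1: "wt a x \<le> wt a x * wt a y" if "0 < x" "0 < y" for x y
    using mult_left_mono[OF W[OF that(2)], of "wt a x"] W[OF that(1)] by simp
  have prod2: "wt a y \<le> wt a x * wt a y" if "0 < x" "0 < y" for x y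
    using prod1[OF that(2,1)] by (simp add: mult.commute)
  have \<omega>1: "\<bar>\<omega> x * \<kappa> x' y'\<bar> \<le> B * N * wt a x" if "0 < x" for x x' y'
    using mult_mono[OF B[OF that] kN[of x' y']] B0 wt_pos[OF that, of a] by (simp add: abs_mult mult_ac)
  have i1: "integrable lborel2 (\<lambda>p. \<omega> (fst p) * \<kappa> (fst p) (snd p) * ?G p)"
  proof (rule admissible_pair_integral[OF g g, where B = "B * N"])
    fix x y :: real assume "0 < x" "0 < y"
    then show "\<bar>\<omega> (fst (x, y)) * \<kappa> (fst (x, y)) (snd (x, y))\<bar> \<le> B * N * (wt a x * wt a y)"
      using \<omega>1[of x x y] mult_left_mono[OF prod1[of x y], of "B * N"] B0 N by simp
  qed measurable
  have i2: "integrable lborel2 (\<lambda>p. \<omega> (snd p) * \<kappa> (fst p) (snd p) * ?G p)"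
  proof (rule admissible_pair_integral[OF g g, where B = "B * N"])
    fix x y :: real assume "0 < x" "0 < y"
    then show "\<bar>\<omega> (snd (x, y)) * \<kappa> (fst (x, y)) (snd (x, y))\<bar> \<le> B * N * (wt a x * wt a y)"
      using \<omega>1[of y x y] mult_left_mono[OF prod2[of x y], of "B * N"] B0 N by simp
  qed measurable
  have i3: "integrable lborel2 (\<lambda>p. \<omega> (fst p + snd p) * \<kappa> (fst p) (snd p) * ?G p)"
  proof (rule admissible_pair_integral[OF g g, where B = "2 * (B * N)"])
    fix x y :: real assume xy: "0 < x" "0 < y"
    have "\<bar>\<omega> (x + y) * \<kappa> x y\<bar> \<le> B * N * wt a (x + y)" using \<omega>1[of "x + y" x y] xy by simp
    also have "\<dots> \<le> B * N * (2 * (wt a x * wt a y))"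
      using wt_add[OF a xy] prod1[OF xy] prod2[OF xy] B0 N by (intro mult_left_mono) auto
    finally show "\<bar>\<omega> (fst (x, y) + snd (x, y)) * \<kappa> (fst (x, y)) (snd (x, y))\<bar> \<le> 2 * (B * N) * (wt a x * wt a y)"
      by simp
  qed measurable
  have swap: "(LINT p|lborel2. \<omega> (snd p) * \<kappa> (fst p) (snd p) * ?G p) =
      (LINT p|lborel2. \<omega> (fst p) * \<kappa> (fst p) (snd p) * ?G p)"
    using lborel_pair.integral_product_swap[of "\<lambda>p. \<omega> (fst p) * \<kappa> (fst p) (snd p) * ?G p"] sym
    by (simp add: case_prod_beta' mult_ac)
  have form: "coag_form \<kappa> \<omega> g = (LINT p|lborel2. \<omega> (fst p + snd p) * \<kappa> (fst p) (snd p) * ?G p)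
     - 2 * (LINT p|lborel2. \<omega> (fst p) * \<kappa> (fst p) (snd p) * ?G p)"
    unfolding coag_form_def left_diff_distrib using i1 i2 i3 swap by simp
  have loss: "integrable lborel (\<lambda>x. \<omega> x * (g x * (LBINT y. \<kappa> x y * g y)))"
    "(LBINT x. \<omega> x * (g x * (LBINT y. \<kappa> x y * g y))) =
      (LINT p|lborel2. \<omega> (fst p) * \<kappa> (fst p) (snd p) * ?G p)"
    using lborel_pair.integrable_fst'[OF i1] lborel_pair.integral_fst'[OF i1]
    by (simp_all add: mult_ac flip: integral_mult_right_zero)
  have gain: "integrable lborel (\<lambda>x. \<omega> x * (LBINT y. \<kappa> (x - y) y * (g (x - y) * g y)))"
    "(LBINT x. \<omega> x * (LBINT y. \<kappa> (x - y) y * (g (x - y) * g y))) =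
      (LINT p|lborel2. \<omega> (fst p + snd p) * \<kappa> (fst p) (snd p) * ?G p)"
    using lborel_pair.integrable_fst'[OF integrable_shear(1)[OF i3]]
      lborel_pair.integral_fst'[OF integrable_shear(1)[OF i3]] integrable_shear(2)[OF i3]
    by (simp_all add: mult_ac flip: integral_mult_right_zero)
  have og: "integrable lborel (\<lambda>x. \<omega> x * g x)" by (rule admissible_integral[OF g \<omega> B])
  have eq: "\<omega> x * euler_step h \<kappa> g x = \<omega> x * g x - h * (\<omega> x * (g x * (LBINT y. \<kappa> x y * g y)))
      + h / 2 * (\<omega> x * (LBINT y. \<kappa> (x - y) y * (g (x - y) * g y)))" for x
    unfolding euler_step_def by (simp add: algebra_simps)
  show "integrable lborel (\<lambda>x. \<omega> x * euler_step h \<kappa> g x)"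
    unfolding eq using og loss(1) gain(1) by auto
  show "(LBINT x. \<omega> x * euler_step h \<kappa> g x) = (LBINT x. \<omega> x * g x) + h / 2 * coag_form \<kappa> \<omega> g"
    unfolding eq form using og loss gain by (simp add: algebra_simps)
  show "integrable lborel2 (coag_integrand \<kappa> \<omega> g)"
    unfolding left_diff_distrib using i1 i2 i3 by simp
qed

lemma coag_form_nonpos:
  assumes "admissible a g" "\<And>x y. 0 \<le> \<kappa> x y" "\<And>x y. 0 < x \<Longrightarrow> 0 < y \<Longrightarrow> \<omega> (x + y) \<le> \<omega> x + \<omega> y"
  shows "coag_form \<kappa> \<omega> g \<le> 0"
proof -
  have "(\<omega> (x + y) - \<omega> x - \<omega> y) * \<kappa> x y * (g x * g y) \<le> 0" for x y
  proof (cases "x \<le> 0 \<or> y \<le> 0")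
    case True then show ?thesis using admissibleD(3)[OF assms(1)] by auto
  next
    case False then show ?thesis using assms(2)[of x y] assms(3)[of x y] admissibleD(2)[OF assms(1)]
      by (intro mult_nonpos_nonneg) auto
  qed
  then have "0 \<le> (LINT p|lborel2.
     - (coag_integrand \<kappa> \<omega> g p))"
    by (intro Bochner_Integration.integral_nonneg) (simp add: algebra_simps)
  then show ?thesis unfolding coag_form_def by simp
qed

text \<open>The condition on \<open>h\<close> bounds \<open>h\<close> times the loss rate by 1,
  because the rate at \<open>z\<close> is at most \<open>N\<close> times the integral of
  \<open>g\<close>, hence of \<open>wt a x * g x\<close>. So the loss never exceeds what is present.
  As the norm does not increase, the same \<open>h\<close> remains allowed at the next step.\<close>

lemma euler_step_admissible:
  assumes g: "admissible a g" and a: "0 \<le> a"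
    and \<kappa>[measurable]: "measurable2 \<kappa>"
    and \<kappa>b: "\<And>x y. 0 \<le> \<kappa> x y" "\<And>x y. \<kappa> x y \<le> N" and sym: "\<And>x y. \<kappa> x y = \<kappa> y x"
    and h: "0 \<le> h" "h * (N * (LBINT x. wt a x * g x)) \<le> 1"
  shows "admissible a (euler_step h \<kappa> g)"
    and "(LBINT x. wt a x * euler_step h \<kappa> g x) \<le> (LBINT x. wt a x * g x)"
proof -
  note [measurable] = admissibleD(1)[OF g]
  have N: "0 \<le> N" using \<kappa>b[of 0 0] by simp
  have "\<bar>wt a x\<bar> \<le> 1 * wt a x" if "0 < x" for x using wt_pos[OF that, of a] by simp
  note weak = euler_step_weak(1,2)[OF g a \<kappa> \<kappa>b sym wt_measurable this, where h = h]
  show "(LBINT x. wt a x * euler_step h \<kappa> g x) \<le> (LBINT x. wt a x * g x)"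
    using weak(2) coag_form_nonpos[OF g \<kappa>b(1) wt_add[OF a]] h(1) by (simp add: mult_nonneg_nonpos)
  have \<kappa>'[measurable]: "case_prod \<kappa> \<in> borel_measurable (borel \<Otimes>\<^sub>M borel)"
    using \<kappa> by (simp add: case_prod_beta' cong: measurable_cong_sets)
  have meas: "euler_step h \<kappa> g \<in> borel_measurable borel"
    unfolding euler_step_def by measurable
  have nonneg: "0 \<le> euler_step h \<kappa> g z" for z
  proof -
    have "h * (LBINT y. \<kappa> z y * g y) \<le> h * (N * (LBINT x. wt a x * g x))"
    proof (intro mult_left_mono h)
      have [measurable]: "\<kappa> z \<in> borel_measurable borel" by measurable
      have "\<bar>\<kappa> z x\<bar> \<le> N * wt a x" if "0 < x" for x
        using \<kappa>b[of z x] mult_left_mono[OF wt_ge_1[OF a that] N] by simp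
      from admissible_integral(2)[OF g _ this]
      show "(LBINT y. \<kappa> z y * g y) \<le> N * (LBINT x. wt a x * g x)" by simp
    qed
    then have "h * (LBINT y. \<kappa> z y * g y) \<le> 1" using h by simp
    then have "0 \<le> g z * (1 - h * (LBINT y. \<kappa> z y * g y))"
      using admissibleD(2)[OF g] by simp
    moreover have "0 \<le> h / 2 * (LBINT y. \<kappa> (z - y) y * (g (z - y) * g y))"
      using h \<kappa>b(1) admissibleD(2)[OF g] by (intro mult_nonneg_nonneg Bochner_Integration.integral_nonneg) auto
    ultimately show ?thesis unfolding euler_step_def by (simp add: algebra_simps)
  qed
  have zero: "euler_step h \<kappa> g z = 0" if "z \<le> 0" for z
  proof -
    have 0: "\<kappa> (z - y) y * (g (z - y) * g y) = 0" for y
      using admissibleD(3)[OF g, of y] admissibleD(3)[OF g, of "z - y"] that by (cases "y \<le> 0") auto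
    show ?thesis unfolding euler_step_def 0 using admissibleD(3)[OF g that] by simp
  qed
  show "admissible a (euler_step h \<kappa> g)"
    unfolding admissible_def using meas nonneg zero weak(1) by blast
qed

text \<open>Below the level \<open>n\<close> the integral over a set is at most \<open>n\<close>
  times its measure, and the excess over the level vanishes by dominated convergence. An affine
  bound in the measure is convenient because each Euler step reproduces it up to a factor.\<close>

lemma integral_indicator_le_measure:
  fixes f :: "real \<Rightarrow> real"
  assumes f: "integrable lborel f" and e: "0 < e"
  obtains N where "0 \<le> N" "\<And>A. A \<in> sets lborel \<Longrightarrow> emeasure lborel A < \<infinity> \<Longrightarrow>
    (LBINT x. indicator A x * f x) \<le> N * measure lborel A + e"
proof -
  have [measurable]: "f \<in> borel_measurable borel" using f by auto
  have int: "integrable lborel (\<lambda>x. max 0 (f x - real n))" for n :: nat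
    by (rule Bochner_Integration.integrable_bound[OF f]) auto
  have "(\<lambda>n. LBINT x. max 0 (f x - real n)) \<longlonglongrightarrow> (LBINT x::real. 0)"
  proof (rule integral_dominated_convergence[where w="\<lambda>x. \<bar>f x\<bar>"])
    show "AE x in lborel. (\<lambda>n. max 0 (f x - real n)) \<longlonglongrightarrow> 0"
    proof (rule AE_I2)
      fix x
      obtain k :: nat where k: "f x \<le> real k" using real_arch_simple by blast
      have "\<forall>\<^sub>F n in sequentially. max 0 (f x - real n) = 0"
        using eventually_ge_at_top[of k] by eventually_elim (use k in auto)
      then show "(\<lambda>n. max 0 (f x - real n)) \<longlonglongrightarrow> 0" by (rule tendsto_eventually)
    qed
  qed (use f in auto)
  then have "eventually (\<lambda>n. (LBINT x. max 0 (f x - real n)) < e) sequentially"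
    using e by (intro order_tendstoD) auto
  then obtain n where n: "(LBINT x. max 0 (f x - real n)) < e"
    by (auto simp: eventually_sequentially)
  show ?thesis
  proof
    show "0 \<le> real n" by simp
    fix A :: "real set" assume A: "A \<in> sets lborel" "emeasure lborel A < \<infinity>"
    have iA: "integrable lborel (\<lambda>x. real n * indicator A x)"
      using A by (intro integrable_mult_right integrable_real_indicator) auto
    have "(LBINT x. indicator A x * f x) \<le> (LBINT x. real n * indicator A x + max 0 (f x - real n))"
      by (intro integral_mono integrable_indicator_times f A Bochner_Integration.integrable_add int iA)
        (auto simp: indicator_def)
    also have "\<dots> = real n * measure lborel A + (LBINT x. max 0 (f x - real n))"
      using iA int A by (simp add: Bochner_Integration.integral_add)
    finally show "(LBINT x. indicator A x * f x) \<le> real n * measure lborel A + e" using n by simp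
  qed
qed

text \<open>Once the forcing stays below r/4, the recursion yields r/2 plus a remainder that is
  halved at each step. It will be applied to the tail bounds at successive size scales.\<close>

lemma halving_recurrence_tendsto_0:
  fixes F :: "nat \<Rightarrow> real"
  assumes F: "\<And>m. F (Suc m) = a m + F m / 2" and a: "a \<longlonglongrightarrow> 0" "\<And>m. 0 \<le> a m" and F0: "0 \<le> F 0"
  shows "F \<longlonglongrightarrow> 0"
proof -
  have nn: "0 \<le> F m" for m by (induction m) (use F a F0 in auto)
  show ?thesis
  proof (rule LIMSEQ_I)
    fix r :: real assume r: "0 < r"
    obtain m0 where m0: "\<And>m. m \<ge> m0 \<Longrightarrow> a m < r / 4"
      using order_tendstoD(2)[OF a(1), of "r/4"] r by (auto simp: eventually_sequentially)
    have bd: "F (m0 + k) \<le> r / 2 + F m0 * (1/2) ^ k" for k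
    proof (induction k)
      case (Suc k)
      have "F (m0 + Suc k) = a (m0 + k) + F (m0 + k) / 2" using F by simp
      also have "\<dots> \<le> r / 4 + (r / 2 + F m0 * (1/2) ^ k) / 2" using m0[OF le_add1, of k] Suc by (intro add_mono divide_right_mono) auto
      also have "\<dots> = r / 2 + F m0 * (1/2) ^ Suc k" by (simp add: field_simps)
      finally show ?case .
    qed (use r in simp)
    have "(\<lambda>k. F m0 * (1/2) ^ k) \<longlonglongrightarrow> F m0 * 0"
      by (intro tendsto_intros LIMSEQ_realpow_zero) auto
    then have "eventually (\<lambda>k. F m0 * (1/2) ^ k < r / 2) sequentially"
      using r by (intro order_tendstoD) auto
    then obtain k0 where k0: "\<And>k. k \<ge> k0 \<Longrightarrow> F m0 * (1/2) ^ k < r / 2"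
      by (auto simp: eventually_sequentially)
    have "norm (F m - 0) < r" if "m \<ge> m0 + k0" for m
    proof -
      have "m0 + (m - m0) = m" "k0 \<le> m - m0" using that by auto
      then show ?thesis using bd[of "m - m0"] k0[of "m - m0"] nn[of m] by simp
    qed
    then show "\<exists>no. \<forall>m\<ge>no. norm (F m - 0) < r" by blast
  qed
qed

abbreviation tail_mass :: "real \<Rightarrow> (real \<Rightarrow> real) \<Rightarrow> real" where
  "tail_mass R f \<equiv> LBINT x. indicator {R<..} x * x * f x"

section \<open>A priori estimates\<close>

text \<open>Two consequences of the growth conditions on the kernel enter the analysis.
  \<open>K_le\<close> controls quadratic terms by products of moments. For the tails it is too weak:
  multiplied by \<open>y\<close> it would leave \<open>y * wt b y\<close>, that is, a second moment.
  \<open>K_le_large\<close> avoids this by being linear in the larger size.\<close>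

locale coagulation_problem =
  fixes K :: "real \<Rightarrow> real \<Rightarrow> real" and b c :: real and f0 :: "real \<Rightarrow> real"
  assumes K_measurable: "measurable2 K"
    and K_nonneg: "\<And>x y. 0 \<le> K x y" and K_sym: "\<And>x y. K x y = K y x"
    and b_pos: "0 < b" and c_pos: "0 < c"
    and K_le: "\<And>x y. 0 < x \<Longrightarrow> 0 < y \<Longrightarrow> K x y \<le> c * (wt b x * wt b y)"
    and K_le_large: "\<And>x y. 0 < y \<Longrightarrow> y \<le> x \<Longrightarrow> 1 < x \<Longrightarrow> y * K x y \<le> c * (x * wt b y)"
    and f0: "admissible (2 * b) f0"
begin

abbreviation \<rho> :: "real \<Rightarrow> real" where "\<rho> \<equiv> wt (2 * b)"

definition M :: real where "M = (LBINT x. \<rho> x * f0 x)"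
definition trunc :: "nat \<Rightarrow> real \<Rightarrow> real \<Rightarrow> real" where "trunc n x y = min (K x y) (real n + 1)"
text \<open>\<open>real n + 1\<close> bounds the truncated kernel and \<open>M + 1\<close> exceeds
  the norm, which makes the step small enough for positivity. The added ones keep both factors
  positive for \<open>n = 0\<close> and for a vanishing datum.\<close>

definition tau :: "nat \<Rightarrow> real" where "tau n = 1 / ((real n + 1) * (M + 1))"

primrec u :: "nat \<Rightarrow> nat \<Rightarrow> real \<Rightarrow> real" where
  "u n 0 = f0"
| "u n (Suc j) = euler_step (tau n) (trunc n) (u n j)"

text \<open>Interpolation by step functions puts all approximations on one time axis; its jumps are
  the reason why the Lipschitz estimates for \<open>v\<close> carry an additional
  \<open>tau n\<close>.\<close>

definition v :: "nat \<Rightarrow> real \<Rightarrow> real \<Rightarrow> real" where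
  "v n t = u n (nat \<lfloor>t / tau n\<rfloor>)"

text \<open>Half of 3 * 4 * c * M^2: \<open>tilde\<close> of a function bounded by 1 is at most 3,
  the kernel is at most \<open>4 * c * (\<rho> x * \<rho> y)\<close>, and 1/2 is the factor in the
  equation.\<close>

definition lip :: real where "lip = 6 * c * M\<^sup>2"

lemma M_nonneg: "0 \<le> M"
  unfolding M_def by (rule admissibleD(6)[OF f0])

lemma tau_pos: "0 < tau n"
  unfolding tau_def using M_nonneg by simp

lemma lip_nonneg: "0 \<le> lip"
  unfolding lip_def using c_pos by simp

lemma trunc_measurable: "measurable2 (trunc n)"
  unfolding trunc_def using K_measurable by measurable

lemma trunc_props:
  "0 \<le> trunc n x y" "trunc n x y \<le> real n + 1" "trunc n x y \<le> K x y" "trunc n x y = trunc n y x"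
  using K_nonneg[of x y] K_sym[of x y] by (auto simp: trunc_def)

lemma wt_double_ge_1: "0 < x \<Longrightarrow> 1 \<le> \<rho> x"
  using b_pos by (intro wt_ge_1) auto

lemma wt_le: "0 < x \<Longrightarrow> wt b x \<le> 2 * \<rho> x"
  using b_pos by (intro wt_le_wt_double) auto

lemma K_le_wt_double:
  assumes "0 < x" "0 < y" shows "K x y \<le> 4 * c * (\<rho> x * \<rho> y)"
proof -
  have "wt b x * wt b y \<le> (2 * \<rho> x) * (2 * \<rho> y)"
    using wt_le assms wt_pos[of x b] wt_pos[of y b] wt_pos[of x "2 * b"] by (intro mult_mono) auto
  then have "c * (wt b x * wt b y) \<le> c * ((2 * \<rho> x) * (2 * \<rho> y))"
    using c_pos by (intro mult_left_mono) auto
  then show ?thesis using K_le[OF assms] by simp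
qed

lemma u_admissible: "admissible (2 * b) (u n j)"
  and u_norm: "(LBINT x. \<rho> x * u n j x) \<le> M"
proof -
  \<comment> \<open>Both claims go together, as the norm bound at step \<open>j\<close> is what
    admits the fixed step \<open>tau n\<close> once more.\<close>
  have "admissible (2 * b) (u n j) \<and> (LBINT x. \<rho> x * u n j x) \<le> M"
  proof (induction j)
    case 0 then show ?case using f0 by (simp add: M_def)
  next
    case (Suc j)
    let ?m = "LBINT x. \<rho> x * u n j x"
    have "tau n * ((real n + 1) * ?m) \<le> tau n * ((real n + 1) * (M + 1))"
      using Suc tau_pos[of n] by (intro mult_left_mono) auto
    also have "\<dots> = 1" unfolding tau_def using M_nonneg by simp
    finally have "tau n * ((real n + 1) * ?m) \<le> 1" .
    from euler_step_admissible[OF conjunct1[OF Suc] _ trunc_measurable trunc_props(1,2,4) _ this]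
    show ?case using Suc b_pos tau_pos[of n] by auto
  qed
  then show "admissible (2 * b) (u n j)" "(LBINT x. \<rho> x * u n j x) \<le> M" by auto
qed

lemma v_admissible: "admissible (2 * b) (v n t)"
  and v_norm: "(LBINT x. \<rho> x * v n t x) \<le> M"
  unfolding v_def by (rule u_admissible, rule u_norm)

lemma u_step:
  assumes "\<omega> \<in> borel_measurable borel" "\<And>x. 0 < x \<Longrightarrow> \<bar>\<omega> x\<bar> \<le> B * \<rho> x"
  shows "(LBINT x. \<omega> x * u n (Suc j) x) = (LBINT x. \<omega> x * u n j x) + tau n / 2 * coag_form (trunc n) \<omega> (u n j)"
  using euler_step_weak(2)[OF u_admissible _ trunc_measurable trunc_props(1,2,4) assms] b_pos by simp

lemma u_weak:
  assumes "\<omega> \<in> borel_measurable borel" "\<And>x. 0 < x \<Longrightarrow> \<bar>\<omega> x\<bar> \<le> B * \<rho> x"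
  shows "(LBINT x. \<omega> x * u n j x) = (LBINT x. \<omega> x * f0 x) + tau n / 2 * (\<Sum>i<j. coag_form (trunc n) \<omega> (u n i))"
proof (induction j)
  case (Suc j)
  show ?case using u_step[OF assms, where j = j and n = n] Suc by (simp add: algebra_simps)
qed simp

lemma coag_form_le:
  assumes g: "admissible (2 * b) g"
    and \<omega>: "\<omega> \<in> borel_measurable borel" "\<And>x. 0 < x \<Longrightarrow> \<bar>\<omega> x\<bar> \<le> B * \<rho> x"
    and \<Phi>: "\<Phi> \<in> borel_measurable lborel2"
      "\<And>x y. 0 < x \<Longrightarrow> 0 < y \<Longrightarrow> \<bar>\<Phi> (x, y)\<bar> \<le> B' * (\<rho> x * \<rho> y)"
    and le: "\<And>x y. 0 < x \<Longrightarrow> 0 < y \<Longrightarrow> (\<omega> (x + y) - \<omega> x - \<omega> y) * trunc n x y \<le> \<Phi> (x, y)"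
  shows "coag_form (trunc n) \<omega> g \<le> (LINT p|lborel2. \<Phi> p * (g (fst p) * g (snd p)))"
  unfolding coag_form_def
proof (rule integral_mono)
  show "integrable lborel2 (coag_integrand (trunc n) \<omega> g)"
    using euler_step_weak(3)[OF g _ trunc_measurable trunc_props(1,2,4) \<omega>] b_pos by simp
  show "integrable lborel2 (\<lambda>p. \<Phi> p * (g (fst p) * g (snd p)))"
    by (rule admissible_pair_integral[OF g g \<Phi>])
  fix p :: "real \<times> real"
  show "coag_integrand (trunc n) \<omega> g p
      \<le> \<Phi> p * (g (fst p) * g (snd p))"
  proof (cases "fst p \<le> 0 \<or> snd p \<le> 0")
    case True then show ?thesis using admissibleD(3)[OF g, of "fst p"] admissibleD(3)[OF g, of "snd p"] by auto
  next
    case False then show ?thesis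
      using le[of "fst p" "snd p"] admissibleD(2)[OF g] by (intro mult_right_mono) auto
  qed
qed

text \<open>\<open>tilde\<close> vanishes for the identity, which is dominated by the weight, so the
  scheme conserves mass exactly.\<close>

lemma v_mass: "(LBINT x. x * v n t x) = (LBINT x. x * f0 x)"
proof -
  have "\<bar>x\<bar> \<le> 1 * \<rho> x" if "0 < x" for x using wt_ge_self[OF that, of "2 * b"] that by simp
  from u_weak[OF _ this, where n = n and j = "nat \<lfloor>t / tau n\<rfloor>"] show ?thesis
    by (simp add: v_def coag_form_def)
qed

text \<open>Test with \<open>max 0 (x - 2 * r)\<close>: a collision changes it by at most the smaller size, and only if
  the larger size exceeds \<open>r\<close>.\<close>
lemma u_tail_recurrence:
  assumes r: "1 \<le> r"
  shows "tail_mass (4 * r) (u n j) \<le>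
    2 * tail_mass (2 * r) f0 +
    4 * c * M * tau n * (\<Sum>i<j. tail_mass r (u n i))"
proof -
  define \<omega> where "\<omega> = (\<lambda>x. max 0 (x - 2 * r))"
  have \<omega>[measurable]: "\<omega> \<in> borel_measurable borel" unfolding \<omega>_def by measurable
  have \<omega>B: "\<bar>\<omega> x\<bar> \<le> 1 * \<rho> x" if "0 < x" for x
    using wt_ge_self[OF that, of "2 * b"] that r wt_pos[OF that, of "2 * b"] unfolding \<omega>_def by simp
  define I where "I = (\<lambda>x. indicator {r<..} x * x :: real)"
  have I[measurable]: "I \<in> borel_measurable borel" unfolding I_def by measurable
  have IB: "\<bar>I x\<bar> \<le> 1 * \<rho> x" if "0 < x" for x
    unfolding I_def by (rule indicator_self_le_wt[OF that])
  have I0: "0 \<le> I x" for x using r unfolding I_def by (auto simp: indicator_def)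
  have wB: "\<bar>wt b x\<bar> \<le> 2 * \<rho> x" if "0 < x" for x
    using wt_le[OF that] wt_pos[OF that, of b] by simp
  \<comment> \<open>Either partner may be the larger one, hence a symmetric majorant; each summand
    has product form and integrates to a product of moments.\<close>
  define \<Phi> where "\<Phi> = (\<lambda>p. c * (I (fst p) * wt b (snd p) + wt b (fst p) * I (snd p)))"
  have \<Phi>[measurable]: "\<Phi> \<in> borel_measurable lborel2" unfolding \<Phi>_def by measurable
  have \<Phi>B: "\<bar>\<Phi> (x, y)\<bar> \<le> (4 * c) * (\<rho> x * \<rho> y)" if xy: "0 < x" "0 < y" for x y
  proof -
    have 1: "I x * wt b y \<le> \<rho> x * (2 * \<rho> y)"
      using IB[OF xy(1)] wB[OF xy(2)] I0[of x] wt_pos[OF xy(2), of b] wt_pos[OF xy(1), of "2*b"] by (intro mult_mono) auto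
    have 2: "wt b x * I y \<le> (2 * \<rho> x) * \<rho> y"
      using IB[OF xy(2)] wB[OF xy(1)] I0[of y] wt_pos[OF xy(1), of b] wt_pos[OF xy(1), of "2*b"] by (intro mult_mono) auto
    have 3: "0 \<le> I x * wt b y + wt b x * I y"
      using I0 wt_pos[OF xy(1), of b] wt_pos[OF xy(2), of b] by simp
    have "\<bar>\<Phi> (x, y)\<bar> = c * (I x * wt b y + wt b x * I y)" using 3 c_pos unfolding \<Phi>_def by simp
    also have "\<dots> \<le> c * (4 * (\<rho> x * \<rho> y))" using 1 2 c_pos by (intro mult_left_mono) auto
    finally show ?thesis by simp
  qed
  have le: "(\<omega> (x + y) - \<omega> x - \<omega> y) * trunc m x y \<le> \<Phi> (x, y)" if xy: "0 < x" "0 < y" for x y m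
  proof (cases "x + y \<le> 2 * r")
    case True
    then have "\<omega> (x + y) - \<omega> x - \<omega> y = 0" unfolding \<omega>_def using xy by simp
    moreover have "0 \<le> \<Phi> (x, y)"
      unfolding \<Phi>_def using I0 wt_pos[OF xy(1), of b] wt_pos[OF xy(2), of b] c_pos by simp
    ultimately show ?thesis by simp
  next
    case large: False
    have main: "(\<omega> (x + y) - \<omega> x - \<omega> y) * trunc m x y \<le> c * (I x * wt b y)"
      if "0 < x" "0 < y" "y \<le> x" "\<not> x + y \<le> 2 * r" for x y
    proof -
      have "(\<omega> (x + y) - \<omega> x - \<omega> y) * trunc m x y \<le> y * K x y"
        using trunc_props[of m x y] that by (intro mult_mono) (auto simp: \<omega>_def)
      also have "\<dots> \<le> c * (x * wt b y)" using that r by (intro K_le_large) auto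
      also have "c * (x * wt b y) = c * (I x * wt b y)" using that unfolding I_def by simp
      finally show ?thesis .
    qed
    show ?thesis
    proof (cases "y \<le> x")
      case True
      have "(\<omega> (x + y) - \<omega> x - \<omega> y) * trunc m x y \<le> c * (I x * wt b y)"
        using main[OF xy True large] .
      also have "\<dots> \<le> \<Phi> (x, y)" unfolding \<Phi>_def using I0 wt_pos[OF xy(1), of b] c_pos by simp
      finally show ?thesis .
    next
      case False
      have "(\<omega> (x + y) - \<omega> x - \<omega> y) * trunc m x y = (\<omega> (y + x) - \<omega> y - \<omega> x) * trunc m y x"
        using trunc_props(4)[of m x y] by (simp add: algebra_simps)
      also have "\<dots> \<le> c * (I y * wt b x)"
        using main[OF xy(2,1)] False large by simp
      also have "\<dots> \<le> \<Phi> (x, y)" unfolding \<Phi>_def using I0 wt_pos[OF xy(2), of b] c_pos by (simp add: mult_ac)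
      finally show ?thesis .
    qed
  qed
  \<comment> \<open>One factor 2 comes from the two symmetric halves of \<open>\<Phi>\<close>, the
    other from \<open>wt b x \<le> 2 * \<rho> x\<close>.\<close>
  have form: "coag_form (trunc n) \<omega> (u n i) \<le> 4 * c * M * (LBINT x. I x * u n i x)" for i
  proof -
    let ?u = "u n i"
    note a = u_admissible[of n i]
    have iI: "integrable lborel (\<lambda>x. I x * ?u x)" by (rule admissible_integral[OF a I IB])
    have iw: "integrable lborel (\<lambda>x. wt b x * ?u x)" by (rule admissible_integral[OF a wt_measurable wB])
    have I_nn: "0 \<le> (LBINT x. I x * ?u x)" using I0 admissibleD(2)[OF a] by simp
    have w_le: "(LBINT x. wt b x * ?u x) \<le> 2 * M"
      using admissible_integral(2)[OF a wt_measurable wB] u_norm[of n i] by simp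
    have "coag_form (trunc n) \<omega> ?u \<le> (LINT p|lborel2. \<Phi> p * (?u (fst p) * ?u (snd p)))"
      by (rule coag_form_le[OF a \<omega> \<omega>B \<Phi> \<Phi>B le])
    also have "\<dots> = (LINT p|lborel2. c * ((I (fst p) * ?u (fst p)) * (wt b (snd p) * ?u (snd p)) +
        (wt b (fst p) * ?u (fst p)) * (I (snd p) * ?u (snd p))))"
      unfolding \<Phi>_def by (intro Bochner_Integration.integral_cong) (auto simp: algebra_simps)
    also have "\<dots> = c * (2 * ((LBINT x. I x * ?u x) * (LBINT x. wt b x * ?u x)))"
      using integrable_pair_times[OF iI iw] integrable_pair_times[OF iw iI] by (simp add: algebra_simps)
    also have "\<dots> \<le> c * (2 * ((LBINT x. I x * ?u x) * (2 * M)))"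
      using c_pos I_nn w_le by (intro mult_left_mono) auto
    finally show ?thesis by (simp add: mult_ac)
  qed
  have "tail_mass (4 * r) (u n j) \<le> (LBINT x. 2 * (\<omega> x * u n j x))"
  proof (rule integral_mono)
    show "integrable lborel (\<lambda>x. indicator {4 * r<..} x * x * u n j x)"
      using admissible_integral(1)[OF u_admissible[of n j] _ indicator_self_le_wt] by simp
    show "integrable lborel (\<lambda>x. 2 * (\<omega> x * u n j x))"
      using admissible_integral(1)[OF u_admissible[of n j] \<omega> \<omega>B] by simp
    fix x
    \<comment> \<open>Beyond \<open>4 * r\<close> the subtracted \<open>2 * r\<close> is less than
      half of \<open>x\<close>; this is the origin of the factor 2 and of the scale
      \<open>4 * r\<close> on the left.\<close>
    have "indicator {4 * r<..} x * x \<le> 2 * \<omega> x" using r unfolding \<omega>_def by (auto simp: indicator_def)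
    from mult_right_mono[OF this admissibleD(2)[OF u_admissible, of n j x]]
    show "indicator {4 * r<..} x * x * u n j x \<le> 2 * (\<omega> x * u n j x)" by simp
  qed
  also have "\<dots> = 2 * (LBINT x. \<omega> x * u n j x)" by simp
  also have "(LBINT x. \<omega> x * u n j x) = (LBINT x. \<omega> x * f0 x) + tau n / 2 * (\<Sum>i<j. coag_form (trunc n) \<omega> (u n i))"
    by (rule u_weak[OF \<omega> \<omega>B])
  also have "(LBINT x. \<omega> x * f0 x) \<le> tail_mass (2 * r) f0"
  proof (rule integral_mono)
    show "integrable lborel (\<lambda>x. indicator {2 * r<..} x * x * f0 x)"
      using admissible_integral(1)[OF f0 _ indicator_self_le_wt] by simp
    show "integrable lborel (\<lambda>x. \<omega> x * f0 x)"
      using admissible_integral(1)[OF f0 \<omega> \<omega>B] by simp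
    fix x
    have "\<omega> x \<le> indicator {2 * r<..} x * x" using r unfolding \<omega>_def by (auto simp: indicator_def)
    from mult_right_mono[OF this admissibleD(2)[OF f0, of x]]
    show "\<omega> x * f0 x \<le> indicator {2 * r<..} x * x * f0 x" by simp
  qed
  also have "tau n / 2 * (\<Sum>i<j. coag_form (trunc n) \<omega> (u n i)) \<le>
      tau n / 2 * (\<Sum>i<j. 4 * c * M * (LBINT x. I x * u n i x))"
    using tau_pos[of n] by (intro mult_left_mono sum_mono form) auto
  finally show ?thesis
    unfolding I_def by (simp add: sum_distrib_left mult_ac)
qed

text \<open>A time \<open>t\<close> is reached in at most \<open>t / tau n\<close> steps, so
  discrete growth factors have a bound that does not depend on \<open>n\<close>.\<close>

lemma one_plus_tau_power_le:
  assumes "0 \<le> d" "0 \<le> t"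
  shows "(1 + d * tau n) ^ nat \<lfloor>t / tau n\<rfloor> \<le> exp (d * t)"
proof -
  have "(1 + d * tau n) ^ nat \<lfloor>t / tau n\<rfloor> \<le> exp (d * tau n) ^ nat \<lfloor>t / tau n\<rfloor>"
    using assms tau_pos[of n] by (intro power_mono) auto
  also have "\<dots> = exp (real (nat \<lfloor>t / tau n\<rfloor>) * (d * tau n))"
    by (rule exp_of_nat_mult[symmetric])
  also have "\<dots> \<le> exp (d * t)"
  proof -
    have "0 \<le> t / tau n" using assms tau_pos[of n] by simp
    then have "real (nat \<lfloor>t / tau n\<rfloor>) \<le> t / tau n" by (simp add: of_nat_floor)
    then have "real (nat \<lfloor>t / tau n\<rfloor>) * tau n \<le> t" using tau_pos[of n] by (simp add: field_simps)
    from mult_left_mono[OF this assms(1)] show ?thesis by (simp add: mult_ac)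
  qed
  finally show ?thesis .
qed

text \<open>\<open>F m\<close> bounds the mass beyond size 4^m, up to a growth factor in time, for
  all \<open>n\<close> at once. It starts from the full moment bound \<open>M\<close>; each change
  of scale adds the initial tail \<open>a m\<close> to half of \<open>F m\<close>. As the datum has
  finite first moment, \<open>a\<close> tends to 0 and hence so does \<open>F\<close>.\<close>

lemma v_tail:
  assumes e: "0 < e"
  obtains R where "1 \<le> R" "\<And>n t. 0 \<le> t \<Longrightarrow> t \<le> T \<Longrightarrow> tail_mass R (v n t) \<le> e"
proof -
  \<comment> \<open>the factor \<open>(1 + l * tau n) ^ j\<close> turns the recurrence into a contraction by 1/2 between scales\<close>
  define l where "l = 8 * c * M + 1"
  have l: "0 < l" "8 * c * M \<le> l" unfolding l_def using c_pos M_nonneg by (auto intro: add_nonneg_pos)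
  define a where "a = (\<lambda>m::nat. 2 * tail_mass (2 * 4 ^ m) f0)"
  define F where "F = rec_nat M (\<lambda>m y. a m + y / 2)"
  have F0: "F 0 = M" and FS: "F (Suc m) = a m + F m / 2" for m unfolding F_def by simp_all
  have a0: "0 \<le> a m" for m
  proof -
    have "0 \<le> indicator {2 * 4 ^ m<..} x * x * f0 x" for x
      using admissibleD(2,3)[OF f0, of x] by (cases "x \<le> 0") (auto simp: indicator_def)
    then show ?thesis unfolding a_def by simp
  qed
  have int: "integrable lborel (\<lambda>x. x * f0 x)"
    using admissible_integral(1)[OF f0, of "\<lambda>x. x" 1] wt_ge_self by simp
  have "(\<lambda>m. LBINT x. indicator {2 * 4 ^ m<..} x * (x * f0 x)) \<longlonglongrightarrow> 0"
  proof (rule tendsto_integral_decseq[OF int])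
    show "decseq (\<lambda>m. {2 * 4 ^ m<..} :: real set)"
    proof (rule decseq_SucI)
      fix m :: nat show "greaterThan (2 * 4 ^ Suc m) \<subseteq> greaterThan ((2::real) * 4 ^ m)" by (simp add: greaterThan_subset_iff)
    qed
    have "\<exists>m. x \<le> 2 * 4 ^ m" for x :: real
    proof -
      obtain m :: nat where "x < 4 ^ m" using real_arch_pow[of 4 x] by auto
      moreover have "(0::real) < 4 ^ m" by simp
      ultimately have "x \<le> 2 * 4 ^ m" by linarith
      then show ?thesis ..
    qed
    then show "(\<Inter>m::nat. greaterThan ((2::real) * 4 ^ m)) = {}" by auto (metis not_less)
  qed simp
  then have a_lim: "a \<longlonglongrightarrow> 0" unfolding a_def by (auto intro!: tendsto_mult_right_zero simp: mult.assoc)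
  have F_lim: "F \<longlonglongrightarrow> 0"
    by (rule halving_recurrence_tendsto_0[OF FS a_lim a0]) (simp add: F0 M_nonneg)
  have Fnn: "0 \<le> F m" for m by (induction m) (use F0 FS a0 M_nonneg in auto)
  have T: "tail_mass (4 ^ m) (u n j) \<le> F m * (1 + l * tau n) ^ j" for m n j
  proof (induction m arbitrary: j)
    case 0
    have 1: "1 \<le> (1 + l * tau n) ^ j" using l tau_pos[of n] by (intro one_le_power) auto
    have "tail_mass (4 ^ 0) (u n j) \<le> M"
      using admissible_integral(2)[OF u_admissible[of n j] _ indicator_self_le_wt[where A = "{1<..}"]] u_norm[of n j] by simp
    also have "\<dots> \<le> M * (1 + l * tau n) ^ j" using mult_left_mono[OF 1 M_nonneg] by simp
    finally show ?case by (simp add: F0)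
  next
    case (Suc m)
    let ?q = "1 + l * tau n"
    have q: "1 \<le> ?q" using l tau_pos[of n] by simp
    \<comment> \<open>By the geometric series, summing the growth factors over all earlier steps
      costs no more than 1 / (l * tau n) times the current factor. With \<open>4 * c * M\<close> at
      most \<open>l / 2\<close> this leaves half of \<open>F m\<close>.\<close>
    have geom: "l * tau n * (\<Sum>i<j. ?q ^ i) \<le> ?q ^ j"
    proof -
      have "(?q - 1) * (\<Sum>i<j. ?q ^ i) = ?q ^ j - 1"
        using power_diff_1_eq[of ?q j] by simp
      then show ?thesis by simp
    qed
    have "tail_mass (4 ^ Suc m) (u n j) \<le> a m +
        4 * c * M * tau n * (\<Sum>i<j. tail_mass (4 ^ m) (u n i))"
      using u_tail_recurrence[of "4 ^ m" n j] unfolding a_def by simp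
    also have "4 * c * M * tau n * (\<Sum>i<j. tail_mass (4 ^ m) (u n i)) \<le>
        4 * c * M * tau n * (\<Sum>i<j. F m * ?q ^ i)"
      using c_pos M_nonneg tau_pos[of n] by (intro mult_left_mono sum_mono Suc) auto
    also have "\<dots> = (4 * c * M) * (tau n * F m * (\<Sum>i<j. ?q ^ i))" by (simp add: sum_distrib_left mult_ac)
    also have "\<dots> \<le> (l / 2) * (tau n * F m * (\<Sum>i<j. ?q ^ i))"
      using l Fnn[of m] tau_pos[of n] q by (intro mult_right_mono mult_nonneg_nonneg sum_nonneg) auto
    also have "\<dots> = F m / 2 * (l * tau n * (\<Sum>i<j. ?q ^ i))" by simp
    also have "\<dots> \<le> F m / 2 * ?q ^ j" using Fnn[of m] by (intro mult_left_mono geom) auto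
    also have "a m \<le> a m * ?q ^ j" using mult_left_mono[OF one_le_power[OF q, of j] a0[of m]] by simp
    finally show ?case unfolding FS by (simp add: algebra_simps)
  qed
  define e' where "e' = e / exp (l * \<bar>T\<bar>)"
  have "e' > 0" unfolding e'_def using e by simp
  then obtain m where m: "F m < e'"
    using order_tendstoD(2)[OF F_lim, of e'] by (auto simp: eventually_sequentially)
  show ?thesis
  proof
    show "1 \<le> (4::real) ^ m" by simp
    fix n t assume t: "0 \<le> t" "t \<le> T"
    have "tail_mass (4 ^ m) (v n t) \<le> F m * (1 + l * tau n) ^ nat \<lfloor>t / tau n\<rfloor>"
      unfolding v_def by (rule T)
    also have "\<dots> \<le> F m * exp (l * t)"
      using Fnn one_plus_tau_power_le[of l t n] l t by (intro mult_left_mono) auto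
    also have "\<dots> \<le> e' * exp (l * \<bar>T\<bar>)"
      using m t l Fnn[of m] by (intro mult_mono) auto
    also have "\<dots> = e" unfolding e'_def by simp
    finally show "tail_mass (4 ^ m) (v n t) \<le> e" .
  qed
qed

end

section \<open>Equicontinuity in time and uniform integrability of the approximations\<close>

context coagulation_problem
begin

lemma bounded_le_wt: "0 \<le> B \<Longrightarrow> 0 < x \<Longrightarrow> \<bar>y\<bar> \<le> B \<Longrightarrow> \<bar>y\<bar> \<le> B * \<rho> x"
  using mult_left_mono[OF wt_double_ge_1, of x B] by simp

lemma coag_form_bound:
  assumes g: "admissible (2 * b) g" "(LBINT x. \<rho> x * g x) \<le> M"
    and \<omega>[measurable]: "\<omega> \<in> borel_measurable borel" and B: "\<And>x. \<bar>\<omega> x\<bar> \<le> B"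
    and \<kappa>[measurable]: "measurable2 \<kappa>"
    and \<kappa>b: "\<And>x y. 0 \<le> \<kappa> x y" "\<And>x y. \<kappa> x y \<le> K x y"
  shows "integrable lborel2 (coag_integrand \<kappa> \<omega> g)"
    and "(LINT p|lborel2. \<bar>coag_integrand \<kappa> \<omega> g p\<bar>) \<le> 2 * (B * lip)"
    and "\<bar>coag_form \<kappa> \<omega> g\<bar> \<le> 2 * (B * lip)"
proof -
  have B0: "0 \<le> B" using order_trans[OF abs_ge_zero B] .
  let ?\<Phi> = "\<lambda>p. tilde \<omega> p * \<kappa> (fst p) (snd p)"
  have le: "\<bar>?\<Phi> (x, y)\<bar>
      \<le> (12 * B * c) * (\<rho> x * \<rho> y)" if "0 < x" "0 < y" for x y
  proof -
    have "\<bar>\<omega> (x + y) - \<omega> x - \<omega> y\<bar> \<le> 3 * B" using B[of "x + y"] B[of x] B[of y] by linarith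
    moreover have "\<kappa> x y \<le> 4 * c * (\<rho> x * \<rho> y)"
      using \<kappa>b(2) K_le_wt_double[OF that] by (rule order_trans)
    ultimately have "\<bar>\<omega> (x + y) - \<omega> x - \<omega> y\<bar> * \<kappa> x y \<le> (3 * B) * (4 * c * (\<rho> x * \<rho> y))"
      using \<kappa>b(1) B0 by (intro mult_mono) auto
    then show ?thesis using \<kappa>b(1)[of x y] by (simp add: abs_mult mult_ac)
  qed
  have le': "\<bar>\<bar>?\<Phi> (x, y)\<bar>\<bar> \<le> (12 * B * c) * (\<rho> x * \<rho> y)" if "0 < x" "0 < y" for x y
    using le[OF that] by simp
  show "integrable lborel2 (\<lambda>p. ?\<Phi> p * (g (fst p) * g (snd p)))"
    by (rule admissible_pair_integral[OF g(1) g(1) _ le]) measurable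
  have "(LINT p|lborel2. \<bar>?\<Phi> p * (g (fst p) * g (snd p))\<bar>) =
      (LINT p|lborel2. \<bar>?\<Phi> p\<bar> * (g (fst p) * g (snd p)))"
    using admissibleD(2)[OF g(1)] by (simp add: abs_mult)
  also have "\<dots> \<le> (12 * B * c) * ((LBINT x. \<rho> x * g x) * (LBINT x. \<rho> x * g x))"
    by (rule order_trans[OF abs_ge_self admissible_pair_integral(2)[OF g(1) g(1) _ le']]) measurable
  also have "\<dots> \<le> (12 * B * c) * (M * M)"
    using g B0 c_pos M_nonneg admissibleD(6)[OF g(1)] by (intro mult_left_mono mult_mono) auto
  also have "\<dots> = 2 * (B * lip)" unfolding lip_def by (simp add: power2_eq_square)
  finally show abs: "(LINT p|lborel2. \<bar>?\<Phi> p * (g (fst p) * g (snd p))\<bar>) \<le> 2 * (B * lip)" .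
  show "\<bar>coag_form \<kappa> \<omega> g\<bar> \<le> 2 * (B * lip)"
    unfolding coag_form_def by (rule order_trans[OF integral_abs_bound abs])
qed

lemma u_lipschitz:
  assumes \<omega>: "\<omega> \<in> borel_measurable borel" "\<And>x. \<bar>\<omega> x\<bar> \<le> B" and ij: "i \<le> j"
  shows "\<bar>(LBINT x. \<omega> x * u n j x) - (LBINT x. \<omega> x * u n i x)\<bar> \<le> B * lip * (tau n * (real j - real i))"
  using ij
proof (induction j rule: dec_induct)
  case (step j)
  have B0: "0 \<le> B" using order_trans[OF abs_ge_zero \<omega>(2)] .
  have "\<bar>coag_form (trunc n) \<omega> (u n j)\<bar> \<le> 2 * (B * lip)"
    by (rule coag_form_bound(3)[OF u_admissible u_norm \<omega> trunc_measurable trunc_props(1,3)])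
  then have "\<bar>tau n / 2 * coag_form (trunc n) \<omega> (u n j)\<bar> \<le> tau n / 2 * (2 * (B * lip))"
    unfolding abs_mult using tau_pos[of n] by (intro mult_mono) auto
  then show ?case
    using step.IH u_step[OF \<omega>(1) bounded_le_wt[OF B0 _ \<omega>(2)], of n j] by (simp add: algebra_simps)
qed simp

text \<open>Because of rounding, the numbers of steps up to \<open>s\<close> and \<open>t\<close>
  differ by at most \<open>\<bar>t - s\<bar> / tau n + 1\<close>; the extra step contributes
  \<open>tau n\<close>, which disappears in the limit.\<close>

lemma v_lipschitz:
  assumes \<omega>: "\<omega> \<in> borel_measurable borel" "\<And>x. \<bar>\<omega> x\<bar> \<le> B" and st: "0 \<le> s" "0 \<le> t"
  shows "\<bar>(LBINT x. \<omega> x * v n t x) - (LBINT x. \<omega> x * v n s x)\<bar> \<le> B * lip * (\<bar>t - s\<bar> + tau n)"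
  using st
proof (induction s t rule: linorder_wlog)
  case (le s t)
  have B0: "0 \<le> B" using order_trans[OF abs_ge_zero \<omega>(2)] .
  have "s / tau n \<le> t / tau n" using le tau_pos[of n] by (simp add: divide_right_mono)
  then have ij: "nat \<lfloor>s / tau n\<rfloor> \<le> nat \<lfloor>t / tau n\<rfloor>" by (intro nat_mono floor_mono)
  have "0 \<le> s / tau n" "0 \<le> t / tau n" using le tau_pos[of n] by auto
  then have "real (nat \<lfloor>t / tau n\<rfloor>) - real (nat \<lfloor>s / tau n\<rfloor>) \<le> t / tau n - s / tau n + 1"
    by (simp add: of_nat_nat) linarith
  then have "tau n * (real (nat \<lfloor>t / tau n\<rfloor>) - real (nat \<lfloor>s / tau n\<rfloor>)) \<le> tau n * (t / tau n - s / tau n + 1)"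
    using tau_pos[of n] by (intro mult_left_mono) auto
  also have "\<dots> = \<bar>t - s\<bar> + tau n" using tau_pos[of n] le by (simp add: field_simps)
  finally have "B * lip * (tau n * (real (nat \<lfloor>t / tau n\<rfloor>) - real (nat \<lfloor>s / tau n\<rfloor>))) \<le> B * lip * (\<bar>t - s\<bar> + tau n)"
    using B0 lip_nonneg by (intro mult_left_mono) auto
  with u_lipschitz[OF \<omega> ij, of n] show ?case unfolding v_def by linarith
next
  case (sym s t)
  then show ?case by (simp add: abs_minus_commute)
qed

lemma v_integrable: "integrable lborel (v n t)"
  and v_le: "(LBINT x. v n t x) \<le> M"
proof -
  have "\<bar>1\<bar> \<le> 1 * \<rho> x" if "0 < x" for x using wt_double_ge_1[OF that] by simp
  from admissible_integral[OF v_admissible[of n t] _ this]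
  show "integrable lborel (v n t)" "(LBINT x. v n t x) \<le> M" using v_norm[of n t] by auto
qed

lemma v_nonneg: "0 \<le> v n t x"
  by (rule admissibleD(2)[OF v_admissible])

lemma v_L1_lipschitz:
  assumes st: "0 \<le> s" "0 \<le> t"
  shows "(LBINT x. \<bar>v n t x - v n s x\<bar>) \<le> lip * (\<bar>t - s\<bar> + tau n)"
proof (rule integral_abs_diff_le[OF v_integrable v_integrable])
  fix \<omega> :: "real \<Rightarrow> real" assume \<omega>: "\<omega> \<in> borel_measurable lborel" "\<And>x. \<bar>\<omega> x\<bar> \<le> 1"
  have "\<omega> \<in> borel_measurable borel" using \<omega>(1) by simp
  from v_lipschitz[OF this \<omega>(2) st, of n]
  show "(LBINT x. \<omega> x * v n t x) - (LBINT x. \<omega> x * v n s x) \<le> lip * (\<bar>t - s\<bar> + tau n)"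
    by simp
qed

text \<open>A gained particle \<open>x + y \<in> A\<close> has weight at most \<open>x powr (-b)\<close> and rate at most a constant times
  \<open>x powr (-b) * y powr (-b)\<close>; as translations preserve the measure of \<open>A\<close>, the moment of order \<open>-2 * b\<close>
  closes the estimate.\<close>
lemma u_uniformly_integrable:
  assumes R: "1 \<le> R" and N: "0 \<le> N" and e: "0 \<le> e"
    and base: "\<And>A. A \<in> sets lborel \<Longrightarrow> A \<subseteq> {0<..<R} \<Longrightarrow>
      (LBINT x. indicator A x * x powr (-b) * f0 x) \<le> N * measure lborel A + e"
    and A: "A \<in> sets lborel" "A \<subseteq> {0<..<R}"
  shows "(LBINT x. indicator A x * x powr (-b) * u n j x) \<le>
    (N * measure lborel A + e) * (1 + (c * (1 + R powr (1 + b))\<^sup>2 * M / 2) * tau n) ^ j"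
  using A
proof (induction j arbitrary: A)
  case 0 then show ?case using base by simp
next
  case (Suc j)
  note [measurable] = Suc.prems(1)
  let ?D = "c * (1 + R powr (1 + b))\<^sup>2" and ?u = "u n j"
  let ?q = "1 + (?D * M / 2) * tau n"
  define L where "L = (N * measure lborel A + e) * ?q ^ j"
  note adm = u_admissible[of n j]
  note [measurable] = admissibleD(1)[OF adm]
  have D: "0 \<le> ?D" using c_pos by simp
  have q: "0 \<le> ?q" using D M_nonneg tau_pos[of n] by (intro add_nonneg_nonneg mult_nonneg_nonneg) auto
  have L: "0 \<le> L" unfolding L_def using N e q by simp
  define \<omega> where "\<omega> = (\<lambda>x. indicator A x * x powr (-b) :: real)"
  have \<omega>[measurable]: "\<omega> \<in> borel_measurable borel" unfolding \<omega>_def by measurable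
  have pB: "x powr (-b) \<le> \<rho> x" if "0 < x" for x using powr_le_wt_double[of b x] that b_pos by simp
  have indB: "\<bar>indicator S x * x powr (-b)\<bar> \<le> 1 * \<rho> x" if "0 < x" for x and S :: "real set"
    using pB[OF that] by (auto simp: indicator_def less_imp_le[OF wt_pos[OF that]])
  have \<omega>B: "\<bar>\<omega> x\<bar> \<le> 1 * \<rho> x" if "0 < x" for x
    unfolding \<omega>_def by (rule indB[OF that])
  have \<omega>0: "0 \<le> \<omega> x" for x unfolding \<omega>_def by simp
  \<comment> \<open>Below \<open>R\<close> the linear part of the weight is absorbed by the power,
    so the kernel is bounded by a product of pure powers of order -b; the square of this factor
    enters the growth rate.\<close>
  have w_le: "wt b x \<le> (1 + R powr (1 + b)) * x powr (-b)" if "0 < x" "x < R" for x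
  proof -
    have "x = x powr (1 + b) * x powr (-b)" using that by (simp flip: powr_add)
    also have "\<dots> \<le> R powr (1 + b) * x powr (-b)"
      using that b_pos by (intro mult_right_mono powr_mono2) auto
    finally show ?thesis unfolding wt_def by (simp add: algebra_simps)
  qed
  \<comment> \<open>The variable \<open>y\<close> keeps the order -b, so that the inner integral is
    again of the kind estimated by the induction hypothesis.\<close>
  define \<Phi> where "\<Phi> = (\<lambda>p. ?D * (fst p powr (- (2 * b)) * (indicator A (fst p + snd p) * snd p powr (-b))))"
  have \<Phi>[measurable]: "\<Phi> \<in> borel_measurable lborel2" unfolding \<Phi>_def by measurable
  have \<Phi>B: "\<bar>\<Phi> (x, y)\<bar> \<le> ?D * (\<rho> x * \<rho> y)" if xy: "0 < x" "0 < y" for x y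
  proof -
    have "\<bar>x powr (- (2 * b)) * (indicator A (x + y) * y powr (-b))\<bar> \<le> \<rho> x * \<rho> y"
      unfolding abs_mult using xy pB[OF xy(2)] wt_ge_powr[OF xy(1), of "2 * b"] wt_pos[OF xy(2), of "2*b"]
      by (intro mult_mono) (auto simp: indicator_def less_imp_le[OF wt_pos])
    from mult_left_mono[OF this D] show ?thesis
      unfolding \<Phi>_def fst_conv snd_conv abs_mult[of ?D] abs_of_nonneg[OF D] .
  qed
  have le: "(\<omega> (x + y) - \<omega> x - \<omega> y) * trunc n x y \<le> \<Phi> (x, y)" if xy: "0 < x" "0 < y" for x y
  proof (cases "x + y \<in> A")
    case False
    have "(\<omega> (x + y) - \<omega> x - \<omega> y) * trunc n x y \<le> 0"
    proof (rule mult_nonpos_nonneg)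
      have "\<omega> (x + y) = 0" using False by (simp add: \<omega>_def)
      then show "\<omega> (x + y) - \<omega> x - \<omega> y \<le> 0" using \<omega>0[of x] \<omega>0[of y] by simp
    qed (rule trunc_props(1))
    also have "0 \<le> \<Phi> (x, y)" unfolding \<Phi>_def using D by simp
    finally show ?thesis .
  next
    case True
    then have xR: "x < R" "y < R" using Suc.prems(2) xy by auto
    have "(\<omega> (x + y) - \<omega> x - \<omega> y) * trunc n x y \<le> x powr (-b) * K x y"
    proof (intro mult_mono)
      show "\<omega> (x + y) - \<omega> x - \<omega> y \<le> x powr (-b)"
      proof -
        have "\<omega> (x + y) \<le> x powr (-b)"
          using powr_minus_antimono[of b x "x + y"] b_pos xy by (simp add: \<omega>_def indicator_def)
        then show ?thesis using \<omega>0[of x] \<omega>0[of y] by linarith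
      qed
    qed (use trunc_props in auto)
    also have "K x y \<le> c * (((1 + R powr (1 + b)) * x powr (-b)) * ((1 + R powr (1 + b)) * y powr (-b)))"
      using K_le[OF xy] w_le[OF xy(1) xR(1)] w_le[OF xy(2) xR(2)] c_pos wt_pos[OF xy(1), of b] wt_pos[OF xy(2), of b]
      by (elim order_trans) (intro mult_left_mono mult_mono, auto)
    also have "x powr (-b) * (c * (((1 + R powr (1 + b)) * x powr (-b)) * ((1 + R powr (1 + b)) * y powr (-b)))) = \<Phi> (x, y)"
    proof -
      have "x powr (-b) * x powr (-b) = x powr (- (2 * b))" by (simp flip: powr_add)
      then show ?thesis unfolding \<Phi>_def using True by (simp add: power2_eq_square mult_ac)
    qed
    finally show ?thesis by (simp add: mult_left_mono)
  qed
  \<comment> \<open>The induction hypothesis is applied to the translate of \<open>A\<close> by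
    \<open>- x\<close>, cut to positive sizes. It stays in \<open>{0<..<R}\<close> since
    \<open>x\<close> is positive, and its measure is not larger. This is why the induction runs over
    all sets \<open>A\<close>.\<close>
  have inner: "(LBINT y. indicator A (x + y) * y powr (-b) * ?u y) \<le> L" if x: "0 < x" for x
  proof -
    let ?A = "{y. x + y \<in> A} \<inter> {0<..}"
    have m: "{y. x + y \<in> A} \<in> sets lborel" by measurable
    have finA: "emeasure lborel A < \<infinity>"
      by (rule emeasure_bounded_finite[OF bounded_subset[OF _ Suc.prems(2)]]) simp
    have iA: "integrable lborel (\<lambda>y. indicator A y :: real)"
      using finA Suc.prems(1) by (intro integrable_real_indicator) auto
    have iA': "integrable lborel (\<lambda>y. indicator A (x + 1 * y) :: real)"
      by (rule lborel_integrable_real_affine[OF iA]) simp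
    have "measure lborel ?A = (LBINT y. indicator ?A y)" using m by simp
    also have "\<dots> \<le> (LBINT y. indicator A (x + 1 * y))"
    proof (rule integral_mono[OF _ iA'])
      show "integrable lborel (\<lambda>y. indicator ?A y :: real)"
        by (rule Bochner_Integration.integrable_bound[OF iA']) (use m in \<open>auto simp: indicator_def\<close>)
    qed (auto simp: indicator_def)
    also have "\<dots> = (LBINT y. indicator A y)"
      using lborel_integral_real_affine[of 1 "\<lambda>y. indicator A y :: real" x] by simp
    finally have mA: "measure lborel ?A \<le> measure lborel A" by simp
    have "(LBINT y. indicator A (x + y) * y powr (-b) * ?u y) = (LBINT y. indicator ?A y * y powr (-b) * ?u y)"
      using admissibleD(3)[OF adm] by (intro Bochner_Integration.integral_cong) (auto simp: indicator_def)
    also have "\<dots> \<le> (N * measure lborel ?A + e) * ?q ^ j"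
      using Suc.prems(2) x m by (intro Suc.IH) auto
    also have "\<dots> \<le> L" unfolding L_def using mA N q by (intro mult_right_mono add_right_mono mult_left_mono) auto
    finally show ?thesis .
  qed
  have form: "coag_form (trunc n) \<omega> ?u \<le> ?D * M * L"
  proof -
    note int = admissible_pair_integral(1)[OF adm adm \<Phi> \<Phi>B]
    have int_x: "integrable lborel (\<lambda>x. x powr (- (2 * b)) * ?u x)"
      by (rule admissible_integral[OF adm, where B=1]) (use wt_ge_powr in auto)
    have "coag_form (trunc n) \<omega> ?u \<le> (LINT p|lborel2. \<Phi> p * (?u (fst p) * ?u (snd p)))"
      by (rule coag_form_le[OF adm \<omega> \<omega>B \<Phi> \<Phi>B le])
    also have "\<dots> = (LBINT x. LBINT y. \<Phi> (x, y) * (?u x * ?u y))"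
      using lborel_pair.integral_fst'[OF int] by simp
    also have "\<dots> \<le> (LBINT x. ?D * L * (x powr (- (2 * b)) * ?u x))"
    proof (rule integral_mono)
      show "integrable lborel (\<lambda>x. LBINT y. \<Phi> (x, y) * (?u x * ?u y))"
        using lborel_pair.integrable_fst'[OF int] by simp
      show "integrable lborel (\<lambda>x. ?D * L * (x powr (- (2 * b)) * ?u x))" using int_x by simp
      fix x
      have "(LBINT y. \<Phi> (x, y) * (?u x * ?u y)) =
          ?D * (x powr (- (2 * b)) * ?u x) * (LBINT y. indicator A (x + y) * y powr (-b) * ?u y)"
        unfolding \<Phi>_def by (simp add: mult_ac flip: integral_mult_right_zero)
      also have "\<dots> \<le> ?D * (x powr (- (2 * b)) * ?u x) * L"
      proof (cases "x \<le> 0")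
        case True then show ?thesis using admissibleD(3)[OF adm] by simp
      next
        case False then show ?thesis
          using inner[of x] c_pos admissibleD(2)[OF adm, of x] by (intro mult_left_mono mult_nonneg_nonneg) auto
      qed
      finally show "(LBINT y. \<Phi> (x, y) * (?u x * ?u y)) \<le> ?D * L * (x powr (- (2 * b)) * ?u x)"
        by (simp add: mult_ac)
    qed
    also have "\<dots> = ?D * L * (LBINT x. x powr (- (2 * b)) * ?u x)" by simp
    also have "\<dots> \<le> ?D * L * M"
    proof -
      have "(LBINT x. x powr (- (2 * b)) * ?u x) \<le> (LBINT x. \<rho> x * ?u x)"
      proof (rule integral_mono[OF int_x admissibleD(4)[OF adm]])
        show "x powr (- (2 * b)) * ?u x \<le> \<rho> x * ?u x" for x
          using wt_ge_powr[of x "2 * b"] admissibleD(2,3)[OF adm, of x] by (cases "x \<le> 0") (auto intro: mult_right_mono)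
      qed
      then show ?thesis using u_norm[of n j] D L by (intro mult_left_mono) auto
    qed
    finally show ?thesis by (simp add: mult_ac)
  qed
  have "(LBINT x. \<omega> x * u n (Suc j) x) = (LBINT x. \<omega> x * ?u x) + tau n / 2 * coag_form (trunc n) \<omega> ?u"
    by (rule u_step[OF \<omega> \<omega>B])
  also have "\<dots> \<le> L + tau n / 2 * (?D * M * L)"
  proof (intro add_mono mult_left_mono form)
    show "(LBINT x. \<omega> x * ?u x) \<le> L" unfolding \<omega>_def L_def by (rule Suc.IH[OF Suc.prems])
  qed (use tau_pos[of n] in auto)
  also have "\<dots> = L * ?q" by (simp add: algebra_simps)
  finally show ?case unfolding \<omega>_def L_def by (simp add: mult_ac)
qed

text \<open>Sizes above \<open>R\<close> carry mass at most M/R by the first moment. Below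
  \<open>R\<close> the weight \<open>x powr (-b)\<close> is at least \<open>R powr (-b)\<close>, so
  the weighted estimate controls the plain mass, and the given sets shrink to measure zero inside
  the bounded interval.\<close>

lemma v_equi_small:
  assumes t: "0 \<le> t"
  shows "equi_small lborel (\<lambda>n. v n t)"
  unfolding equi_small_def
proof (intro allI impI)
  fix A :: "nat \<Rightarrow> real set" and e :: real
  assume A0: "range A \<subseteq> sets lborel" and dec: "decseq A" and A_empty: "(\<Inter>i. A i) = {}" and e: "0 < e"
  have A[measurable]: "A i \<in> sets lborel" for i using A0 by auto
  define R where "R = max 1 (2 * M / e)"
  have R: "1 \<le> R" "M / R \<le> e / 2"
    using e M_nonneg by (auto simp: R_def field_simps max_def)
  define D where "D = c * (1 + R powr (1 + b))\<^sup>2 * M / 2"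
  have D: "0 \<le> D" unfolding D_def using c_pos M_nonneg by simp
  \<comment> \<open>\<open>E\<close> is the total loss of accuracy: \<open>R powr b\<close> for
    removing the weight, the exponential for the growth in time. Tolerances
    \<open>e / (4 * E)\<close> for the datum and for the measure term then give
    \<open>e / 2\<close>.\<close>
  define E where "E = R powr b * exp (D * t)"
  have E: "0 < E" unfolding E_def using R by simp
  have pB: "\<bar>x powr (-b)\<bar> \<le> 1 * \<rho> x" if "0 < x" for x
    using powr_le_wt_double[of b x] that b_pos by simp
  have "integrable lborel (\<lambda>x. x powr (-b) * f0 x)"
    by (rule admissible_integral[OF f0 _ pB]) auto
  then obtain N where N: "0 \<le> N" and base: "\<And>A. A \<in> sets lborel \<Longrightarrow> emeasure lborel A < \<infinity> \<Longrightarrow>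
    (LBINT x. indicator A x * (x powr (-b) * f0 x)) \<le> N * measure lborel A + e / (4 * E)"
    using integral_indicator_le_measure[of "\<lambda>x. x powr (-b) * f0 x" "e / (4 * E)"] e E by auto
  have fin: "emeasure lborel S < \<infinity>" if "S \<subseteq> {0<..<R}" for S
    by (rule emeasure_bounded_finite[OF bounded_subset[OF _ that]]) simp
  have "(\<lambda>i. LBINT x. indicator (A i) x * indicator {0<..<R} x :: real) \<longlonglongrightarrow> 0"
    by (rule tendsto_integral_decseq[OF _ A dec A_empty]) (auto intro!: integrable_real_indicator fin[OF order_refl, folded infinity_ennreal_def])
  then have "eventually (\<lambda>i. (LBINT x. indicator (A i) x * indicator {0<..<R} x :: real) < e / (4 * E * (N + 1))) sequentially"
    using e E N by (intro order_tendstoD) auto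
  then obtain i where "(LBINT x. indicator (A i) x * indicator {0<..<R} x :: real) < e / (4 * E * (N + 1))"
    by (auto simp: eventually_sequentially)
  then have mi: "measure lborel (A i \<inter> {0<..<R}) < e / (4 * E * (N + 1))"
    by (simp flip: indicator_inter_arith)
  have NE: "N * measure lborel (A i \<inter> {0<..<R}) \<le> e / (4 * E)"
  proof -
    have "N * measure lborel (A i \<inter> {0<..<R}) \<le> (N + 1) * (e / (4 * E * (N + 1)))"
      using mi N by (intro mult_mono) auto
    also have "\<dots> = e / (4 * E)"
      using N by (simp only: times_divide_eq_right nonzero_mult_divide_mult_cancel_left2)
    finally show ?thesis .
  qed
  have "int_on lborel (A i) (v n t) \<le> e" for n
  proof -
    let ?v = "v n t"
    note adm = v_admissible[of n t]
    let ?W = "\<lambda>x. R powr b * (indicator (A i \<inter> {0<..<R}) x * x powr (-b) * ?v x) + (1 / R) * (x * ?v x)"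
    have i1: "integrable lborel (\<lambda>x. indicator (A i \<inter> {0<..<R}) x * x powr (-b) * ?v x)"
      by (rule admissible_integral[OF adm, where B=1])
        (use pB in \<open>auto simp: indicator_def less_imp_le[OF wt_pos]\<close>)
    have i2: "integrable lborel (\<lambda>x. x * ?v x)"
      by (rule admissible_integral[OF adm, where B=1]) (use wt_ge_self in auto)
    have "(LBINT x. indicator (A i) x * ?v x) \<le>
      (LBINT x. ?W x)"
    proof (rule integral_mono)
      show "integrable lborel (\<lambda>x. indicator (A i) x * ?v x)"
        by (rule integrable_indicator_times[OF v_integrable A])
      show "integrable lborel (\<lambda>x. ?W x)"
        using i1 i2 by (intro Bochner_Integration.integrable_add integrable_mult_right) auto
      fix x
      show "indicator (A i) x * ?v x \<le> ?W x"
      proof (cases "x \<le> 0")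
        case True then show ?thesis using admissibleD(3)[OF adm] by simp
      next
        case False
        have "indicator (A i) x \<le> R powr b * (indicator (A i \<inter> {0<..<R}) x * x powr (-b)) + (1 / R) * x"
        proof (cases "x < R")
          case True
          have "1 = x powr b * x powr (-b)" using False by (simp flip: powr_add)
          also have "\<dots> \<le> R powr b * x powr (-b)" using False True b_pos by (intro mult_right_mono powr_mono2) auto
          finally show ?thesis using True False R by (auto simp: indicator_def add_increasing2)
        next
          case F: False
          then have "1 \<le> (1 / R) * x" using R by (simp add: field_simps)
          then show ?thesis using F by (auto simp: indicator_def)
        qed
        from mult_right_mono[OF this v_nonneg[of n t x]] show ?thesis by (simp add: algebra_simps)
      qed
    qed
    also have "\<dots> = R powr b * (LBINT x. indicator (A i \<inter> {0<..<R}) x * x powr (-b) * ?v x) + (1 / R) * (LBINT x. x * ?v x)"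
      using i1 i2 by simp
    also have "(LBINT x. x * ?v x) \<le> M"
      using admissible_integral(2)[OF adm, of "\<lambda>x. x" 1] wt_ge_self v_norm[of n t] by simp
    also have "(LBINT x. indicator (A i \<inter> {0<..<R}) x * x powr (-b) * ?v x) \<le>
        (N * measure lborel (A i \<inter> {0<..<R}) + e / (4 * E)) * (1 + D * tau n) ^ nat \<lfloor>t / tau n\<rfloor>"
      unfolding v_def D_def
      by (rule u_uniformly_integrable) (use R N e E base fin in \<open>auto simp: mult.assoc\<close>)
    also have "\<dots> \<le> (e / (4 * E) + e / (4 * E)) * exp (D * t)"
      using NE one_plus_tau_power_le[OF D t, of n] N e E D tau_pos[of n]
      by (intro mult_mono add_mono) (auto intro!: add_nonneg_nonneg)
    finally have "(LBINT x. indicator (A i) x * ?v x) \<le>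
        R powr b * ((e / (4 * E) + e / (4 * E)) * exp (D * t)) + 1 / R * M"
      using R by (simp add: mult_left_mono divide_right_mono)
    also have "R powr b * ((e / (4 * E) + e / (4 * E)) * exp (D * t)) = (e / (4 * E) + e / (4 * E)) * E"
      unfolding E_def by (simp add: mult_ac)
    also have "\<dots> = e / 2" using E by (simp add: field_simps)
    finally have "(LBINT x. indicator (A i) x * ?v x) \<le> e / 2 + M / R" by simp
    then show ?thesis using R(2) by linarith
  qed
  then show "\<exists>i. \<forall>n. int_on lborel (A i) (v n t) \<le> e" by blast
qed

end

section \<open>The limit curve\<close>

text \<open>An unbounded weight is not allowed as a test function in weak convergence, but its
  truncations are; monotone convergence then recovers the full weight with the same bound.\<close>

lemma integral_truncated_weight:
  fixes f w :: "'a \<Rightarrow> real"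
  assumes f: "\<And>x. 0 \<le> f x" and wf: "(\<lambda>x. w x * f x) \<in> borel_measurable M"
    and int: "\<And>k::nat. integrable M (\<lambda>x. min (w x) (real k) * f x)"
    and le: "\<And>k::nat. (LINT x|M. min (w x) (real k) * f x) \<le> C"
  shows "integrable M (\<lambda>x. w x * f x)" "(LINT x|M. w x * f x) \<le> C"
proof -
  have mono: "mono (\<lambda>k::nat. min (w x) (real k) * f x)" for x
    using f by (intro monoI mult_right_mono) auto
  have inc: "incseq (\<lambda>k::nat. LINT x|M. min (w x) (real k) * f x)"
    using mono by (intro incseq_SucI integral_mono int) (auto simp: mono_iff_le_Suc)
  obtain L where L: "(\<lambda>k::nat. LINT x|M. min (w x) (real k) * f x) \<longlonglongrightarrow> L"
    by (rule incseq_convergent[OF inc, of C]) (use le in auto)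
  have lim: "(\<lambda>k::nat. min (w x) (real k) * f x) \<longlonglongrightarrow> w x * f x" for x
  proof -
    obtain k0 :: nat where "w x \<le> real k0" using real_arch_simple by blast
    then have "\<forall>\<^sub>F k in sequentially. min (w x) (real k) * f x = w x * f x"
      by (auto intro!: eventually_sequentiallyI[of k0])
    then show ?thesis by (rule tendsto_eventually)
  qed
  show "integrable M (\<lambda>x. w x * f x)"
    by (rule integrable_monotone_convergence[OF int _ _ L wf]) (use mono lim in auto)
  have "(LINT x|M. w x * f x) = L"
    by (rule integral_monotone_convergence[OF int _ _ L wf]) (use mono lim in auto)
  then show "(LINT x|M. w x * f x) \<le> C"
    using LIMSEQ_le_const2[OF L] le by auto
qed

text \<open>The series of absolute values has finite integral and therefore converges almost
  everywhere, so its terms tend to 0.\<close>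

lemma AE_tendsto_of_summable_L1:
  fixes f :: "nat \<Rightarrow> 'a \<Rightarrow> real"
  assumes f: "\<And>m. integrable M (f m)" and le: "\<And>m. (LINT x|M. \<bar>f m x\<bar>) \<le> a m" and a: "summable a"
  shows "AE x in M. (\<lambda>m. f m x) \<longlonglongrightarrow> 0"
proof -
  have [measurable]: "f m \<in> borel_measurable M" for m using f by auto
  have a0: "0 \<le> a m" for m by (rule order_trans[OF _ le]) simp
  have "(\<integral>\<^sup>+x. (\<Sum>m. ennreal \<bar>f m x\<bar>) \<partial>M) = (\<Sum>m. \<integral>\<^sup>+x. ennreal \<bar>f m x\<bar> \<partial>M)"
    by (rule nn_integral_suminf) measurable
  also have "\<dots> \<le> (\<Sum>m. ennreal (a m))"
    using f le by (intro suminf_le) (auto simp: nn_integral_eq_integral ennreal_leI)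
  also have "\<dots> = ennreal (\<Sum>m. a m)"
    by (rule suminf_ennreal2[OF a0 a])
  also have "\<dots> < \<infinity>" by simp
  finally have "AE x in M. (\<Sum>m. ennreal \<bar>f m x\<bar>) \<noteq> \<infinity>"
    by (intro nn_integral_noteq_infinite) (auto simp: less_top)
  then show ?thesis
  proof (rule AE_mp, intro AE_I2 impI)
    fix x assume "(\<Sum>m. ennreal \<bar>f m x\<bar>) \<noteq> \<infinity>"
    then have "summable (\<lambda>m. \<bar>f m x\<bar>)" by (intro summable_suminf_not_top) auto
    then have "(\<lambda>m. \<bar>f m x\<bar>) \<longlonglongrightarrow> 0" by (rule summable_LIMSEQ_zero)
    then show "(\<lambda>m. f m x) \<longlonglongrightarrow> 0" by (simp add: tendsto_rabs_zero_iff)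
  qed
qed

text \<open>The curve is sampled at dyadic times; the L1 errors are summable, so the samples converge almost
  everywhere.\<close>
lemma L1_lipschitz_jointly_measurable:
  fixes g :: "real \<Rightarrow> real \<Rightarrow> real"
  assumes g: "\<And>t. 0 \<le> t \<Longrightarrow> integrable lborel (g t)"
    and lip: "\<And>s t. 0 \<le> s \<Longrightarrow> 0 \<le> t \<Longrightarrow> (LBINT x. \<bar>g t x - g s x\<bar>) \<le> L * \<bar>t - s\<bar>"
  obtains G where "measurable2 G"
    "\<And>t. 0 \<le> t \<Longrightarrow> AE x in lborel. G x t = g t x"
proof -
  define a where "a = (\<lambda>(m::nat) (i::int). real_of_int i / 2 ^ m)"
  define j where "j = (\<lambda>(m::nat) (t::real). \<lfloor>2 ^ m * max 0 t\<rfloor>)"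
  \<comment> \<open>\<open>max 0\<close> sends negative times and indices to time 0, so that
    \<open>g\<close> is sampled only where it is known to be integrable.\<close>
  define G where "G = (\<lambda>x t. lim (\<lambda>m. g (a m (max 0 (j m t))) x))"
  have j0: "0 \<le> j m t" for m t unfolding j_def by simp
  have gm[measurable]: "g (a m (max 0 i)) \<in> borel_measurable borel" for m i
    using g[of "a m (max 0 i)"] by (auto simp: a_def)
  \<comment> \<open>The sample depends on the time only through an integer, so joint measurability
    reduces to that of countably many sections.\<close>
  have meas: "(\<lambda>p. g (a m (max 0 (j m (snd p)))) (fst p)) \<in> borel_measurable lborel2" for m
  proof (rule measurable_compose_countable[where g="\<lambda>p. j m (snd p)" and f="\<lambda>i p. g (a m (max 0 i)) (fst p)"])
    show "(\<lambda>p. j m (snd p)) \<in> measurable lborel2 (count_space UNIV)"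
      unfolding j_def by measurable
  qed measurable
  show ?thesis
  proof
    show "measurable2 G"
      unfolding G_def by (intro borel_measurable_lim_metric meas)
    fix t :: real assume t: "0 \<le> t"
    define s where "s = (\<lambda>m. a m (max 0 (j m t)))"
    have s0: "0 \<le> s m" for m unfolding s_def a_def by simp
    have st: "\<bar>s m - t\<bar> \<le> (1/2) ^ m" for m
    proof -
      have "\<bar>real_of_int (j m t) - 2 ^ m * t\<bar> \<le> 1" unfolding j_def using t by simp linarith
      then have "\<bar>(real_of_int (j m t) - 2 ^ m * t) / 2 ^ m\<bar> \<le> 1 / 2 ^ m"
        unfolding abs_divide by (simp add: divide_right_mono)
      then show ?thesis unfolding s_def a_def using j0[of m t] by (simp add: diff_divide_distrib power_one_over)
    qed
    have L0: "0 \<le> L" using order_trans[OF _ lip[of 0 1]] by simp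
    have "AE x in lborel. (\<lambda>m. g (s m) x - g t x) \<longlonglongrightarrow> 0"
    proof (rule AE_tendsto_of_summable_L1)
      show "(LBINT x. \<bar>g (s m) x - g t x\<bar>) \<le> L * (1/2) ^ m" for m
        using lip[OF t s0[of m]] mult_left_mono[OF st[of m] L0] by simp
      show "summable (\<lambda>m. L * (1/2) ^ m)" by (intro summable_mult summable_geometric) simp
    qed (use g t s0 in auto)
    then show "AE x in lborel. G x t = g t x"
    proof (rule AE_mp, intro AE_I2 impI)
      fix x assume "(\<lambda>m. g (s m) x - g t x) \<longlonglongrightarrow> 0"
      then have "(\<lambda>m. g (s m) x) \<longlonglongrightarrow> g t x" by (simp add: LIM_zero_iff)
      then show "G x t = g t x" unfolding G_def s_def by (rule limI)
    qed
  qed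
qed

text \<open>This interface separates compactness from the limit equation: one filter
  \<open>F\<close> serves all times, and \<open>G\<close> is a version of the limit that is jointly
  measurable and has its sign and support at every point. The arguments about the limit use nothing
  else of its construction.\<close>

locale coagulation_limit = coagulation_problem +
  fixes F :: "nat filter" and G :: "real \<Rightarrow> real \<Rightarrow> real"
  assumes F: "F \<noteq> bot" "F \<le> sequentially"
    and G_measurable: "measurable2 G"
    and G_nonneg: "\<And>x t. 0 \<le> G x t" and G_zero: "\<And>x t. x \<le> 0 \<Longrightarrow> G x t = 0"
    and G_integrable: "\<And>t. 0 \<le> t \<Longrightarrow> integrable lborel (\<lambda>x. G x t)"
    and G_tendsto: "\<And>t \<phi> B. 0 \<le> t \<Longrightarrow> \<phi> \<in> borel_measurable borel \<Longrightarrow> (\<And>x. \<bar>\<phi> x\<bar> \<le> B) \<Longrightarrow>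
      ((\<lambda>n. LBINT x. \<phi> x * v n t x) \<longlongrightarrow> (LBINT x. \<phi> x * G x t)) F"

section \<open>Compactness and a jointly measurable version of the limit\<close>

context coagulation_problem
begin

lemma tau_tendsto_0: "tau \<longlonglongrightarrow> 0"
proof -
  have "(\<lambda>n. inverse (real (Suc n)) * inverse (M + 1)) \<longlonglongrightarrow> 0 * inverse (M + 1)"
    by (intro tendsto_mult LIMSEQ_inverse_real_of_nat tendsto_const)
  then show ?thesis unfolding tau_def by (simp add: divide_inverse add.commute)
qed

text \<open>Formulated for arbitrary weak limits, since it is used twice: for the limits chosen
  separately at each time, in order to find a jointly measurable version, and again for that
  version. The rounding term \<open>tau n\<close> vanishes along \<open>F\<close>.\<close>

lemma limit_L1_lipschitz:
  assumes F: "F \<noteq> bot" "F \<le> sequentially" and st: "0 \<le> s" "0 \<le> t"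
    and f: "integrable lborel f" and g: "integrable lborel g"
    and lim: "\<And>\<omega> :: real \<Rightarrow> real. \<omega> \<in> borel_measurable borel \<Longrightarrow> (\<And>x. \<bar>\<omega> x\<bar> \<le> 1) \<Longrightarrow>
        ((\<lambda>n. LBINT x. \<omega> x * v n t x) \<longlongrightarrow> (LBINT x. \<omega> x * f x)) F"
      "\<And>\<omega> :: real \<Rightarrow> real. \<omega> \<in> borel_measurable borel \<Longrightarrow> (\<And>x. \<bar>\<omega> x\<bar> \<le> 1) \<Longrightarrow>
        ((\<lambda>n. LBINT x. \<omega> x * v n s x) \<longlongrightarrow> (LBINT x. \<omega> x * g x)) F"
  shows "(LBINT x. \<bar>f x - g x\<bar>) \<le> lip * \<bar>t - s\<bar>"
proof (rule integral_abs_diff_le[OF f g])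
  fix \<omega> :: "real \<Rightarrow> real" assume "\<omega> \<in> borel_measurable lborel" and \<omega>1: "\<And>x. \<bar>\<omega> x\<bar> \<le> 1"
  then have \<omega>: "\<omega> \<in> borel_measurable borel" by simp
  have "(LBINT x. \<omega> x * f x) - (LBINT x. \<omega> x * g x) \<le> 1 * lip * (\<bar>t - s\<bar> + 0)"
  proof (rule tendsto_le[OF F(1)])
    show "((\<lambda>n. 1 * lip * (\<bar>t - s\<bar> + tau n)) \<longlongrightarrow> 1 * lip * (\<bar>t - s\<bar> + 0)) F"
      by (intro tendsto_intros tendsto_mono[OF F(2) tau_tendsto_0])
    show "((\<lambda>n. (LBINT x. \<omega> x * v n t x) - (LBINT x. \<omega> x * v n s x)) \<longlongrightarrow>
        (LBINT x. \<omega> x * f x) - (LBINT x. \<omega> x * g x)) F"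
      by (intro tendsto_diff lim \<omega> \<omega>1)
    show "\<forall>\<^sub>F n in F. (LBINT x. \<omega> x * v n t x) - (LBINT x. \<omega> x * v n s x) \<le> 1 * lip * (\<bar>t - s\<bar> + tau n)"
      using order_trans[OF abs_ge_self v_lipschitz[OF \<omega> \<omega>1 st]] by simp
  qed
  then show "(LBINT x. \<omega> x * f x) - (LBINT x. \<omega> x * g x) \<le> lip * \<bar>t - s\<bar>" by simp
qed

text \<open>Compactness is applied to all pairs of a time and a measurable set at once, which yields
  one filter for every time. The densities are then chosen independently for each time, so
  measurability in both variables is not automatic; it is restored by their Lipschitz continuity in
  L1.\<close>

lemma coagulation_limit_exists: "\<exists>F G. coagulation_limit K b c f0 F G"
proof -
  define q where "q = (\<lambda>n (t :: real, A). if 0 \<le> t \<and> A \<in> sets lborel then LBINT x. indicator A x * v n t x else 0)"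
  have "\<bar>q n p\<bar> \<le> M" for n p
  proof (cases p)
    case (Pair t A)
    have "\<bar>LBINT x. indicator A x * v n t x\<bar> \<le> M" if "A \<in> sets lborel"
      using abs_integral_bounded_times[OF v_integrable v_nonneg, of "indicator A" 1 n t] that v_le[of n t]
      by (auto simp: indicator_def)
    then show ?thesis unfolding Pair q_def using M_nonneg by auto
  qed
  then obtain F where F: "F \<noteq> bot" "F \<le> sequentially" and conv: "\<And>p. \<exists>l. ((\<lambda>n. q n p) \<longlongrightarrow> l) F"
    using bounded_family_subfilter[of q M sequentially] by (metis sequentially_bot)
  have "\<forall>t. \<exists>g. 0 \<le> t \<longrightarrow> integrable lborel g \<and> (\<forall>x. 0 \<le> g x) \<and> (\<forall>A\<in>sets lborel.
      ((\<lambda>n. int_on lborel A (v n t)) \<longlongrightarrow> int_on lborel A g) F)"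
  proof
    fix t :: real
    show "\<exists>g. 0 \<le> t \<longrightarrow> integrable lborel g \<and> (\<forall>x. 0 \<le> g x) \<and> (\<forall>A\<in>sets lborel.
      ((\<lambda>n. int_on lborel A (v n t)) \<longlongrightarrow> int_on lborel A g) F)"
    proof (cases "0 \<le> t")
      case True
      show ?thesis
      proof (rule equi_small_limit_density[OF sigma_finite_lborel v_integrable v_nonneg v_equi_small[OF True] F(1)])
        show "\<exists>l. ((\<lambda>n. int_on lborel A (v n t)) \<longlongrightarrow> l) F" if "A \<in> sets lborel" for A
          using conv[of "(t, A)"] True that by (simp add: q_def)
      qed blast
    qed simp
  qed
  from choice[OF this] obtain g where g0: "\<forall>t. 0 \<le> t \<longrightarrow> integrable lborel (g t) \<and> (\<forall>x. 0 \<le> g t x) \<and> (\<forall>A\<in>sets lborel.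
      ((\<lambda>n. int_on lborel A (v n t)) \<longlongrightarrow> int_on lborel A (g t)) F)" ..
  then have g: "\<And>t. 0 \<le> t \<Longrightarrow> integrable lborel (g t)" "\<And>t x. 0 \<le> t \<Longrightarrow> 0 \<le> g t x"
    and glim: "\<And>t A. 0 \<le> t \<Longrightarrow> A \<in> sets lborel \<Longrightarrow>
      ((\<lambda>n. int_on lborel A (v n t)) \<longlongrightarrow> int_on lborel A (g t)) F"
    by blast+
  have g_le: "(LBINT x. g t x) \<le> M" if "0 \<le> t" for t
    using tendsto_upperbound[OF glim[OF that, of UNIV] _ F(1), of M] v_le by simp
  have g_tendsto: "((\<lambda>n. LBINT x. \<phi> x * v n t x) \<longlongrightarrow> (LBINT x. \<phi> x * g t x)) F"
    if "0 \<le> t" "\<phi> \<in> borel_measurable borel" "\<And>x. \<bar>\<phi> x\<bar> \<le> B" for t \<phi> B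
    by (rule tendsto_integral_bounded_times[OF v_integrable v_nonneg v_le g(1) g(2) g_le glim])
      (use that in auto)
  have lip: "(LBINT x. \<bar>g t x - g s x\<bar>) \<le> lip * \<bar>t - s\<bar>" if st: "0 \<le> s" "0 \<le> t" for s t
    by (rule limit_L1_lipschitz[OF F st g(1)[OF st(2)] g(1)[OF st(1)] g_tendsto[OF st(2)] g_tendsto[OF st(1)]])
  obtain G where Gm[measurable]: "measurable2 G"
    and GAE: "\<And>t. 0 \<le> t \<Longrightarrow> AE x in lborel. G x t = g t x"
    using L1_lipschitz_jointly_measurable[OF g(1) lip] by blast
  \<comment> \<open>This makes sign and support hold at every point. For positive sizes the sections
    still agree almost everywhere with \<open>g t\<close>, and the approximations have no mass
    elsewhere, so the convergence survives.\<close>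
  define H where "H = (\<lambda>x t. if 0 < x then max 0 (G x t) else 0)"
  have Hm: "measurable2 H"
    unfolding H_def by measurable
  have Ht[measurable]: "(\<lambda>x. H x t) \<in> borel_measurable borel" for t
  proof -
    have "(\<lambda>x. (x, t)) \<in> measurable lborel lborel2" by measurable
    from measurable_compose[OF this Hm] show ?thesis by simp
  qed
  have HAE: "AE x in lborel. H x t = indicator {0<..} x * g t x" if "0 \<le> t" for t
    using GAE[OF that] by eventually_elim (use g(2)[OF that] in \<open>auto simp: H_def\<close>)
  have "coagulation_limit K b c f0 F H"
  proof
    show "integrable lborel (\<lambda>x. H x t)" if "0 \<le> t" for t
      using integrable_indicator_times[OF g(1)[OF that], of "{0<..}"] HAE[OF that]
      by (subst integrable_cong_AE[of _ _ "\<lambda>x. indicator {0<..} x * g t x"]) auto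
    fix t :: real and \<phi> :: "real \<Rightarrow> real" and B :: real assume t: "0 \<le> t" and \<phi>[measurable]: "\<phi> \<in> borel_measurable borel" and B: "\<And>x. \<bar>\<phi> x\<bar> \<le> B"
    have [measurable]: "g t \<in> borel_measurable borel" using g(1)[OF t] by auto
    have eq1: "(LBINT x. \<phi> x * indicator {0<..} x * v n t x) = (LBINT x. \<phi> x * v n t x)" for n
      using admissibleD(3)[OF v_admissible] by (intro Bochner_Integration.integral_cong) (auto simp: indicator_def)
    have eq2: "(LBINT x. \<phi> x * indicator {0<..} x * g t x) = (LBINT x. \<phi> x * H x t)"
      using HAE[OF t] by (intro integral_cong_AE) (auto elim!: eventually_mono)
    have "((\<lambda>n. LBINT x. \<phi> x * indicator {0<..} x * v n t x) \<longlongrightarrow> (LBINT x. \<phi> x * indicator {0<..} x * g t x)) F"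
      by (rule g_tendsto[OF t, of _ "\<bar>B\<bar>"]) (use order_trans[OF B abs_ge_self] in \<open>auto simp: indicator_def\<close>)
    then show "((\<lambda>n. LBINT x. \<phi> x * v n t x) \<longlongrightarrow> (LBINT x. \<phi> x * H x t)) F"
      unfolding eq1 eq2 .
  qed (use F Hm in \<open>auto simp: H_def\<close>)
  then show ?thesis by blast
qed

end

section \<open>Moments and time continuity of the limit\<close>

context coagulation_limit
begin

lemma G_section_measurable: "(\<lambda>x. G x t) \<in> borel_measurable borel"
proof -
  have "(\<lambda>x. (x, t)) \<in> measurable lborel lborel2" by measurable
  from measurable_compose[OF this G_measurable] show ?thesis by simp
qed

text \<open>Convergence against the truncations of \<open>w\<close> gives lower semicontinuity of
  the weighted integral, hence an upper bound only; equality for the first moment requires control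
  of the tails.\<close>

lemma G_weighted:
  assumes t: "0 \<le> t" and w: "w \<in> borel_measurable borel" "\<And>x. 0 < x \<Longrightarrow> 0 \<le> w x"
    and B: "\<And>x. 0 < x \<Longrightarrow> w x \<le> B * \<rho> x"
    and C: "\<And>n. (LBINT x. w x * v n t x) \<le> C"
  shows "integrable lborel (\<lambda>x. w x * G x t)" "(LBINT x. w x * G x t) \<le> C"
proof -
  note [measurable] = w(1) G_section_measurable
  \<comment> \<open>The sign of \<open>w\<close> is known for positive sizes only; cutting it there
    makes its truncations bounded from below as well.\<close>
  define w' where "w' = (\<lambda>x. indicator {0<..} x * w x)"
  have w'0: "0 \<le> w' x" for x unfolding w'_def using w(2) by (auto simp: indicator_def)
  have [measurable]: "w' \<in> borel_measurable borel" unfolding w'_def by measurable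
  have eqG: "w' x * G x t = w x * G x t" for x using G_zero[of x t] by (auto simp: w'_def indicator_def)
  have eqv: "w' x * v n t x = w x * v n t x" for x n
    using admissibleD(3)[OF v_admissible, of x n t] by (auto simp: w'_def indicator_def)
  have m: "\<bar>min (w' x) (real k)\<bar> \<le> real k" for x k using w'0[of x] by auto
  have 1: "integrable lborel (\<lambda>x. min (w' x) (real k) * G x t)" for k
    by (rule integrable_bounded_times[OF G_integrable[OF t], where B="real k"]) (use m in auto)
  have 2: "(LBINT x. min (w' x) (real k) * G x t) \<le> C" for k
  proof (rule tendsto_upperbound[OF G_tendsto[OF t _ m] _ F(1)])
    have "(LBINT x. min (w' x) (real k) * v n t x) \<le> C" for n
    proof -
      have "(LBINT x. min (w' x) (real k) * v n t x) \<le> (LBINT x. w x * v n t x)"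
      proof (rule integral_mono)
        show "integrable lborel (\<lambda>x. min (w' x) (real k) * v n t x)"
          by (rule integrable_bounded_times[OF v_integrable, where B="real k"]) (use m in auto)
        show "integrable lborel (\<lambda>x. w x * v n t x)"
          by (rule admissible_integral[OF v_admissible w(1), where B=B]) (use w(2) B in auto)
        show "min (w' x) (real k) * v n t x \<le> w x * v n t x" for x
          using mult_right_mono[OF min.cobounded1[of "w' x" "real k"] v_nonneg[of n t x]] eqv by simp
      qed
      then show ?thesis using C[of n] by simp
    qed
    then show "\<forall>\<^sub>F n in F. (LBINT x. min (w' x) (real k) * v n t x) \<le> C" by simp
  qed measurable
  have 3: "(\<lambda>x. w' x * G x t) \<in> borel_measurable lborel" by measurable
  from integral_truncated_weight[OF G_nonneg 3 1 2]
  show "integrable lborel (\<lambda>x. w x * G x t)" "(LBINT x. w x * G x t) \<le> C"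
    unfolding eqG by auto
qed

lemma G_admissible: "0 \<le> t \<Longrightarrow> admissible (2 * b) (\<lambda>x. G x t)"
  and G_norm: "0 \<le> t \<Longrightarrow> (LBINT x. \<rho> x * G x t) \<le> M"
  using G_weighted[OF _ wt_measurable _ _ v_norm, of t 1] G_section_measurable G_nonneg G_zero
  by (auto simp: admissible_def less_imp_le[OF wt_pos])

lemma G_tail:
  assumes e: "0 < e"
  obtains R where "1 \<le> R"
    "\<And>n t. 0 \<le> t \<Longrightarrow> t \<le> T \<Longrightarrow> tail_mass R (v n t) \<le> e"
    "\<And>t. 0 \<le> t \<Longrightarrow> t \<le> T \<Longrightarrow> tail_mass R (\<lambda>x. G x t) \<le> e"
proof -
  obtain R where R: "1 \<le> R" "\<And>n t. 0 \<le> t \<Longrightarrow> t \<le> T \<Longrightarrow> tail_mass R (v n t) \<le> e"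
    using v_tail[OF e] by blast
  have "tail_mass R (\<lambda>x. G x t) \<le> e" if t: "0 \<le> t" "t \<le> T" for t
    by (rule G_weighted[OF t(1), where B=1])
      (use R(2)[OF t] wt_ge_self wt_pos in \<open>auto simp: indicator_def less_imp_le\<close>)
  then show ?thesis using R that by blast
qed

text \<open>The identity is unbounded, so it is cut at a size \<open>R\<close> with tails at most
  \<open>e\<close>. For the approximations the cut moment lies between the initial mass minus
  \<open>e\<close> and the initial mass; these bounds pass to the limit, whose own tail is at most
  \<open>e\<close> as well.\<close>

lemma G_mass:
  assumes t: "0 \<le> t"
  shows "(LBINT x. x * G x t) = (LBINT x. x * f0 x)"
proof -
  have "\<bar>(LBINT x. x * G x t) - (LBINT x. x * f0 x)\<bar> \<le> e" if e: "0 < e" for e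
  proof -
    obtain R where R: "1 \<le> R" "\<And>n t'. 0 \<le> t' \<Longrightarrow> t' \<le> t \<Longrightarrow> tail_mass R (v n t') \<le> e"
      "\<And>t'. 0 \<le> t' \<Longrightarrow> t' \<le> t \<Longrightarrow> tail_mass R (\<lambda>x. G x t') \<le> e"
      by (rule G_tail[OF e, of t]) blast
    define \<phi> where "\<phi> = (\<lambda>x. indicator {0<..R} x * x :: real)"
    have \<phi>: "\<phi> \<in> borel_measurable borel" "\<And>x. \<bar>\<phi> x\<bar> \<le> R"
      unfolding \<phi>_def by measurable[1] (use R(1) in \<open>auto simp: indicator_def\<close>)
    have split: "(LBINT x. x * f x) = (LBINT x. \<phi> x * f x) + tail_mass R f"
      and nn: "0 \<le> tail_mass R f"
      if f: "admissible (2 * b) f" for f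
    proof -
      have i1: "integrable lborel (\<lambda>x. indicator {R<..} x * x * f x)"
        by (rule admissible_integral[OF f _ indicator_self_le_wt]) measurable
      have i2: "integrable lborel (\<lambda>x. \<phi> x * f x)"
        unfolding \<phi>_def by (rule admissible_integral[OF f _ indicator_self_le_wt]) measurable
      have "(LBINT x. x * f x) = (LBINT x. \<phi> x * f x + indicator {R<..} x * x * f x)"
        using admissibleD(3)[OF f] R(1) by (intro Bochner_Integration.integral_cong) (auto simp: \<phi>_def indicator_def)
      then show "(LBINT x. x * f x) = (LBINT x. \<phi> x * f x) + tail_mass R f"
        using i1 i2 by simp
      show "0 \<le> tail_mass R f"
        using admissibleD(2)[OF f] R(1) by (intro Bochner_Integration.integral_nonneg) (auto simp: indicator_def)
    qed
    have lim: "((\<lambda>n. LBINT x. \<phi> x * v n t x) \<longlongrightarrow> (LBINT x. \<phi> x * G x t)) F"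
      by (rule G_tendsto[OF t \<phi>])
    have v: "(LBINT x. \<phi> x * v n t x) \<le> (LBINT x. x * f0 x)"
      "(LBINT x. x * f0 x) - e \<le> (LBINT x. \<phi> x * v n t x)" for n
      using split[OF v_admissible, of n t] nn[OF v_admissible, of n t] R(2)[OF t order_refl, of n] v_mass[of n t] by auto
    have "(LBINT x. \<phi> x * G x t) \<le> (LBINT x. x * f0 x)"
      by (rule tendsto_upperbound[OF lim _ F(1)]) (use v in auto)
    moreover have "(LBINT x. x * f0 x) - e \<le> (LBINT x. \<phi> x * G x t)"
      by (rule tendsto_lowerbound[OF lim _ F(1)]) (use v in auto)
    ultimately show ?thesis
      using split[OF G_admissible[OF t]] nn[OF G_admissible[OF t]] R(3)[OF t order_refl] by auto
  qed
  then have "\<bar>(LBINT x. x * G x t) - (LBINT x. x * f0 x)\<bar> \<le> 0"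
    by (rule field_le_epsilon[of _ 0, simplified])
  then show ?thesis by simp
qed

lemma G_lipschitz:
  assumes st: "0 \<le> s" "0 \<le> t"
  shows "(LBINT x. \<bar>G x t - G x s\<bar>) \<le> lip * \<bar>t - s\<bar>"
  by (rule limit_L1_lipschitz[OF F st G_integrable[OF st(2)] G_integrable[OF st(1)] G_tendsto[OF st(2)] G_tendsto[OF st(1)]])

end

section \<open>The limit equation\<close>

text \<open>On each complete step the integrand is constant, so the integral and the Euler sum
  differ only by the last, incomplete step.\<close>

lemma integral_step_function:
  fixes q :: "nat \<Rightarrow> real"
  assumes tau: "0 < \<tau>" and t: "0 \<le> t" and q: "\<And>i. \<bar>q i\<bar> \<le> C"
  shows "set_integrable lborel {0<..<t} (\<lambda>s. q (nat \<lfloor>s / \<tau>\<rfloor>))"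
    and "\<bar>(LBINT s:{0<..<t}. q (nat \<lfloor>s / \<tau>\<rfloor>)) - \<tau> * (\<Sum>i<nat \<lfloor>t / \<tau>\<rfloor>. q i)\<bar> \<le> C * \<tau>"
proof -
  define j where "j = nat \<lfloor>t / \<tau>\<rfloor>"
  \<comment> \<open>The cell with index 0 loses its left end point and the cell with index
    \<open>j\<close> is cut at \<open>t\<close>; the cells in between are complete.\<close>
  define I where "I = (\<lambda>i::nat. {i * \<tau>..<(i + 1) * \<tau>} \<inter> {0<..<t})"
  have I[measurable]: "I i \<in> sets lborel" for i unfolding I_def by measurable
  have fin: "emeasure lborel (I i) < \<infinity>" for i
    by (rule emeasure_bounded_finite) (auto simp: I_def intro: bounded_subset)
  have C: "0 \<le> C" using order_trans[OF abs_ge_zero q] .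
  have jt: "j * \<tau> \<le> t" "t < (j + 1) * \<tau>"
  proof -
    have "0 \<le> t / \<tau>" using tau t by simp
    then have "real j \<le> t / \<tau>" "t / \<tau> < real j + 1" unfolding j_def by simp_all
    then show "j * \<tau> \<le> t" "t < (j + 1) * \<tau>" using tau by (simp_all add: field_simps)
  qed
  have eq: "indicator {0<..<t} s *\<^sub>R q (nat \<lfloor>s / \<tau>\<rfloor>) = (\<Sum>i\<le>j. q i * indicator (I i) s)" for s
  proof (cases "s \<in> {0<..<t}")
    case True
    let ?i = "nat \<lfloor>s / \<tau>\<rfloor>"
    have s0: "0 \<le> s / \<tau>" using True tau by simp
    have iff: "s \<in> I i \<longleftrightarrow> i = ?i" for i
    proof -
      have "s \<in> I i \<longleftrightarrow> real i \<le> s / \<tau> \<and> s / \<tau> < real i + 1"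
        using True tau unfolding I_def by (auto simp: field_simps)
      also have "\<dots> \<longleftrightarrow> \<lfloor>s / \<tau>\<rfloor> = int i" by (simp add: floor_eq_iff)
      also have "\<dots> \<longleftrightarrow> i = ?i" using s0 by auto
      finally show ?thesis .
    qed
    have "s / \<tau> \<le> t / \<tau>" using True tau by (simp add: divide_right_mono)
    then have "?i \<le> j" unfolding j_def by (intro nat_mono floor_mono)
    then have "(\<Sum>i\<le>j. q i * indicator (I i) s) = q ?i"
      using sum.delta[of "{..j}" ?i q] iff by (simp add: indicator_def if_distrib cong: if_cong)
    then show ?thesis using True by simp
  next
    case False then show ?thesis unfolding I_def by (auto intro!: sum.neutral)
  qed
  have int: "integrable lborel (\<lambda>s. q i * indicator (I i) s)" for i
    by (intro integrable_mult_right integrable_real_indicator I fin)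
  show "set_integrable lborel {0<..<t} (\<lambda>s. q (nat \<lfloor>s / \<tau>\<rfloor>))"
    unfolding set_integrable_def eq by (intro Bochner_Integration.integrable_sum int)
  have m: "measure lborel (I i) = \<tau>" if "i < j" for i
  proof -
    have "(real i + 1) * \<tau> \<le> j * \<tau>" using that tau by (intro mult_right_mono) auto
    then have le: "(real i + 1) * \<tau> \<le> t" using jt by simp
    show ?thesis
    proof (cases "i = 0")
      case True
      then have "I i = {0<..<\<tau>}" using le unfolding I_def by auto
      then show ?thesis using tau by simp
    next
      case False
      then have "0 < i * \<tau>" using tau by simp
      from less_le_trans[OF this] have "I i = {i * \<tau>..<(real i + 1) * \<tau>}"
        using less_le_trans[OF _ le] unfolding I_def by auto
      then show ?thesis using tau by (simp add: algebra_simps)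
    qed
  qed
  have mj: "0 \<le> measure lborel (I j)" "measure lborel (I j) \<le> \<tau>"
  proof -
    have "emeasure lborel (I j) \<le> emeasure lborel {j * \<tau>..(j + 1) * \<tau>}"
      by (intro emeasure_mono) (auto simp: I_def algebra_simps)
    also have "\<dots> = ennreal \<tau>" using tau by (simp add: algebra_simps)
    finally show "measure lborel (I j) \<le> \<tau>"
      unfolding measure_def using tau by (intro enn2real_leI) auto
  qed simp
  have "(LBINT s:{0<..<t}. q (nat \<lfloor>s / \<tau>\<rfloor>)) = (\<Sum>i\<le>j. q i * measure lborel (I i))"
    unfolding set_lebesgue_integral_def eq using int by (subst Bochner_Integration.integral_sum) auto
  also have "\<dots> = \<tau> * (\<Sum>i<j. q i) + q j * measure lborel (I j)"
    using m by (simp add: sum_distrib_left mult.commute flip: lessThan_Suc_atMost)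
  finally have "(LBINT s:{0<..<t}. q (nat \<lfloor>s / \<tau>\<rfloor>)) - \<tau> * (\<Sum>i<j. q i) = q j * measure lborel (I j)" by simp
  moreover have "\<bar>q j * measure lborel (I j)\<bar> \<le> C * \<tau>"
    unfolding abs_mult using q[of j] mj C by (intro mult_mono) auto
  ultimately show "\<bar>(LBINT s:{0<..<t}. q (nat \<lfloor>s / \<tau>\<rfloor>)) - \<tau> * (\<Sum>i<nat \<lfloor>t / \<tau>\<rfloor>. q i)\<bar> \<le> C * \<tau>"
    unfolding j_def by simp
qed

lemma measurable_triple:
  fixes f :: "real \<Rightarrow> real \<Rightarrow> real"
  assumes "measurable2 f"
  shows "(\<lambda>q. f (fst (snd q)) (snd (snd q))) \<in> borel_measurable lborel3"
    and "(\<lambda>q. f (fst (snd q)) (fst q)) \<in> borel_measurable lborel3"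
    and "(\<lambda>q. f (snd (snd q)) (fst q)) \<in> borel_measurable lborel3"
  using measurable_compose[OF _ assms, of "\<lambda>q. (fst (snd q), fst q)" lborel3]
    measurable_compose[OF _ assms, of "\<lambda>q. (snd (snd q), fst q)" lborel3]
    measurable_compose[OF measurable_snd assms, of lborel]
  by simp_all

lemma pair_sigma_finite_lborel_pair: "pair_sigma_finite lborel lborel2"
  unfolding pair_sigma_finite_def using lborel_pair.sigma_finite_measure_axioms sigma_finite_lborel by auto

text \<open>Confines both sizes to a compact interval of positive numbers, on which
  \<open>wt b\<close>, and with it the kernel of the problem, is bounded.\<close>

definition cut_kernel :: "real \<Rightarrow> (real \<Rightarrow> real \<Rightarrow> real) \<Rightarrow> real \<Rightarrow> real \<Rightarrow> real" where
  "cut_kernel r \<kappa> x y = indicator {1/r..r} x * indicator {1/r..r} y * \<kappa> x y"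

text \<open>The difference of the tensor squares splits into (f - g) times f plus g times (f - g).
  These two terms and the bound \<open>3 * B\<close> for \<open>tilde \<omega>\<close> make the
  factor 6.\<close>

lemma coag_form_bounded_kernel_diff:
  assumes f: "integrable lborel f" "\<And>x. 0 \<le> f x" "(LBINT x. f x) \<le> C"
    and g: "integrable lborel g" "\<And>x. 0 \<le> g x" "(LBINT x. g x) \<le> C"
    and \<omega>[measurable]: "\<omega> \<in> borel_measurable borel" and B: "\<And>x. \<bar>\<omega> x\<bar> \<le> B"
    and \<kappa>[measurable]: "measurable2 \<kappa>"
    and N: "\<And>x y. 0 \<le> \<kappa> x y" "\<And>x y. \<kappa> x y \<le> N"
  shows "\<bar>coag_form \<kappa> \<omega> f - coag_form \<kappa> \<omega> g\<bar> \<le> 6 * B * N * C * (LBINT x. \<bar>f x - g x\<bar>)"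
proof -
  define \<Theta> where "\<Theta> = (\<lambda>p. tilde \<omega> p * \<kappa> (fst p) (snd p))"
  have \<Theta>[measurable]: "\<Theta> \<in> borel_measurable lborel2" unfolding \<Theta>_def by measurable
  have B0: "0 \<le> B" using order_trans[OF abs_ge_zero B] .
  have \<Theta>B: "\<bar>\<Theta> p\<bar> \<le> 3 * B * N" for p
    unfolding \<Theta>_def abs_mult
  by (intro mult_mono abs_tilde_le B) (use N B0 in auto)
  have N0: "0 \<le> 3 * B * N" using order_trans[OF abs_ge_zero \<Theta>B] .
  have d: "integrable lborel (\<lambda>x. \<bar>f x - g x\<bar>)" using f g by auto
  let ?E = "\<lambda>p. \<Theta> p * (f (fst p) * f (snd p)) - \<Theta> p * (g (fst p) * g (snd p))"
  let ?D = "\<lambda>p. \<bar>f (fst p) - g (fst p)\<bar> * f (snd p) + g (fst p) * \<bar>f (snd p) - g (snd p)\<bar>"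
  have i: "integrable lborel2 ?D"
    by (intro Bochner_Integration.integrable_add integrable_pair_times f g d)
  have form: "coag_form \<kappa> \<omega> h = (LINT p|lborel2. \<Theta> p * (h (fst p) * h (snd p)))"
    "integrable lborel2 (\<lambda>p. \<Theta> p * (h (fst p) * h (snd p)))" if "integrable lborel h" for h
  proof -
    show "coag_form \<kappa> \<omega> h = (LINT p|lborel2. \<Theta> p * (h (fst p) * h (snd p)))"
      unfolding coag_form_def \<Theta>_def ..
    show "integrable lborel2 (\<lambda>p. \<Theta> p * (h (fst p) * h (snd p)))"
      by (rule integrable_bounded_times[OF integrable_pair_times(1)[OF that that] \<Theta> \<Theta>B])
  qed
  have "\<bar>coag_form \<kappa> \<omega> f - coag_form \<kappa> \<omega> g\<bar> =
      \<bar>LINT p|lborel2. ?E p\<bar>"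
    using form[OF f(1)] form[OF g(1)] by simp
  also have "\<dots> \<le> (LINT p|lborel2. \<bar>?E p\<bar>)"
    by (rule integral_abs_bound)
  also have "\<dots> \<le> (LINT p|lborel2. 3 * B * N * ?D p)"
  proof (rule integral_mono)
    show "integrable lborel2 (\<lambda>p. \<bar>?E p\<bar>)"
      using form(2)[OF f(1)] form(2)[OF g(1)] by auto
    show "integrable lborel2 (\<lambda>p. 3 * B * N * ?D p)" using i by simp
    fix p :: "real \<times> real"
    have "?E p =
        \<Theta> p * ((f (fst p) - g (fst p)) * f (snd p) + g (fst p) * (f (snd p) - g (snd p)))"
      by (simp add: algebra_simps)
    also have "\<bar>\<dots>\<bar> \<le> (3 * B * N) * ?D p"
      unfolding abs_mult[of "\<Theta> p"]
    proof (intro mult_mono \<Theta>B N0)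
      show "\<bar>(f (fst p) - g (fst p)) * f (snd p) + g (fst p) * (f (snd p) - g (snd p))\<bar> \<le> ?D p"
        by (rule order_trans[OF abs_triangle_ineq]) (simp add: abs_mult f(2) g(2))
    qed simp
    finally show "\<bar>?E p\<bar> \<le> 3 * B * N * ?D p" .
  qed
  also have "\<dots> = 3 * B * N * ((LBINT x. \<bar>f x - g x\<bar>) * (LBINT x. f x) + (LBINT x. g x) * (LBINT x. \<bar>f x - g x\<bar>))"
    using integrable_pair_times[OF d f(1)] integrable_pair_times[OF g(1) d] by simp
  also have "\<dots> \<le> 3 * B * N * ((LBINT x. \<bar>f x - g x\<bar>) * C + C * (LBINT x. \<bar>f x - g x\<bar>))"
    using f(3) g(3) by (intro mult_left_mono add_mono mult_right_mono N0) auto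
  finally show ?thesis by (simp add: algebra_simps)
qed

section \<open>Cost of cutting the kernel to a compact square\<close>

context coagulation_problem
begin

lemma cut_kernel_measurable:
  assumes [measurable]: "measurable2 \<kappa>"
  shows "(\<lambda>p. cut_kernel r \<kappa> (fst p) (snd p)) \<in> borel_measurable lborel2"
  unfolding cut_kernel_def by measurable

text \<open>Below 1/r, passing from order -b to order -2 * b gains a factor r^(-b); above
  \<open>r\<close> the linear part dominates and is left as a tail of the first moment. The factors
  2 merge the two summands of \<open>wt b\<close>, the smaller being below the larger.\<close>

lemma wt_outside:
  assumes x: "0 < x" and r: "1 \<le> r"
  shows "indicator (- {1/r..r}) x * wt b x \<le> 2 * r powr (-b) * \<rho> x + 2 * (indicator {r<..} x * x)"
proof -
  have nn: "0 \<le> r powr (-b) * \<rho> x" using wt_pos[OF x, of "2 * b"] by simp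
  consider "x < 1/r" | "1/r \<le> x" "x \<le> r" | "r < x" by linarith
  then show ?thesis
  proof cases
    case 1
    have "1/r \<le> 1" using r by simp
    then have x1: "x < 1" using 1 by linarith
    have "x \<le> x powr (-b)"
      using powr_minus_antimono[of b x 1] b_pos x x1 by simp
    then have "wt b x \<le> 2 * x powr (-b)" unfolding wt_def by simp
    also have "x powr (-b) = x powr b * x powr (- (2 * b))" using x by (simp flip: powr_add)
    also have "\<dots> \<le> (1/r) powr b * \<rho> x"
      using 1 x b_pos wt_ge_powr[OF x, of "2 * b"] by (intro mult_mono powr_mono2) auto
    also have "(1/r) powr b = r powr (-b)" using r by (simp add: powr_divide powr_minus_divide)
    finally show ?thesis using 1 r x by (auto simp: indicator_def)
  next
    case 2
    then show ?thesis using nn r by (auto simp: indicator_def)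
  next
    case 3
    have "x powr (-b) \<le> 1" using powr_minus_antimono[of b 1 x] b_pos 3 r by simp
    then have "wt b x \<le> 2 * x" unfolding wt_def using 3 r by simp
    then show ?thesis using 3 nn by (simp add: indicator_def)
  qed
qed

text \<open>A pair removed by the cut has a coordinate outside the interval; that coordinate
  contributes the small integral of \<open>W\<close>, the other one the moment of
  \<open>wt b\<close>. The 24 is 3 for \<open>tilde\<close>, 2 for the choice of the coordinate, 2
  from \<open>wt_outside\<close> and 2 from \<open>wt b x \<le> 2 * \<rho> x\<close>.\<close>

lemma coag_form_cut_error:
  assumes g: "admissible (2 * b) g" "(LBINT x. \<rho> x * g x) \<le> M"
    and \<omega>[measurable]: "\<omega> \<in> borel_measurable borel" and B: "\<And>x. \<bar>\<omega> x\<bar> \<le> B"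
    and \<kappa>[measurable]: "measurable2 \<kappa>"
    and \<kappa>b: "\<And>x y. 0 \<le> \<kappa> x y" "\<And>x y. \<kappa> x y \<le> K x y" and r: "1 \<le> r"
  shows "\<bar>coag_form \<kappa> \<omega> g - coag_form (cut_kernel r \<kappa>) \<omega> g\<bar> \<le>
    24 * B * c * M * (r powr (-b) * M + tail_mass r g)"
proof -
  have B0: "0 \<le> B" using order_trans[OF abs_ge_zero B] .
  define W where "W = (\<lambda>x. indicator (- {1/r..r}) x * wt b x)"
  have W[measurable]: "W \<in> borel_measurable borel" unfolding W_def by measurable
  have wB: "\<bar>wt b x\<bar> \<le> 2 * \<rho> x" if "0 < x" for x
    using wt_le[OF that] wt_pos[OF that, of b] by simp
  have WB: "\<bar>W x\<bar> \<le> 2 * \<rho> x" if "0 < x" for x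
    using wB[OF that] wt_pos[OF that, of "2 * b"] by (auto simp: W_def indicator_def)
  have W0: "0 \<le> W x * g x" for x
    using admissibleD(2,3)[OF g(1), of x] wt_pos[of x b] by (cases "x \<le> 0") (auto simp: W_def indicator_def)
  have iW: "integrable lborel (\<lambda>x. W x * g x)" by (rule admissible_integral[OF g(1) W WB])
  have iw: "integrable lborel (\<lambda>x. wt b x * g x)" by (rule admissible_integral[OF g(1) wt_measurable wB])
  have iI: "integrable lborel (\<lambda>x. indicator {r<..} x * x * g x)"
    by (rule admissible_integral[OF g(1) _ indicator_self_le_wt]) measurable
  have w_le: "(LBINT x. wt b x * g x) \<le> 2 * M"
    using admissible_integral(2)[OF g(1) wt_measurable wB] g(2) by simp
  have W_le: "(LBINT x. W x * g x) \<le> 2 * (r powr (-b) * M + tail_mass r g)"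
  proof -
    have "(LBINT x. W x * g x) \<le>
      (LBINT x. 2 * r powr (-b) * (\<rho> x * g x) + 2 * (indicator {r<..} x * x * g x))"
    proof (rule integral_mono[OF iW])
      show "integrable lborel (\<lambda>x. 2 * r powr (-b) * (\<rho> x * g x) + 2 * (indicator {r<..} x * x * g x))"
        using admissibleD(4)[OF g(1)] iI by simp
      show "W x * g x \<le> 2 * r powr (-b) * (\<rho> x * g x) + 2 * (indicator {r<..} x * x * g x)" for x
        using mult_right_mono[OF wt_outside[OF _ r, of x] admissibleD(2)[OF g(1), of x]] admissibleD(3)[OF g(1), of x]
        by (cases "x \<le> 0") (auto simp: W_def algebra_simps)
    qed
    also have "\<dots> = 2 * r powr (-b) * (LBINT x. \<rho> x * g x) + 2 * tail_mass r g"
      using admissibleD(4)[OF g(1)] iI by simp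
    also have "\<dots> \<le> 2 * r powr (-b) * M + 2 * tail_mass r g"
      using g(2) by (intro add_right_mono mult_left_mono) auto
    finally show ?thesis by simp
  qed
  let ?E = "\<lambda>p. coag_integrand \<kappa> \<omega> g p - coag_integrand (cut_kernel r \<kappa>) \<omega> g p"
  let ?W = "\<lambda>p. 3 * B * c *
      ((W (fst p) * g (fst p)) * (wt b (snd p) * g (snd p)) + (wt b (fst p) * g (fst p)) * (W (snd p) * g (snd p)))"
  have cutb: "0 \<le> cut_kernel r \<kappa> x y" "cut_kernel r \<kappa> x y \<le> K x y" for x y
    using \<kappa>b[of x y] K_nonneg[of x y] by (auto simp: cut_kernel_def indicator_def)
  note i1 = coag_form_bound(1)[OF g \<omega> B \<kappa> \<kappa>b]
  note i2 = coag_form_bound(1)[OF g \<omega> B cut_kernel_measurable[OF \<kappa>] cutb]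
  have "\<bar>coag_form \<kappa> \<omega> g - coag_form (cut_kernel r \<kappa>) \<omega> g\<bar> =
    \<bar>LINT p|lborel2. ?E p\<bar>"
    unfolding coag_form_def using i1 i2 by simp
  also have "\<dots> \<le> (LINT p|lborel2. \<bar>?E p\<bar>)"
    by (rule integral_abs_bound)
  also have "\<dots> \<le> (LINT p|lborel2. ?W p)"
  proof (rule integral_mono)
    show "integrable lborel2 (\<lambda>p. \<bar>?E p\<bar>)"
      using i1 i2 by auto
    show "integrable lborel2 (\<lambda>p. ?W p)"
      by (intro integrable_mult_right Bochner_Integration.integrable_add integrable_pair_times iW iw)
    fix p :: "real \<times> real"
    obtain x y where p: "p = (x, y)" by (cases p)
    show "\<bar>?E p\<bar> \<le> ?W p"
    proof (cases "x \<le> 0 \<or> y \<le> 0")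
      case True then show ?thesis using admissibleD(3)[OF g(1), of x] admissibleD(3)[OF g(1), of y] by (auto simp: p)
    next
      case False
      then have xy: "0 < x" "0 < y" by auto
      have O: "\<bar>\<omega> (x + y) - \<omega> x - \<omega> y\<bar> \<le> 3 * B" using B[of "x + y"] B[of x] B[of y] by linarith
      have k: "\<bar>\<kappa> x y - cut_kernel r \<kappa> x y\<bar> \<le> c * (W x * wt b y + wt b x * W y)"
      proof -
        have nn: "0 \<le> W x * wt b y" "0 \<le> wt b x * W y"
          using wt_pos[OF xy(1), of b] wt_pos[OF xy(2), of b] by (auto simp: W_def)
        show ?thesis
        proof (cases "x \<in> {1/r..r} \<and> y \<in> {1/r..r}")
          case True then show ?thesis using nn c_pos by (simp add: cut_kernel_def)
        next
          case False
          then have cut: "cut_kernel r \<kappa> x y = 0" by (auto simp: cut_kernel_def indicator_def)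
          have "wt b x * wt b y \<le> W x * wt b y + wt b x * W y"
            using False nn wt_pos[OF xy(1), of b] wt_pos[OF xy(2), of b] by (auto simp: W_def indicator_def)
          from mult_left_mono[OF this less_imp_le[OF c_pos]] show ?thesis
            using cut \<kappa>b[of x y] K_le[OF xy] by simp
        qed
      qed
      have "\<bar>?E p\<bar> =
          \<bar>(\<omega> (x + y) - \<omega> x - \<omega> y) * (\<kappa> x y - cut_kernel r \<kappa> x y) * (g x * g y)\<bar>"
        by (simp add: p algebra_simps)
      also have "\<dots> = \<bar>\<omega> (x + y) - \<omega> x - \<omega> y\<bar> * \<bar>\<kappa> x y - cut_kernel r \<kappa> x y\<bar> * (g x * g y)"
        using admissibleD(2)[OF g(1)] by (simp add: abs_mult)
      also have "\<dots> \<le> (3 * B) * (c * (W x * wt b y + wt b x * W y)) * (g x * g y)"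
        using O k admissibleD(2)[OF g(1)] B0 by (intro mult_right_mono mult_mono) auto
      finally show ?thesis by (simp add: p algebra_simps)
    qed
  qed
  also have "\<dots> = 6 * B * c * ((LBINT x. W x * g x) * (LBINT x. wt b x * g x))"
    using integrable_pair_times[OF iW iw] integrable_pair_times[OF iw iW] by (simp add: algebra_simps)
  also have "\<dots> \<le> 6 * B * c * ((2 * (r powr (-b) * M + tail_mass r g)) * (2 * M))"
  proof (intro mult_left_mono mult_mono W_le w_le)
    show "0 \<le> (LBINT x. wt b x * g x)"
      using admissibleD(2,3)[OF g(1)] wt_pos
      by (intro Bochner_Integration.integral_nonneg) (metis less_imp_le linorder_not_le mult_eq_0_iff mult_nonneg_nonneg order_refl)
    show "0 \<le> 2 * (r powr (-b) * M + tail_mass r g)"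
      using order_trans[OF Bochner_Integration.integral_nonneg W_le] W0 by simp
  qed (use B0 c_pos in auto)
  also have "\<dots> = 24 * B * c * M * (r powr (-b) * M + tail_mass r g)"
    by simp
  finally show ?thesis .
qed

text \<open>Where \<open>K\<close> is at most \<open>N\<close>, truncation at
  \<open>real n + 1\<close> is inactive for large \<open>n\<close>. The cut kernels then no longer
  depend on \<open>n\<close>, which leaves one bounded kernel for the whole passage to the
  limit.\<close>

lemma cut_kernel_bounded:
  assumes "1 \<le> r"
  obtains N where "0 \<le> N" "\<forall>x y. cut_kernel r K x y \<le> N"
    "\<forall>n. N \<le> real n + 1 \<longrightarrow> cut_kernel r (trunc n) = cut_kernel r K"
proof -
  define N where "N = c * ((r powr b + r) * (r powr b + r))"
  have N0: "0 \<le> N" unfolding N_def using c_pos assms by simp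
  have KN: "K x y \<le> N" if "x \<in> {1/r..r}" "y \<in> {1/r..r}" for x y
  proof -
    have pos: "0 < z" and w: "wt b z \<le> r powr b + r" if "z \<in> {1/r..r}" for z
    proof -
      have r0: "0 < 1/r" using assms by simp
      show "0 < z" using that r0 by (simp del: zero_less_divide_1_iff zero_less_divide_iff)
      have "z powr (-b) \<le> (1/r) powr (-b)" using powr_minus_antimono[of b "1/r" z] b_pos r0 that by simp
      also have "\<dots> = r powr b" using assms by (simp add: powr_divide powr_minus_divide)
      finally show "wt b z \<le> r powr b + r" unfolding wt_def using that by simp
    qed
    have "K x y \<le> c * (wt b x * wt b y)" by (rule K_le[OF pos pos]) fact+
    also have "\<dots> \<le> N" unfolding N_def
      using w[OF that(1)] w[OF that(2)] c_pos wt_pos[OF pos[OF that(1)], of b] wt_pos[OF pos[OF that(2)], of b]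
      by (intro mult_left_mono mult_mono) auto
    finally show ?thesis .
  qed
  show ?thesis
  proof
    show "0 \<le> N" by fact
    show "\<forall>x y. cut_kernel r K x y \<le> N"
      using KN N0 by (auto simp: cut_kernel_def indicator_def)
    show "\<forall>n. N \<le> real n + 1 \<longrightarrow> cut_kernel r (trunc n) = cut_kernel r K"
    proof (intro allI impI ext)
      fix n x y assume "N \<le> real n + 1"
      then show "cut_kernel r (trunc n) x y = cut_kernel r K x y"
        using KN[of x y] by (auto simp: cut_kernel_def indicator_def trunc_def)
    qed
  qed
qed

end

section \<open>Passage to the limit in the quadratic term\<close>

context coagulation_limit
begin

text \<open>Up to an error \<open>e\<close>, uniform on the time interval, the unbounded kernel and
  its truncations are replaced by one bounded kernel, for the approximations and for the limit
  alike. Weak convergence and continuity in time then concern only that kernel.\<close>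

lemma coag_form_bounded_kernel_approx:
  assumes e: "0 < e" and \<omega>: "\<omega> \<in> borel_measurable borel" "\<And>x. \<bar>\<omega> x\<bar> \<le> B"
  obtains \<kappa> N where "measurable2 \<kappa>"
    "\<forall>x y. 0 \<le> \<kappa> x y" "\<forall>x y. \<kappa> x y \<le> N" "0 \<le> N"
    "\<forall>\<^sub>F n in F. \<forall>t. 0 \<le> t \<longrightarrow> t \<le> T \<longrightarrow> \<bar>coag_form (trunc n) \<omega> (v n t) - coag_form \<kappa> \<omega> (v n t)\<bar> \<le> e"
    "\<forall>t. 0 \<le> t \<longrightarrow> t \<le> T \<longrightarrow> \<bar>coag_form K \<omega> (\<lambda>x. G x t) - coag_form \<kappa> \<omega> (\<lambda>x. G x t)\<bar> \<le> e"
proof -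
  have B: "0 \<le> B" using order_trans[OF abs_ge_zero \<omega>(2)] .
  define D where "D = 24 * B * c * M + 1"
  have D: "0 < D" "24 * B * c * M \<le> D" unfolding D_def using B c_pos M_nonneg by (auto intro: add_nonneg_pos)
  define e' where "e' = e / (2 * D)"
  have e': "0 < e'" unfolding e'_def using e D by simp
  obtain R where R: "1 \<le> R"
    "\<And>n t. 0 \<le> t \<Longrightarrow> t \<le> T \<Longrightarrow> tail_mass R (v n t) \<le> e'"
    "\<And>t. 0 \<le> t \<Longrightarrow> t \<le> T \<Longrightarrow> tail_mass R (\<lambda>x. G x t) \<le> e'"
    by (rule G_tail[OF e', of T]) blast
  have "((\<lambda>r. r powr (-b) * M) \<longlongrightarrow> 0 * M) at_top"
    using b_pos by (intro tendsto_mult tendsto_const tendsto_neg_powr filterlim_ident) auto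
  then have "eventually (\<lambda>r. r powr (-b) * M < e') at_top" using e' by (intro order_tendstoD) auto
  then obtain r0 where r0: "\<And>r. r \<ge> r0 \<Longrightarrow> r powr (-b) * M < e'" by (auto simp: eventually_at_top_linorder)
  \<comment> \<open>\<open>R\<close> takes care of the tails at large sizes, \<open>r0\<close> of
    the factor \<open>r powr (-b)\<close> from small sizes.\<close>
  define r where "r = max R r0"
  have r: "1 \<le> r" "R \<le> r" using R(1) by (auto simp: r_def)
  have main: "\<bar>coag_form \<kappa> \<omega> f - coag_form (cut_kernel r \<kappa>) \<omega> f\<bar> \<le> e"
    if \<kappa>: "measurable2 \<kappa>" "\<And>x y. 0 \<le> \<kappa> x y" "\<And>x y. \<kappa> x y \<le> K x y"
      and f: "admissible (2 * b) f" "(LBINT x. \<rho> x * f x) \<le> M"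
      and tail: "tail_mass R f \<le> e'" for \<kappa> f
  proof -
    have ii: "integrable lborel (\<lambda>x. indicator {s<..} x * x * f x)" for s :: real
      by (rule admissible_integral[OF f(1) _ indicator_self_le_wt]) measurable
    have "tail_mass r f \<le> tail_mass R f"
      using r R(1) admissibleD(2)[OF f(1)] by (intro integral_mono ii) (auto simp: indicator_def)
    then have 1: "r powr (-b) * M + tail_mass r f \<le> e' + e'"
      using tail r0[of r] by (simp add: r_def)
    have 2: "0 \<le> tail_mass r f"
      using r admissibleD(2)[OF f(1)] by (intro Bochner_Integration.integral_nonneg) (auto simp: indicator_def)
    have "\<bar>coag_form \<kappa> \<omega> f - coag_form (cut_kernel r \<kappa>) \<omega> f\<bar> \<le>
        24 * B * c * M * (r powr (-b) * M + tail_mass r f)"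
      by (rule coag_form_cut_error[OF f \<omega> \<kappa> r(1)])
    also have "\<dots> \<le> D * (e' + e')"
      using 1 2 D M_nonneg by (intro mult_mono) auto
    also have "\<dots> = e" unfolding e'_def using D by (simp add: field_simps)
    finally show ?thesis .
  qed
  obtain N where N: "0 \<le> N" "\<forall>x y. cut_kernel r K x y \<le> N"
    "\<forall>n. N \<le> real n + 1 \<longrightarrow> cut_kernel r (trunc n) = cut_kernel r K"
    by (rule cut_kernel_bounded[OF r(1)])
  obtain n0 :: nat where "N \<le> real n0" using real_arch_simple by blast
  then have "\<forall>\<^sub>F n in sequentially. N \<le> real n + 1"
    by (intro eventually_sequentiallyI[of n0]) (meson add_increasing2 of_nat_mono order_trans zero_le_one)
  then have "\<forall>\<^sub>F n in F. N \<le> real n + 1" by (rule filter_leD[OF F(2)])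
  then have v: "\<forall>\<^sub>F n in F. \<forall>t. 0 \<le> t \<longrightarrow> t \<le> T \<longrightarrow>
      \<bar>coag_form (trunc n) \<omega> (v n t) - coag_form (cut_kernel r K) \<omega> (v n t)\<bar> \<le> e"
  proof eventually_elim
    case (elim n)
    then show ?case
      using main[OF trunc_measurable[of n] trunc_props(1,3) v_admissible v_norm R(2)] N(3) by simp
  qed
  have G: "\<forall>t. 0 \<le> t \<longrightarrow> t \<le> T \<longrightarrow> \<bar>coag_form K \<omega> (\<lambda>x. G x t) - coag_form (cut_kernel r K) \<omega> (\<lambda>x. G x t)\<bar> \<le> e"
    using main[OF K_measurable K_nonneg order_refl G_admissible G_norm R(3)] by simp
  have "\<forall>x y. 0 \<le> cut_kernel r K x y" using K_nonneg by (simp add: cut_kernel_def)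
  from that[OF cut_kernel_measurable[OF K_measurable] this N(2,1) v G] show ?thesis .
qed

lemma coag_form_tendsto:
  assumes t: "0 \<le> t" and \<omega>[measurable]: "\<omega> \<in> borel_measurable borel" and B: "\<And>x. \<bar>\<omega> x\<bar> \<le> B"
  shows "((\<lambda>n. coag_form (trunc n) \<omega> (v n t)) \<longlongrightarrow> coag_form K \<omega> (\<lambda>x. G x t)) F"
proof (rule tendstoI)
  fix e :: real assume e: "0 < e"
  have B0: "0 \<le> B" using order_trans[OF abs_ge_zero B] .
  have e3: "0 < e / 3" using e by simp
  obtain \<kappa> N where \<kappa>[measurable]: "measurable2 \<kappa>"
    and N: "\<forall>x y. 0 \<le> \<kappa> x y" "\<forall>x y. \<kappa> x y \<le> N" "0 \<le> N"
    and v: "\<forall>\<^sub>F n in F. \<forall>t'. 0 \<le> t' \<longrightarrow> t' \<le> t \<longrightarrow>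
      \<bar>coag_form (trunc n) \<omega> (v n t') - coag_form \<kappa> \<omega> (v n t')\<bar> \<le> e / 3"
    and G: "\<forall>t'. 0 \<le> t' \<longrightarrow> t' \<le> t \<longrightarrow> \<bar>coag_form K \<omega> (\<lambda>x. G x t') - coag_form \<kappa> \<omega> (\<lambda>x. G x t')\<bar> \<le> e / 3"
    by (rule coag_form_bounded_kernel_approx[OF e3 \<omega> B, of t])
  \<comment> \<open>\<open>\<Theta>\<close> merges kernel and test function into one bounded
    measurable function of the pair, against which the tensor squares converge.\<close>
  define \<Theta> where "\<Theta> = (\<lambda>p. tilde \<omega> p * \<kappa> (fst p) (snd p))"
  have \<Theta>B: "\<bar>\<Theta> p\<bar> \<le> 3 * B * N" for p
    unfolding \<Theta>_def abs_mult
  by (intro mult_mono abs_tilde_le B) (use N B0 in auto)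
  have G_le: "(LBINT x. G x t) \<le> M"
    using G_weighted(2)[OF t, of "\<lambda>_. 1" 1 M] wt_double_ge_1 v_le by simp
  have "((\<lambda>n. LINT p|lborel2. \<Theta> p * (v n t (fst p) * v n t (snd p))) \<longlongrightarrow>
    (LINT p|lborel2. \<Theta> p * (G (fst p) t * G (snd p) t))) F"
  proof (rule tendsto_quadratic_integral[OF v_integrable v_nonneg v_le G_integrable[OF t] G_nonneg G_le v_equi_small[OF t]])
    show "((\<lambda>n. int_on lborel A (v n t)) \<longlongrightarrow> int_on lborel A (\<lambda>x. G x t)) F"
      if "A \<in> sets lborel" for A
      by (rule G_tendsto[OF t, where B=1]) (use that in \<open>auto simp: indicator_def\<close>)
    show "\<Theta> \<in> borel_measurable lborel2" unfolding \<Theta>_def by measurable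
  qed (use \<Theta>B in auto)
  then have "((\<lambda>n. coag_form \<kappa> \<omega> (v n t)) \<longlongrightarrow> coag_form \<kappa> \<omega> (\<lambda>x. G x t)) F"
    unfolding coag_form_def \<Theta>_def .
  from tendstoD[OF this e3] v
  show "eventually (\<lambda>n. dist (coag_form (trunc n) \<omega> (v n t)) (coag_form K \<omega> (\<lambda>x. G x t)) < e) F"
  proof eventually_elim
    case (elim n)
    have 1: "\<bar>coag_form (trunc n) \<omega> (v n t) - coag_form \<kappa> \<omega> (v n t)\<bar> \<le> e / 3"
      and 2: "\<bar>coag_form K \<omega> (\<lambda>x. G x t) - coag_form \<kappa> \<omega> (\<lambda>x. G x t)\<bar> \<le> e / 3"
      using elim(2) G t by auto
    show ?case using 1 2 elim(1) unfolding dist_real_def by linarith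
  qed
qed

text \<open>For a bounded kernel the form is Lipschitz with respect to the L1 distance, and
  \<open>v n\<close> is Lipschitz in time in L1 up to \<open>tau n\<close>. The bounded replacement
  is within \<open>e / 3\<close> at all times, so the modulus transfers for those \<open>n\<close>
  for which the replacement is valid and \<open>tau n\<close> is below \<open>d\<close>.\<close>

lemma coag_form_equicontinuous:
  assumes \<omega>: "\<omega> \<in> borel_measurable borel" "\<And>x. \<bar>\<omega> x\<bar> \<le> B" and e: "0 < e"
  shows "\<exists>d>0. eventually (\<lambda>n. \<forall>s r. 0 \<le> s \<longrightarrow> s \<le> t \<longrightarrow> 0 \<le> r \<longrightarrow> r \<le> t \<longrightarrow> \<bar>s - r\<bar> < d \<longrightarrow>
      \<bar>coag_form (trunc n) \<omega> (v n s) - coag_form (trunc n) \<omega> (v n r)\<bar> \<le> e) F"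
proof -
  have B0: "0 \<le> B" using order_trans[OF abs_ge_zero \<omega>(2)] .
  have e3: "0 < e / 3" using e by simp
  obtain \<kappa> N where \<kappa>: "measurable2 \<kappa>"
    and N: "\<forall>x y. 0 \<le> \<kappa> x y" "\<forall>x y. \<kappa> x y \<le> N" "0 \<le> N"
    and v: "\<forall>\<^sub>F n in F. \<forall>t'. 0 \<le> t' \<longrightarrow> t' \<le> t \<longrightarrow>
      \<bar>coag_form (trunc n) \<omega> (v n t') - coag_form \<kappa> \<omega> (v n t')\<bar> \<le> e / 3"
    and "\<forall>t'. 0 \<le> t' \<longrightarrow> t' \<le> t \<longrightarrow> \<bar>coag_form K \<omega> (\<lambda>x. G x t') - coag_form \<kappa> \<omega> (\<lambda>x. G x t')\<bar> \<le> e / 3"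
    by (rule coag_form_bounded_kernel_approx[OF e3 \<omega>, of t])
  define D where "D = 6 * B * N * M * lip + 1"
  have D0: "0 \<le> 6 * B * N * M" using B0 N M_nonneg by simp
  have D: "0 < D" "6 * B * N * M * lip \<le> D"
    unfolding D_def using D0 lip_nonneg by (auto intro: add_nonneg_pos)
  \<comment> \<open>The time difference and \<open>tau n\<close> are both below \<open>d\<close>,
    and \<open>D * (d + d)\<close> is \<open>e / 3\<close>.\<close>
  define d where "d = e / (6 * D)"
  have d: "0 < d" unfolding d_def using e D by simp
  have "eventually (\<lambda>n. tau n < d) F"
    using tendsto_mono[OF F(2) tau_tendsto_0] d by (rule order_tendstoD)
  with v have "eventually (\<lambda>n. \<forall>s r. 0 \<le> s \<longrightarrow> s \<le> t \<longrightarrow> 0 \<le> r \<longrightarrow> r \<le> t \<longrightarrow> \<bar>s - r\<bar> < d \<longrightarrow>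
      \<bar>coag_form (trunc n) \<omega> (v n s) - coag_form (trunc n) \<omega> (v n r)\<bar> \<le> e) F"
  proof eventually_elim
    case (elim n)
    show ?case
    proof (intro allI impI)
      fix s s' assume s: "0 \<le> s" "s \<le> t" and s': "0 \<le> s'" "s' \<le> t" and ss: "\<bar>s - s'\<bar> < d"
      have 1: "\<bar>coag_form (trunc n) \<omega> (v n s) - coag_form \<kappa> \<omega> (v n s)\<bar> \<le> e / 3"
        and 2: "\<bar>coag_form (trunc n) \<omega> (v n s') - coag_form \<kappa> \<omega> (v n s')\<bar> \<le> e / 3"
        using elim(1) s s' by auto
      have "\<bar>coag_form \<kappa> \<omega> (v n s) - coag_form \<kappa> \<omega> (v n s')\<bar> \<le>
          6 * B * N * M * (LBINT x. \<bar>v n s x - v n s' x\<bar>)"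
        by (rule coag_form_bounded_kernel_diff[OF v_integrable v_nonneg v_le v_integrable v_nonneg v_le \<omega>
            \<kappa> N(1,2)[rule_format]])
      also have "\<dots> \<le> 6 * B * N * M * (lip * (\<bar>s - s'\<bar> + tau n))"
        by (rule mult_left_mono[OF v_L1_lipschitz[OF s'(1) s(1)] D0])
      also have "\<dots> \<le> D * (d + d)"
        unfolding mult.assoc[symmetric] using D ss elim(2) tau_pos[of n] by (intro mult_mono) auto
      also have "\<dots> = e / 3" unfolding d_def using D by (simp add: field_simps)
      finally have 3: "\<bar>coag_form \<kappa> \<omega> (v n s) - coag_form \<kappa> \<omega> (v n s')\<bar> \<le> e / 3" .
      show "\<bar>coag_form (trunc n) \<omega> (v n s) - coag_form (trunc n) \<omega> (v n s')\<bar> \<le> e"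
        using 1 2 3 by linarith
    qed
  qed
  then show ?thesis using d by blast
qed

text \<open>The form has a bound that is uniform in time, so the integrand is integrable in time and
  both sizes together. This links the triple integral in the notion of solution with the time
  integral of \<open>coag_form\<close>.\<close>

lemma G_form_integral:
  assumes t: "0 < t" and \<omega>[measurable]: "\<omega> \<in> borel_measurable borel" and B: "\<And>x. \<bar>\<omega> x\<bar> \<le> B"
  defines "J \<equiv> \<lambda>q. indicator {0<..<t} (fst q) * coag_integrand K \<omega> (\<lambda>x. G x (fst q)) (snd q)"
  shows "integrable lborel3 J"
    and "set_integrable lborel {0<..<t} (\<lambda>s. coag_form K \<omega> (\<lambda>x. G x s))"
    and "(LINT q|lborel3. J q) = (LBINT s:{0<..<t}. coag_form K \<omega> (\<lambda>x. G x s))"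
proof -
  interpret P: pair_sigma_finite lborel lborel2
    by (rule pair_sigma_finite_lborel_pair)
  note [measurable] = measurable_triple(1)[OF K_measurable] measurable_triple(2,3)[OF G_measurable]
  have J[measurable]: "J \<in> borel_measurable lborel3" unfolding J_def by measurable
  let ?H = "\<lambda>s. coag_integrand K \<omega> (\<lambda>x. G x s)"
  have Jeq: "J (s, p) = indicator {0<..<t} s * ?H s p" for s p unfolding J_def by simp
  note bd = coag_form_bound[OF G_admissible G_norm \<omega> B K_measurable K_nonneg order_refl]
  have inner: "(LINT p|lborel2. norm (J (s, p))) \<le> 2 * (B * lip) * indicator {0<..<t} s" for s
    unfolding Jeq using bd(2)[of s] by (cases "s \<in> {0<..<t}") auto
  have iI: "integrable lborel (\<lambda>s. 2 * (B * lip) * indicator {0<..<t} s)"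
    using t by (intro integrable_mult_right integrable_real_indicator) auto
  show int: "integrable lborel3 J"
  proof (rule P.Fubini_integrable[OF J])
    show "integrable lborel (\<lambda>s. LINT p|lborel2. norm (J (s, p)))"
    proof (rule Bochner_Integration.integrable_bound[OF iI])
      show "AE s in lborel. norm (LINT p|lborel2. norm (J (s, p))) \<le> norm (2 * (B * lip) * indicator {0<..<t} s)"
        using order_trans[OF inner abs_ge_self] by (intro AE_I2) simp
    qed measurable
    show "AE s in lborel. integrable lborel2 (\<lambda>p. J (s, p))"
    proof (rule AE_I2)
      fix s show "integrable lborel2 (\<lambda>p. J (s, p))"
        unfolding Jeq using bd(1)[of s] by (cases "s \<in> {0<..<t}") auto
    qed
  qed
  have eq: "(LINT p|lborel2. J (s, p)) = indicator {0<..<t} s *\<^sub>R coag_form K \<omega> (\<lambda>x. G x s)" for s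
    unfolding Jeq coag_form_def by simp
  show "set_integrable lborel {0<..<t} (\<lambda>s. coag_form K \<omega> (\<lambda>x. G x s))"
    using P.integrable_fst'[OF int] unfolding eq set_integrable_def .
  show "(LINT q|lborel3. J q) = (LBINT s:{0<..<t}. coag_form K \<omega> (\<lambda>x. G x s))"
    using P.integral_fst'[OF int] unfolding eq set_lebesgue_integral_def by simp
qed

text \<open>The scheme satisfies its discrete equation exactly; only the replacement of the Euler
  sum by a time integral costs an error of order \<open>tau n\<close>.\<close>

lemma G_weak_equation:
  assumes t: "0 < t" and \<omega>: "\<omega> \<in> borel_measurable borel" "\<And>x. \<bar>\<omega> x\<bar> \<le> B"
  shows "(LBINT x. \<omega> x * G x t) - (LBINT x. \<omega> x * f0 x) =
    1 / 2 * (LBINT s:{0<..<t}. coag_form K \<omega> (\<lambda>x. G x s))"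
proof -
  have B0: "0 \<le> B" using order_trans[OF abs_ge_zero \<omega>(2)] .
  let ?q = "\<lambda>n i. coag_form (trunc n) \<omega> (u n i)"
  let ?Q = "\<lambda>n. LBINT s:{0<..<t}. coag_form (trunc n) \<omega> (v n s)"
  have q: "\<bar>?q n i\<bar> \<le> 2 * (B * lip)" for n i
    by (rule coag_form_bound(3)[OF u_admissible u_norm \<omega> trunc_measurable trunc_props(1,3)])
  have step: "set_integrable lborel {0<..<t} (\<lambda>s. coag_form (trunc n) \<omega> (v n s))"
    "\<bar>?Q n - tau n * (\<Sum>i<nat \<lfloor>t / tau n\<rfloor>. ?q n i)\<bar> \<le> 2 * (B * lip) * tau n" for n
    using integral_step_function[where q = "?q n", OF tau_pos[of n] less_imp_le[OF t] q] unfolding v_def by auto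
  have lim: "(?Q \<longlongrightarrow> (LBINT s:{0<..<t}. coag_form K \<omega> (\<lambda>x. G x s))) F"
    by (rule tendsto_integral_equicontinuous[OF t step(1) G_form_integral(2)[OF t \<omega>] F(1)
        coag_form_tendsto[OF _ \<omega>] coag_form_equicontinuous[OF \<omega>]])
  have tau0: "(tau \<longlongrightarrow> 0) F" by (rule tendsto_mono[OF F(2) tau_tendsto_0])
  have eqn: "2 * ((LBINT x. \<omega> x * v n t x) - (LBINT x. \<omega> x * f0 x)) = tau n * (\<Sum>i<nat \<lfloor>t / tau n\<rfloor>. ?q n i)" for n
    using u_weak[OF \<omega>(1) bounded_le_wt[OF B0 _ \<omega>(2)], of n "nat \<lfloor>t / tau n\<rfloor>"] unfolding v_def by simp
  \<comment> \<open>By \<open>eqn\<close> the subtracted term is the Euler sum itself, so the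
    difference is just the error of integrating the step function.\<close>
  have "((\<lambda>n. ?Q n - 2 * ((LBINT x. \<omega> x * v n t x) - (LBINT x. \<omega> x * f0 x))) \<longlongrightarrow> 0) F"
  proof (rule Lim_null_comparison)
    show "((\<lambda>n. 2 * (B * lip) * tau n) \<longlongrightarrow> 0) F" by (rule tendsto_mult_right_zero[OF tau0])
    show "\<forall>\<^sub>F n in F. norm (?Q n - 2 * ((LBINT x. \<omega> x * v n t x) - (LBINT x. \<omega> x * f0 x))) \<le> 2 * (B * lip) * tau n"
      unfolding eqn real_norm_def by (rule always_eventually) (rule allI, rule step(2))
  qed
  moreover have "((\<lambda>n. ?Q n - 2 * ((LBINT x. \<omega> x * v n t x) - (LBINT x. \<omega> x * f0 x))) \<longlongrightarrow>
     (LBINT s:{0<..<t}. coag_form K \<omega> (\<lambda>x. G x s)) - 2 * ((LBINT x. \<omega> x * G x t) - (LBINT x. \<omega> x * f0 x))) F"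
    by (intro tendsto_intros lim G_tendsto[OF less_imp_le[OF t] \<omega>])
  ultimately have "(LBINT s:{0<..<t}. coag_form K \<omega> (\<lambda>x. G x s)) - 2 * ((LBINT x. \<omega> x * G x t) - (LBINT x. \<omega> x * f0 x)) = 0"
    by (rule tendsto_unique[OF F(1), symmetric])
  then show ?thesis by simp
qed

end

section \<open>Zero extension and null sets\<close>

lemma integral_lborel_halfline:
  fixes f h :: "real \<Rightarrow> real"
  assumes "\<And>x. 0 < x \<Longrightarrow> f x = h x" "\<And>x. x \<le> 0 \<Longrightarrow> h x = 0"
  shows "(LBINT x:{0<..}. f x) = (LBINT x. h x)"
    and "set_integrable lborel {0<..} f \<longleftrightarrow> integrable lborel h"
proof -
  have "(\<lambda>x. indicator {0<..} x *\<^sub>R f x) = h"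
    using assms by (auto simp: indicator_def fun_eq_iff not_less)
  then show "(LBINT x:{0<..}. f x) = (LBINT x. h x)"
    "set_integrable lborel {0<..} f \<longleftrightarrow> integrable lborel h"
    unfolding set_lebesgue_integral_def set_integrable_def by simp_all
qed

text \<open>For fixed \<open>x\<close> the set of \<open>y\<close> with \<open>x + y\<close> in a
  null set is a translate of it, hence null. The sum is included since \<open>tilde\<close>
  evaluates the test function there, and test functions are bounded only almost everywhere.\<close>

lemma AE_lborel_pair_coordinates:
  assumes "AE x in lborel. P (x::real)"
  shows "AE p in lborel2. P (fst p) \<and> P (snd p) \<and> P (fst p + snd p)"
proof -
  obtain N where N: "N \<in> null_sets lborel" "{x. \<not> P x} \<subseteq> N"
    using assms by (auto simp: eventually_ae_filter)
  have [measurable]: "N \<in> sets borel" using N(1) by auto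
  have "AE p in lborel2. fst p \<notin> N \<and> snd p \<notin> N \<and> fst p + snd p \<notin> N"
  proof (rule lborel_pair.AE_pair_measure)
    show "{p \<in> space lborel2. fst p \<notin> N \<and> snd p \<notin> N \<and> fst p + snd p \<notin> N} \<in> sets lborel2"
      by measurable
    have shift: "AE y in lborel. x + y \<notin> N" for x
    proof -
      have "emeasure lborel N = (\<integral>\<^sup>+y. indicator N (x + 1 * y) \<partial>lborel)"
        using nn_integral_real_affine[of "indicator N" 1 x] by (simp add: nn_integral_indicator)
      then have "(\<integral>\<^sup>+y. indicator N (x + y) \<partial>lborel) = 0" using N(1) by auto
      then show ?thesis by (subst (asm) nn_integral_0_iff_AE) (auto simp: indicator_def elim!: eventually_mono split: if_splits)
    qed
    show "AE x in lborel. AE y in lborel. fst (x, y) \<notin> N \<and> snd (x, y) \<notin> N \<and> fst (x, y) + snd (x, y) \<notin> N"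
      using AE_not_in[OF N(1)]
    proof eventually_elim
      case (elim x)
      then show ?case using AE_not_in[OF N(1)] shift[of x] by auto
    qed
  qed
  then show ?thesis by eventually_elim (use N(2) in auto)
qed

lemma AE_lborel_triple_snd:
  assumes "AE p in lborel2. P (p :: real \<times> real)"
  shows "AE q in lborel3. P (snd (q :: real \<times> real \<times> real))"
proof -
  interpret P: pair_sigma_finite lborel lborel2
    by (rule pair_sigma_finite_lborel_pair)
  obtain N where N: "N \<in> null_sets lborel2" "{p \<in> space lborel2. \<not> P p} \<subseteq> N"
    using assms by (auto simp: eventually_ae_filter)
  have [measurable]: "N \<in> sets lborel2" using N(1) by auto
  have "AE q in lborel3. snd (q :: real \<times> real \<times> real) \<notin> N"
  proof (rule P.AE_pair_measure)
    show "{q \<in> space lborel3. snd q \<notin> N} \<in>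
        sets lborel3" by measurable
  qed (use AE_not_in[OF N(1)] in auto)
  then show ?thesis by eventually_elim (use N(2) in \<open>auto simp: space_pair_measure\<close>)
qed

theorem theorem2p1:
  fixes \<Psi> :: "real \<Rightarrow> real \<Rightarrow> real" and gin :: "real \<Rightarrow> real" and \<beta> k :: real
  assumes meas: "(\<lambda>(x, y). \<Psi> x y) \<in> borel_measurable (restrict_space (lborel \<Otimes>\<^sub>M lborel) ({0<..} \<times> {0<..}))"
    and nonneg: "\<forall>x>0. \<forall>y>0. \<Psi> x y \<ge> 0"
    and "\<beta> > 0" and "k > 0"
    and sym: "\<forall>x>0. \<forall>y>0. \<Psi> x y = \<Psi> y x"
    and b1: "\<forall>x y. 0 < x \<and> x < 1 \<and> 0 < y \<and> y < 1 \<longrightarrow> \<Psi> x y \<le> k * (x * y) powr (-\<beta>)"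
    and b2: "\<forall>x y. 0 < x \<and> x < 1 \<and> 1 < y \<longrightarrow> \<Psi> x y \<le> k * y * x powr (-\<beta>)"
    and b3: "\<forall>x y. 1 < x \<and> 1 < y \<longrightarrow> \<Psi> x y \<le> k * (x + y)"
    and gin: "weighted_L1 \<beta> gin"
    and gin_nonneg: "AE x in lborel. x > 0 \<longrightarrow> gin x \<ge> 0"
  shows "\<exists>g. weak_solution \<Psi> \<beta> gin g \<and>
           (\<forall>t\<ge>0. set_lebesgue_integral lborel {0<..} (\<lambda>z. z * g z t) =
                   set_lebesgue_integral lborel {0<..} (\<lambda>z. z * gin z))"
proof -
  \<comment> \<open>The hypotheses speak about positive sizes only; extension by zero makes the
    kernel measurable on the plane.\<close>
  define \<Psi>0 where "\<Psi>0 = (\<lambda>x y. indicator ({0<..} \<times> {0<..}) (x, y) * \<Psi> x y)"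
  have \<Psi>0[measurable]: "measurable2 \<Psi>0"
    using meas unfolding \<Psi>0_def
    by (subst (asm) borel_measurable_restrict_space_iff) (auto simp: case_prod_beta' space_pair_measure)
  \<comment> \<open>nothing is assumed about \<open>\<Psi>\<close> on the null set where a coordinate is 1\<close>
  define K where "K = (\<lambda>x y. if x = 1 \<or> y = 1 then 0 else \<Psi>0 x y)"
  have K_meas: "measurable2 K"
    unfolding K_def by measurable
  define gin0 where "gin0 = (\<lambda>x. indicator {0<..} x * gin x)"
  have gin0_meas[measurable]: "gin0 \<in> borel_measurable borel"
  proof -
    have [measurable]: "(\<lambda>x. indicator {0<..} x * ((x powr (-2*\<beta>) + x) * gin x)) \<in> borel_measurable borel"
      using gin unfolding weighted_L1_def set_integrable_def by (auto dest: borel_measurable_integrable)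
    have eq: "gin0 = (\<lambda>x. indicator {0<..} x * ((x powr (-2*\<beta>) + x) * gin x) / (x powr (-2*\<beta>) + x))"
    proof
      fix x :: real
      show "gin0 x = indicator {0<..} x * ((x powr (-2*\<beta>) + x) * gin x) / (x powr (-2*\<beta>) + x)"
        using wt_pos[of x "2 * \<beta>"] by (auto simp: gin0_def wt_def indicator_def)
    qed
    show ?thesis unfolding eq by measurable
  qed
  \<comment> \<open>The positive part turns nonnegativity almost everywhere into nonnegativity at
    every point, as \<open>admissible\<close> demands.\<close>
  define f0 where "f0 = (\<lambda>x. max 0 (gin0 x))"
  have f0_meas[measurable]: "f0 \<in> borel_measurable borel" unfolding f0_def by measurable
  have f0_AE: "AE x in lborel. gin0 x = f0 x"
    using gin_nonneg by eventually_elim (auto simp: f0_def gin0_def indicator_def)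
  have f0_adm: "admissible (2 * \<beta>) f0"
    unfolding admissible_def
  proof (intro conjI f0_meas)
    have "integrable lborel (\<lambda>x. wt (2 * \<beta>) x * gin0 x)"
      using gin unfolding weighted_L1_def set_integrable_def
      by (elim Bochner_Integration.integrable_cong[THEN iffD1, rotated -1]) (auto simp: gin0_def wt_def)
    then show "integrable lborel (\<lambda>x. wt (2 * \<beta>) x * f0 x)"
      by (rule integrable_cong_AE_imp) (use f0_AE in \<open>auto elim!: eventually_mono\<close>)
  qed (auto simp: f0_def gin0_def)
  have KP: "K x y = \<Psi> x y" if "0 < x" "0 < y" "x \<noteq> 1" "y \<noteq> 1" for x y
    using that by (simp add: K_def \<Psi>0_def)
  \<comment> \<open>The factor 2 covers \<open>x + y \<le> 2 * (x * y)\<close> for sizes above 1,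
    and \<open>x + y \<le> 2 * x\<close> for \<open>y \<le> x\<close>.\<close>
  interpret coagulation_problem K \<beta> "2 * k" f0
  proof
    show "0 \<le> K x y" for x y using nonneg by (auto simp: K_def \<Psi>0_def indicator_def)
    show "K x y = K y x" for x y using sym by (auto simp: K_def \<Psi>0_def indicator_def)
    show "K x y \<le> 2 * k * (wt \<beta> x * wt \<beta> y)" if xy: "0 < x" "0 < y" for x y
    proof -
      \<comment> \<open>Restricting to \<open>x \<le> y\<close> puts the mixed case in the order in
        which its bound is assumed; symmetry gives the rest.\<close>
      have main: "\<Psi> x y \<le> 2 * k * (wt \<beta> x * wt \<beta> y)" if xy: "0 < x" "0 < y" "x \<noteq> 1" "y \<noteq> 1" "x \<le> y" for x y
      proof -
        have pos: "0 \<le> k * (wt \<beta> x * wt \<beta> y)" using \<open>k > 0\<close> wt_pos[OF xy(1), of \<beta>] wt_pos[OF xy(2), of \<beta>] by simp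
        consider "x < 1" "y < 1" | "x < 1" "1 < y" | "1 < x" "1 < y" using xy by linarith
        then show ?thesis
        proof cases
          case 1
          have "\<Psi> x y \<le> k * (x * y) powr (-\<beta>)" using b1 xy 1 by blast
          also have "\<dots> = k * (x powr (-\<beta>) * y powr (-\<beta>))" using xy by (simp add: powr_mult)
          also have "\<dots> \<le> k * (wt \<beta> x * wt \<beta> y)"
            using \<open>k > 0\<close> wt_ge_powr[OF xy(1), of \<beta>] wt_ge_powr[OF xy(2), of \<beta>] wt_pos[OF xy(1), of \<beta>]
            by (intro mult_left_mono mult_mono) auto
          finally show ?thesis using pos by simp
        next
          case 2
          have "\<Psi> x y \<le> k * y * x powr (-\<beta>)" using b2 xy 2 by blast
          also have "\<dots> = k * (x powr (-\<beta>) * y)" by simp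
          also have "\<dots> \<le> k * (wt \<beta> x * wt \<beta> y)"
            using \<open>k > 0\<close> xy wt_ge_powr[OF xy(1), of \<beta>] wt_ge_self[OF xy(2), of \<beta>] wt_pos[OF xy(1), of \<beta>]
            by (intro mult_left_mono mult_mono) auto
          finally show ?thesis using pos by simp
        next
          case 3
          have "\<Psi> x y \<le> k * (x + y)" using b3 3 by blast
          also have "\<dots> \<le> k * (2 * (x * y))"
          proof (intro mult_left_mono)
            have "1 * y \<le> x * y" "x * 1 \<le> x * y" using 3 by (intro mult_mono; simp)+
            then show "x + y \<le> 2 * (x * y)" by simp
          qed (use \<open>k > 0\<close> in auto)
          also have "\<dots> \<le> k * (2 * (wt \<beta> x * wt \<beta> y))"
            using \<open>k > 0\<close> xy wt_ge_self[OF xy(1), of \<beta>] wt_ge_self[OF xy(2), of \<beta>] wt_pos[OF xy(1), of \<beta>]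
            by (intro mult_left_mono mult_mono) auto
          finally show ?thesis by simp
        qed
      qed
      have pos: "0 \<le> 2 * k * (wt \<beta> x * wt \<beta> y)" using \<open>k > 0\<close> wt_pos[OF xy(1), of \<beta>] wt_pos[OF xy(2), of \<beta>] by simp
      show ?thesis
      proof (cases "x = 1 \<or> y = 1")
        case True then show ?thesis using pos by (auto simp: K_def)
      next
        case False
        then show ?thesis
          using main[of x y] main[of y x] sym xy KP[of x y] by (cases "x \<le> y") (auto simp: mult_ac)
      qed
    qed
    show "y * K x y \<le> 2 * k * (x * wt \<beta> y)" if xy: "0 < y" "y \<le> x" "1 < x" for x y
    proof -
      have pos: "0 \<le> k * (x * wt \<beta> y)" using \<open>k > 0\<close> xy wt_pos[OF xy(1), of \<beta>] by simp
      consider "y < 1" | "y = 1" | "1 < y" by linarith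
      then show ?thesis
      proof cases
        case 1
        have "K x y = \<Psi> y x" using KP[of x y] 1 xy sym by simp
        also have "\<dots> \<le> k * x * y powr (-\<beta>)" using b2 xy 1 by blast
        finally have "y * K x y \<le> 1 * (k * x * y powr (-\<beta>))"
          using 1 xy nonneg \<open>K x y = \<Psi> y x\<close> by (intro mult_mono) auto
        also have "\<dots> \<le> k * (x * wt \<beta> y)"
          using \<open>k > 0\<close> xy wt_ge_powr[OF xy(1), of \<beta>] by (simp add: mult_ac mult_left_mono)
        finally show ?thesis using pos by simp
      next
        case 2 then show ?thesis using pos by (simp add: K_def)
      next
        case 3
        have "K x y \<le> k * (x + y)" using KP[of x y] b3 3 xy by simp
        also have "\<dots> \<le> k * (2 * x)" using xy \<open>k > 0\<close> by (intro mult_left_mono) auto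
        finally have "y * K x y \<le> wt \<beta> y * (k * (2 * x))"
          using wt_ge_self[OF xy(1), of \<beta>] wt_pos[OF xy(1), of \<beta>] nonneg xy by (intro mult_mono) (auto simp: K_def \<Psi>0_def)
        then show ?thesis by (simp add: mult_ac)
      qed
    qed
  qed (use K_meas \<open>\<beta> > 0\<close> \<open>k > 0\<close> f0_adm in auto)
  obtain F G where "coagulation_limit K \<beta> (2 * k) f0 F G" using coagulation_limit_exists by blast
  then interpret coagulation_limit K \<beta> "2 * k" f0 F G .
  note [measurable] = G_measurable G_section_measurable
  have w_eq: "x powr (-2*\<beta>) + x = wt (2 * \<beta>) x" for x :: real by (simp add: wt_def)
  have gin_int: "(LBINT x:{0<..}. \<omega> x * gin x) = (LBINT x. \<omega> x * f0 x)"
    if [measurable]: "\<omega> \<in> borel_measurable borel" for \<omega>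
  proof -
    have "(LBINT x:{0<..}. \<omega> x * gin x) = (LBINT x. \<omega> x * gin0 x)"
      by (rule integral_lborel_halfline) (auto simp: gin0_def)
    also have "\<dots> = (LBINT x. \<omega> x * f0 x)"
      by (rule integral_cong_AE) (use f0_AE in \<open>auto elim!: eventually_mono\<close>)
    finally show ?thesis .
  qed
  have G_int: "(LBINT x:{0<..}. \<omega> x * G x t) = (LBINT x. \<omega> x * G x t)" for \<omega> t
    by (rule integral_lborel_halfline) (auto simp: G_zero)
  have weak: "set_integrable lborel3 ({0<..<t} \<times> ({0<..} \<times> {0<..}))
           (\<lambda>(s, z, e). (\<omega> (z + e) - \<omega> z - \<omega> e) * \<Psi> z e * G z s * G e s) \<and>
         set_lebesgue_integral lborel {0<..} (\<lambda>z. (G z t - gin z) * \<omega> z) =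
         1/2 * set_lebesgue_integral lborel3 ({0<..<t} \<times> ({0<..} \<times> {0<..}))
           (\<lambda>(s, z, e). (\<omega> (z + e) - \<omega> z - \<omega> e) * \<Psi> z e * G z s * G e s)"
    if t: "0 < t" and \<omega>: "\<omega> \<in> borel_measurable (restrict_space lborel {0<..})"
      and bdd: "AE x in lborel. x > 0 \<longrightarrow> \<bar>\<omega> x\<bar> \<le> B" for t \<omega> B
  proof -
    define \<omega>0 where "\<omega>0 = (\<lambda>x. indicator {0<..} x * \<omega> x)"
    have \<omega>0[measurable]: "\<omega>0 \<in> borel_measurable borel"
      using \<omega> unfolding \<omega>0_def by (subst (asm) borel_measurable_restrict_space_iff) auto
    \<comment> \<open>The test function is bounded only almost everywhere; clamping gives a version
      bounded everywhere that differs from it on a null set.\<close>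
    define \<omega>' where "\<omega>' = (\<lambda>x. max (-\<bar>B\<bar>) (min \<bar>B\<bar> (\<omega>0 x)))"
    have \<omega>'[measurable]: "\<omega>' \<in> borel_measurable borel" unfolding \<omega>'_def by measurable
    have \<omega>'B: "\<bar>\<omega>' x\<bar> \<le> \<bar>B\<bar>" for x unfolding \<omega>'_def by auto
    have \<omega>'_AE: "AE x in lborel. \<omega>0 x = \<omega>' x"
      using bdd by eventually_elim (auto simp: \<omega>0_def \<omega>'_def indicator_def)
    define J where "J = (\<lambda>q. indicator {0<..<t} (fst q) * coag_integrand K \<omega>' (\<lambda>x. G x (fst q)) (snd q))"
    define J0 where "J0 = (\<lambda>q. indicator {0<..<t} (fst q) * coag_integrand \<Psi>0 \<omega>0 (\<lambda>x. G x (fst q)) (snd q))"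
    note J = G_form_integral[OF t \<omega>' \<omega>'B, folded J_def]
    have integrand: "indicator ({0<..<t} \<times> ({0<..} \<times> {0<..})) q *\<^sub>R
        (case q of (s, z, e) \<Rightarrow> (\<omega> (z + e) - \<omega> z - \<omega> e) * \<Psi> z e * G z s * G e s) = J0 q" for q
      by (cases q) (auto simp: J0_def \<omega>0_def \<Psi>0_def indicator_def)
    note [measurable] = measurable_triple(1)[OF \<Psi>0] measurable_triple(2,3)[OF G_measurable]
    have J0_meas: "J0 \<in> borel_measurable lborel3" unfolding J0_def by measurable
    \<comment> \<open>With \<open>x \<noteq> 1\<close> for both coordinates \<open>K\<close> and
      \<open>\<Psi>0\<close> agree, so one null set argument handles kernel and test function
      together.\<close>
    have "AE x in lborel. \<omega>0 x = \<omega>' x \<and> x \<noteq> 1" using \<omega>'_AE AE_lborel_singleton[of "1::real"] by eventually_elim simp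
    from AE_lborel_triple_snd[OF AE_lborel_pair_coordinates[OF this]]
    have J_AE: "AE q in lborel3. J0 q = J q"
      by eventually_elim (simp add: J_def J0_def K_def)
    have J_meas: "J \<in> borel_measurable lborel3" using J(1) by (rule borel_measurable_integrable)
    have J0_int: "integrable lborel3 J0"
      using integrable_cong_AE[OF J0_meas J_meas J_AE] J(1) by simp
    have J0_eq: "(LINT q|lborel3. J0 q) = (LINT q|lborel3. J q)"
      by (rule integral_cong_AE[OF J0_meas J_meas J_AE])
    have adm_int: "integrable lborel (\<lambda>x. \<omega>' x * h x)" if "admissible (2 * \<beta>) h" for h
      by (rule admissible_integral[OF that \<omega>', where B="\<bar>B\<bar>"]) (use bounded_le_wt[OF _ _ \<omega>'B] in auto)
    have "set_lebesgue_integral lborel {0<..} (\<lambda>z. (G z t - gin z) * \<omega> z) =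
        (LBINT z. (G z t - gin0 z) * \<omega>0 z)"
      by (rule integral_lborel_halfline) (auto simp: gin0_def \<omega>0_def)
    also have "\<dots> = (LBINT z. \<omega>' z * G z t - \<omega>' z * f0 z)"
    proof (rule integral_cong_AE)
      show "AE z in lborel. (G z t - gin0 z) * \<omega>0 z = \<omega>' z * G z t - \<omega>' z * f0 z"
        using f0_AE \<omega>'_AE by eventually_elim (simp add: algebra_simps)
    qed measurable
    also have "\<dots> = (LBINT z. \<omega>' z * G z t) - (LBINT z. \<omega>' z * f0 z)"
      using adm_int[OF G_admissible] adm_int[OF f0_adm] t by simp
    also have "\<dots> = 1 / 2 * (LINT q|lborel3. J0 q)"
      unfolding J0_eq J(3) by (rule G_weak_equation[OF t \<omega>' \<omega>'B])
    finally show ?thesis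
      unfolding set_integrable_def set_lebesgue_integral_def integrand using J0_int by simp
  qed
  have "weak_solution \<Psi> \<beta> gin G"
    unfolding weak_solution_def
  proof (intro conjI allI impI)
    show "(\<lambda>(z, t). G z t) \<in> borel_measurable (restrict_space lborel2 ({0<..} \<times> {0..}))"
      using G_measurable by (intro measurable_restrict_space1) (simp add: case_prod_beta')
    show "AE z in lborel. z > 0 \<longrightarrow> G z t \<ge> 0" for t by (simp add: G_nonneg)
    show "set_integrable lborel {0<..} (\<lambda>z. G z t)" if "0 \<le> t" for t
      using integral_lborel_halfline(2)[of "\<lambda>z. G z t" "\<lambda>z. G z t"] G_integrable[OF that] G_zero by simp
    show "((\<lambda>s. LBINT z:{0<..}. \<bar>G z s - G z t\<bar>) \<longlongrightarrow> 0) (at t within {0..})" if t: "0 \<le> t" for t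
    proof (rule Lim_null_comparison)
      have "((\<lambda>s. lip * \<bar>s - t\<bar>) \<longlongrightarrow> lip * \<bar>t - t\<bar>) (at t within {0..})" by (intro tendsto_intros)
      then show "((\<lambda>s. lip * \<bar>s - t\<bar>) \<longlongrightarrow> 0) (at t within {0..})" by simp
      have "norm (LBINT z:{0<..}. \<bar>G z s - G z t\<bar>) \<le> lip * \<bar>s - t\<bar>" if s: "0 \<le> s" for s
      proof -
        have "(LBINT z:{0<..}. \<bar>G z s - G z t\<bar>) = (LBINT z. \<bar>G z s - G z t\<bar>)"
          by (rule integral_lborel_halfline) (auto simp: G_zero)
        then show ?thesis using G_lipschitz[OF t s] by simp
      qed
      then show "\<forall>\<^sub>F s in at t within {0..}. norm (LBINT z:{0<..}. \<bar>G z s - G z t\<bar>) \<le> lip * \<bar>s - t\<bar>"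
        by (auto simp: eventually_at intro!: exI[of _ 1])
    qed
    show "\<exists>C. AE t in lborel. t \<ge> 0 \<longrightarrow> weighted_L1 \<beta> (\<lambda>z. G z t) \<and> weighted_norm \<beta> (\<lambda>z. G z t) \<le> C"
    proof (intro exI AE_I2 impI)
      fix t :: real assume t: "0 \<le> t"
      have "weighted_L1 \<beta> (\<lambda>z. G z t)"
        unfolding weighted_L1_def w_eq
        using integral_lborel_halfline(2)[of _ "\<lambda>z. wt (2 * \<beta>) z * G z t"] admissibleD(4)[OF G_admissible[OF t]] G_zero by simp
      moreover have "weighted_norm \<beta> (\<lambda>z. G z t) = (LBINT z. wt (2 * \<beta>) z * G z t)"
        unfolding weighted_norm_def w_eq by (rule integral_lborel_halfline) (auto simp: G_zero G_nonneg)
      ultimately show "weighted_L1 \<beta> (\<lambda>z. G z t) \<and> weighted_norm \<beta> (\<lambda>z. G z t) \<le> M"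
        using G_norm[OF t] by simp
    qed
  qed (use weak in blast)+
  moreover have "set_lebesgue_integral lborel {0<..} (\<lambda>z. z * G z t) = set_lebesgue_integral lborel {0<..} (\<lambda>z. z * gin z)"
    if "0 \<le> t" for t
    unfolding G_int gin_int[OF measurable_ident]
    using G_mass[OF that] gin_int[of "\<lambda>x. x"] by simp
  ultimately show ?thesis by blast
qed

end
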